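(* Let $\mathcal C$ be one of the classes $\Sigma_{2,\le}$, $\texttt{b-}\Sigma_{2,\le}$, $\texttt{b-}\Sigma^{++}_{2,\le}$. Given a $\mathcal C$-sentence, one can compute in polynomial time an equivalent $\mathcal C$-sentence all of whose atoms involve polynomials of total degree at most four. In particular one can compute in polynomial time an equivalent $\mathcal C$-sentence whose atomic polynomials are given in the standard encoding as lists of (multi-index, coefficient) pairs.
   Context: $\mathcal L$ is the first-order language over the signature $\langle \mathbb Z,+,\times,<,\le\rangle$ with connectives $\land,\lor$ (negation, implication, equality as abbreviations), integer constants in binary, polynomials in atoms given as terms over $\langle\mathbb Z,+,\times\rangle$, interpreted over $\mathbb R$. A $\mathrm{QFF}_\le$-formula is a quantifier-free $\mathcal L$-formula not containing $<$. $I=[-1,1]$; $|X|\le y$ abbreviates $\bigwedge_j(-y\le x_j\le y)$ and $|X|>y$ its negation; $\exists X\in I^m.\forall Y\in I^n.\Phi_0$ abbreviates $\exists X\in\mathbb R^m.\forall Y\in\mathbb R^n.(|Y|>1\lor(|X|\le1\land\Phi_0))$. Classes: $\Sigma_{2,\le}$ = sentences $\exists X\in\mathbb R^m.\forall Y\in\mathbb R^n.\Phi_{0,\le}(X,Y)$; $\texttt{b-}\Sigma_{2,\le}$ = sentences $\exists X\in I^m.\forall Y\in I^n.\Phi_{0,\le}(X,Y)$; $\texttt{b-}\Sigma^{++}_{2,\le}$ = sentences $\exists X\in I^m.\forall Y\in I^n.(\Psi_{0,\le}(Y)\to\Phi_{0,\le}(X,Y))$; here $\Phi_{0,\le},\Psi_{0,\le}$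 are $\mathrm{QFF}_\le$-formulas. Standard encoding of $P\in\mathbb Z[x_1,\dots,x_n]$: a list of pairs $(\alpha_k,c_k)$ with $\alpha_k\in\mathbb N^n$ in unary and $c_k\in\mathbb Z$ in binary such that $P=\sum_kc_kx^{\alpha_k}$. *)

theory Defs
  imports Complex_Main
begin

datatype tm_term = Var nat | Const int | Add tm_term tm_term | Mul tm_term tm_term

fun eval_term :: "tm_term \<Rightarrow> (nat \<Rightarrow> real) \<Rightarrow> real" where
  "eval_term (Var i) x = x i"
| "eval_term (Const c) x = of_int c"
| "eval_term (Add a b) x = eval_term a x + eval_term b x"
| "eval_term (Mul a b) x = eval_term a x * eval_term b x"

fun vars_term :: "tm_term \<Rightarrow> nat set" where
  "vars_term (Var i) = {i}"
| "vars_term (Const c) = {}"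
| "vars_term (Add a b) = vars_term a \<union> vars_term b"
| "vars_term (Mul a b) = vars_term a \<union> vars_term b"

text \<open>Standard encoding of a polynomial: list of (multi-index, coefficient) pairs;
  the multi-index alpha denotes the monomial prod_{i < length alpha} x_i ^ (alpha ! i).\<close>
type_synonym std_poly = "(nat list \<times> int) list"

definition eval_std :: "std_poly \<Rightarrow> (nat \<Rightarrow> real) \<Rightarrow> real" where
  "eval_std P x = (\<Sum>(\<alpha>, c) \<leftarrow> P. of_int c * (\<Prod>i<length \<alpha>. x i ^ (\<alpha> ! i)))"

definition vars_std :: "std_poly \<Rightarrow> nat set" where
  "vars_std P = {i. \<exists>(\<alpha>, c) \<in> set P. i < length \<alpha> \<and> \<alpha> ! i > 0}"

definition std_deg_le :: "std_poly \<Rightarrow> nat \<Rightarrow> bool" where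
  "std_deg_le P d \<longleftrightarrow> (\<forall>(\<alpha>, c) \<in> set P. sum_list \<alpha> \<le> d)"

definition term_deg_le :: "tm_term \<Rightarrow> nat \<Rightarrow> bool" where
  "term_deg_le t d \<longleftrightarrow> (\<exists>P. std_deg_le P d \<and> (\<forall>x. eval_std P x = eval_term t x))"

datatype 'p qff = Le 'p 'p | And "'p qff" "'p qff" | Or "'p qff" "'p qff"

fun eval_qff :: "('p \<Rightarrow> (nat \<Rightarrow> real) \<Rightarrow> real) \<Rightarrow> 'p qff \<Rightarrow> (nat \<Rightarrow> real) \<Rightarrow> bool" where
  "eval_qff ev (Le p q) x = (ev p x \<le> ev q x)"
| "eval_qff ev (And a b) x = (eval_qff ev a x \<and> eval_qff ev b x)"
| "eval_qff ev (Or a b) x = (eval_qff ev a x \<or> eval_qff ev b x)"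

fun polys_qff :: "'p qff \<Rightarrow> 'p set" where
  "polys_qff (Le p q) = {p, q}"
| "polys_qff (And a b) = polys_qff a \<union> polys_qff b"
| "polys_qff (Or a b) = polys_qff a \<union> polys_qff b"

definition vars_qff :: "('p \<Rightarrow> nat set) \<Rightarrow> 'p qff \<Rightarrow> nat set" where
  "vars_qff vs \<Phi> = (\<Union>p \<in> polys_qff \<Phi>. vs p)"

text \<open>In a sentence with parameters m, n the existential block X is x_0..x_{m-1}
  and the universal block Y is x_m..x_{m+n-1}.
  S2 m n Phi:         exists X in R^m. forall Y in R^n. Phi(X,Y)
  BS2 m n Phi:        exists X in I^m. forall Y in I^n. Phi(X,Y)
  BS2pp m n Psi Phi:  exists X in I^m. forall Y in I^n. (Psi(Y) --> Phi(X,Y))\<close>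
datatype 'p sentence = S2 nat nat "'p qff" | BS2 nat nat "'p qff" | BS2pp nat nat "'p qff" "'p qff"

datatype sclass = Sigma2 | BSigma2 | BSigma2pp

definition join :: "nat \<Rightarrow> (nat \<Rightarrow> real) \<Rightarrow> (nat \<Rightarrow> real) \<Rightarrow> nat \<Rightarrow> real" where
  "join m X Y = (\<lambda>i. if i < m then X i else Y (i - m))"

fun holds :: "('p \<Rightarrow> (nat \<Rightarrow> real) \<Rightarrow> real) \<Rightarrow> 'p sentence \<Rightarrow> bool" where
  "holds ev (S2 m n \<Phi>) = (\<exists>X. \<forall>Y. eval_qff ev \<Phi> (join m X Y))"
| "holds ev (BS2 m n \<Phi>) = (\<exists>X. \<forall>Y.
      \<not> (\<forall>j<n. \<bar>Y j\<bar> \<le> 1) \<or> ((\<forall>i<m. \<bar>X i\<bar> \<le> 1) \<and> eval_qff ev \<Phi> (join m X Y)))"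
| "holds ev (BS2pp m n \<Psi> \<Phi>) = (\<exists>X. \<forall>Y.
      \<not> (\<forall>j<n. \<bar>Y j\<bar> \<le> 1) \<or> ((\<forall>i<m. \<bar>X i\<bar> \<le> 1) \<and>
        (eval_qff ev \<Psi> (join m X Y) \<longrightarrow> eval_qff ev \<Phi> (join m X Y))))"

fun in_class :: "('p \<Rightarrow> nat set) \<Rightarrow> sclass \<Rightarrow> 'p sentence \<Rightarrow> bool" where
  "in_class vs Sigma2 (S2 m n \<Phi>) = (vars_qff vs \<Phi> \<subseteq> {..<m+n})"
| "in_class vs BSigma2 (BS2 m n \<Phi>) = (vars_qff vs \<Phi> \<subseteq> {..<m+n})"
| "in_class vs BSigma2pp (BS2pp m n \<Psi> \<Phi>) =
     (vars_qff vs \<Phi> \<subseteq> {..<m+n} \<and> vars_qff vs \<Psi> \<subseteq> {m..<m+n})"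
| "in_class vs c s = False"

fun sentence_polys :: "'p sentence \<Rightarrow> 'p set" where
  "sentence_polys (S2 m n \<Phi>) = polys_qff \<Phi>"
| "sentence_polys (BS2 m n \<Phi>) = polys_qff \<Phi>"
| "sentence_polys (BS2pp m n \<Psi> \<Phi>) = polys_qff \<Psi> \<union> polys_qff \<Phi>"

text \<open>Encode into tokens 0..15, each token then written with 4 bits.
  Tokens: 0,1 binary digits; 2 minus sign; 3 plus sign; 4 end marker; 5 Var; 6 Const;
  7 Add; 8 Mul; 9 Le; 10 And; 11 Or; 12 separator; 13 unary mark; 14 open; 15 close.
  Integers are written in binary, exponents of multi-indices in unary.\<close>
fun binnat :: "nat \<Rightarrow> nat list" where
  "binnat n = (if n = 0 then [] else (n mod 2) # binnat (n div 2))"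

definition enc_nat :: "nat \<Rightarrow> nat list" where
  "enc_nat n = binnat n @ [4]"

definition enc_int :: "int \<Rightarrow> nat list" where
  "enc_int c = (if c < 0 then [2] else [3]) @ binnat (nat \<bar>c\<bar>) @ [4]"

fun enc_term :: "tm_term \<Rightarrow> nat list" where
  "enc_term (Var i) = 5 # enc_nat i"
| "enc_term (Const c) = 6 # enc_int c"
| "enc_term (Add a b) = 7 # enc_term a @ enc_term b"
| "enc_term (Mul a b) = 8 # enc_term a @ enc_term b"

definition enc_std :: "std_poly \<Rightarrow> nat list" where
  "enc_std P = [14] @ concat (map (\<lambda>(\<alpha>, c).
       [14] @ concat (map (\<lambda>k. replicate k 13 @ [12]) \<alpha>) @ [15] @ enc_int c) P) @ [15]"

fun enc_qff :: "('p \<Rightarrow> nat list) \<Rightarrow> 'p qff \<Rightarrow> nat list" where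
  "enc_qff e (Le p q) = 9 # e p @ e q"
| "enc_qff e (And a b) = 10 # enc_qff e a @ enc_qff e b"
| "enc_qff e (Or a b) = 11 # enc_qff e a @ enc_qff e b"

fun enc_sentence :: "('p \<Rightarrow> nat list) \<Rightarrow> 'p sentence \<Rightarrow> nat list" where
  "enc_sentence e (S2 m n \<Phi>) = [0] @ enc_nat m @ enc_nat n @ enc_qff e \<Phi>"
| "enc_sentence e (BS2 m n \<Phi>) = [1] @ enc_nat m @ enc_nat n @ enc_qff e \<Phi>"
| "enc_sentence e (BS2pp m n \<Psi> \<Phi>) = [2] @ enc_nat m @ enc_nat n @ enc_qff e \<Psi> @ enc_qff e \<Phi>"

definition bits4 :: "nat \<Rightarrow> bool list" where
  "bits4 k = [odd k, odd (k div 2), odd (k div 4), odd (k div 8)]"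

definition to_bits :: "nat list \<Rightarrow> bool list" where
  "to_bits ts = concat (map bits4 ts)"

datatype move = MvL | MvR | MvS

text \<open>States 0..tm_states-1, start state 0, halting state 1;
  tape symbols 0..tm_syms-1, blank 0, bit False = 1, bit True = 2.\<close>
record tmachine =
  tm_states :: nat
  tm_syms :: nat
  tm_delta :: "nat \<Rightarrow> nat \<Rightarrow> nat \<times> nat \<times> move"

definition tm_wf :: "tmachine \<Rightarrow> bool" where
  "tm_wf M \<longleftrightarrow> tm_states M \<ge> 2 \<and> tm_syms M \<ge> 3 \<and>
     (\<forall>q < tm_states M. \<forall>s < tm_syms M.
        fst (tm_delta M q s) < tm_states M \<and> fst (snd (tm_delta M q s)) < tm_syms M)"

text \<open>Configuration (q, L, R): L = cells left of the head (nearest first),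
  R = cells from the head to the right; missing cells are blank.\<close>
type_synonym config = "nat \<times> nat list \<times> nat list"

definition tm_step :: "tmachine \<Rightarrow> config \<Rightarrow> config" where
  "tm_step M c = (case c of (q, L, R) \<Rightarrow>
     if q = 1 then c else
     (let s = (case R of [] \<Rightarrow> 0 | x # _ \<Rightarrow> x);
          (q', s', d) = tm_delta M q s;
          R1 = s' # tl R
      in case d of
           MvS \<Rightarrow> (q', L, R1)
         | MvR \<Rightarrow> (q', s' # L, tl R1)
         | MvL \<Rightarrow> (case L of [] \<Rightarrow> (q', [], 0 # R1) | l # L' \<Rightarrow> (q', L', l # R1))))"

definition bit_sym :: "bool \<Rightarrow> nat" where
  "bit_sym b = (if b then 2 else 1)"

definition tm_run :: "tmachine \<Rightarrow> bool list \<Rightarrow> nat \<Rightarrow> config" where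
  "tm_run M w t = (tm_step M ^^ t) (0, [], map bit_sym w)"

definition tm_output :: "config \<Rightarrow> bool list" where
  "tm_output c = map (\<lambda>s. s = 2) (takeWhile (\<lambda>s. s = 1 \<or> s = 2) (snd (snd c)))"

definition poly_time_computable :: "(bool list \<Rightarrow> bool list) \<Rightarrow> bool" where
  "poly_time_computable f \<longleftrightarrow> (\<exists>M k. tm_wf M \<and> (\<forall>w. \<exists>t \<le> k * (length w + 1) ^ k.
      fst (tm_run M w t) = 1 \<and> tm_output (tm_run M w t) = f w))"

end

(* Idea. Every subterm t is given universal variables l, u, d, read as an interval (l/d, u/d). The new
   formula says: if d > 0 and each interval strictly contains the one computed from the intervals of
   the children, then the old formula holds with every atom p <= q weakened to l_p/d_p <= u_q/d_q.
   The premises are strict, so their negations are non-strict, as required; after clearing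
   denominators all degrees are at most 3. One direction is interval arithmetic, the other lets the
   radii tend to 0. As d is free, l, u and d can be scaled into [-1, 1], so the same formula serves the
   bounded classes. In the premise Psi of the third class the values are instead exact ratios z/e
   with z^2 + e^2 = 1 and e >= 0.

   Variables are named by positions in the input, so the output consists of copies of fixed
   templates, one for each position or pair of positions, and is printed by nested loops over the
   input. Such loop programs run in polynomial time on a Turing machine whose tape cells store an
   input token, the unary registers and an output bit: each elementary command is one sweep. *)
theory Submission
  imports Defs
begin

text \<open>The obvious reduction names every subterm by a new variable with an equation such as z =
  x * y. The new variables depend on Y, so they cannot be existential. As universal variables they
  put the equations in front of an implication, where they are negated and turn into strict
  inequalities. Open conditions have closed negations, which is why intervals replace equations. The
  price is that a value is known only up to a radius; it is recovered in the limit because a formula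
  built from non-strict atoms by conjunction and disjunction defines a closed set. In the third
  class the part \<Psi> already stands in front of the implication, so the roles are exchanged:
  equations are admissible there and open conditions are not. Constants and repeated squaring give
  subterms doubly exponential values even over [-1, 1], which is why values are represented by
  ratios instead of being scaled by a common constant.\<close>

section \<open>A loop language on registers\<close>

text \<open>Loops run over the positions of the input word only, so every program terminates after
  polynomially many steps on every input, well-formed or not.\<close>

datatype tst = Tok nat "nat set" | Less nat nat | Neq nat nat
datatype cmd = Inc nat | Zero nat | Copy nat nat | Out bool | Skip
  | Seq cmd cmd | If tst cmd cmd | Loop nat cmd

type_synonym regs = "nat \<Rightarrow> nat"

primrec tsem :: "nat list \<Rightarrow> regs \<Rightarrow> tst \<Rightarrow> bool" where
  "tsem W \<sigma> (Tok r S) = (\<sigma> r < length W \<and> W ! \<sigma> r \<in> S)"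
| "tsem W \<sigma> (Less r s) = (\<sigma> r < \<sigma> s)"
| "tsem W \<sigma> (Neq r s) = (\<sigma> r \<noteq> \<sigma> s)"

primrec floop :: "(regs \<Rightarrow> regs \<times> bool list) \<Rightarrow> nat \<Rightarrow> nat list \<Rightarrow> regs \<Rightarrow> regs \<times> bool list" where
  "floop F i [] \<sigma> = (\<sigma>, [])"
| "floop F i (j # js) \<sigma> =
    (let (\<sigma>1, o1) = F (\<sigma>(i := j)); (\<sigma>2, o2) = floop F i js \<sigma>1 in (\<sigma>2, o1 @ o2))"

text \<open>A loop starts at the current value of its counter, so that what is left after one
  iteration is again a loop and can be pushed back as a continuation. The reset on exit hides the
  difference between the last index, where \<open>floop\<close> leaves the counter, and the length
  of the word, where a machine that increments it does.\<close>

primrec run :: "nat list \<Rightarrow> cmd \<Rightarrow> regs \<Rightarrow> regs \<times> bool list" where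
  "run W (Inc r) \<sigma> = (\<sigma>(r := Suc (\<sigma> r)), [])"
| "run W (Zero r) \<sigma> = (\<sigma>(r := 0), [])"
| "run W (Copy r s) \<sigma> = (\<sigma>(r := \<sigma> s), [])"
| "run W (Out b) \<sigma> = (\<sigma>, [b])"
| "run W Skip \<sigma> = (\<sigma>, [])"
| "run W (Seq c d) \<sigma> =
    (let (\<sigma>1, o1) = run W c \<sigma>; (\<sigma>2, o2) = run W d \<sigma>1 in (\<sigma>2, o1 @ o2))"
| "run W (If T c d) \<sigma> = (if tsem W \<sigma> T then run W c \<sigma> else run W d \<sigma>)"
| "run W (Loop i c) \<sigma> =
    (let (\<sigma>1, o1) = floop (run W c) i [\<sigma> i..<length W] \<sigma> in (\<sigma>1(i := 0), o1))"

primrec mods :: "cmd \<Rightarrow> nat set" where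
  "mods (Inc r) = {r}"
| "mods (Zero r) = {r}"
| "mods (Copy r s) = {r}"
| "mods (Out b) = {}"
| "mods Skip = {}"
| "mods (Seq c d) = mods c \<union> mods d"
| "mods (If T c d) = mods c \<union> mods d"
| "mods (Loop i c) = insert i (mods c)"

primrec treg :: "tst \<Rightarrow> nat set" where
  "treg (Tok r S) = {r}" | "treg (Less r s) = {r, s}" | "treg (Neq r s) = {r, s}"

primrec regset :: "cmd \<Rightarrow> nat set" where
  "regset (Inc r) = {r}"
| "regset (Zero r) = {r}"
| "regset (Copy r s) = {r, s}"
| "regset (Out b) = {}"
| "regset Skip = {}"
| "regset (Seq c d) = regset c \<union> regset d"
| "regset (If T c d) = treg T \<union> regset c \<union> regset d"
| "regset (Loop i c) = insert i (regset c)"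

text \<open>\<open>floop\<close> sets the counter before each iteration whereas the machine
  increments it afterwards; the two agree because the body leaves the counter alone.\<close>

primrec wfc :: "cmd \<Rightarrow> bool" where
  "wfc (Inc r) = True"
| "wfc (Zero r) = True"
| "wfc (Copy r s) = True"
| "wfc (Out b) = True"
| "wfc Skip = True"
| "wfc (Seq c d) = (wfc c \<and> wfc d)"
| "wfc (If T c d) = (wfc c \<and> wfc d)"
| "wfc (Loop i c) = (i \<notin> mods c \<and> wfc c)"

text \<open>A bound on the number of sweeps. Besides its body each iteration pays for the test and
  the increment; leaving the loop costs the last test and the reset. Charging both branches of a
  conditional makes the bound a function of the length alone.\<close>

primrec cost :: "cmd \<Rightarrow> nat \<Rightarrow> nat" where
  "cost (Inc r) n = 1"
| "cost (Zero r) n = 1"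
| "cost (Copy r s) n = 1"
| "cost (Out b) n = 1"
| "cost Skip n = 1"
| "cost (Seq c d) n = 1 + cost c n + cost d n"
| "cost (If T c d) n = 1 + cost c n + cost d n"
| "cost (Loop i c) n = 2 + n * (cost c n + 2)"

lemma floop_unmod:
  assumes "\<And>\<sigma>. fst (F \<sigma>) r = \<sigma> r" "r \<noteq> i"
  shows "fst (floop F i js \<sigma>) r = \<sigma> r"
proof (induction js arbitrary: \<sigma>)
  case (Cons j js)
  show ?case using Cons.IH[of "fst (F (\<sigma>(i := j)))"] assms
    by (simp add: case_prod_unfold Let_def)
qed simp

lemma run_unmod: "r \<notin> mods c \<Longrightarrow> fst (run W c \<sigma>) r = \<sigma> r"
proof (induction c arbitrary: \<sigma>)
  case (Loop i c)
  then show ?case using floop_unmod[of "run W c" r i] by (simp add: case_prod_unfold Let_def)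
qed (auto simp: case_prod_unfold Let_def)

section \<open>Execution by sweeps over a tape\<close>

text \<open>\<open>Raw\<close> cells are the bits of the input before the first sweep and those of
  the output after the last, where \<open>Junk\<close> ends the output. In between a
  \<open>Cell\<close> holds an input token, a mark for each register and an output bit.\<close>

datatype sym = Blank | Raw bool | Cell "nat option" "nat set" "bool option" | Junk
datatype mst = Init "bool list" | Run "cmd list" | Pass "cmd list" | Done

text \<open>A left-to-right scan decides a test at the first cell that answers \<open>Some\<close>;
  no answer up to the end of the tape means that the test is false. For \<open>Tok\<close> the
  deciding cell is the one that the register points to, for the comparisons a cell marked for one
  register and not for the other.\<close>

primrec tcell :: "tst \<Rightarrow> nat option \<Rightarrow> nat set \<Rightarrow> bool option" where
  "tcell (Tok r S) a M = (if r \<in> M then None else Some (a \<in> Some ` S))"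
| "tcell (Less r s) a M = (if r \<notin> M \<and> s \<in> M then Some True else None)"
| "tcell (Neq r s) a M = (if (r \<in> M) \<noteq> (s \<in> M) then Some True else None)"

definition tokval :: "bool list \<Rightarrow> nat" where
  "tokval bs = (if bs ! 0 then 1 else 0) + (if bs ! 1 then 2 else 0)
     + (if bs ! 2 then 4 else 0) + (if bs ! 3 then 8 else 0)"

fun stepc :: "cmd \<Rightarrow> cmd list \<Rightarrow> nat option \<Rightarrow> nat set \<Rightarrow> bool option \<Rightarrow> mst \<times> sym" where
  "stepc (Inc r) k a M o' =
    (if r \<in> M then (Run (Inc r # k), Cell a M o') else (Pass k, Cell a (insert r M) o'))"
| "stepc (Zero r) k a M o' = (Run (Zero r # k), Cell a (M - {r}) o')"
| "stepc (Copy r s) k a M o' =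
    (Run (Copy r s # k), Cell a (if s \<in> M then insert r M else M - {r}) o')"
| "stepc (Out b) k a M o' =
    (if o' \<noteq> None then (Run (Out b # k), Cell a M o') else (Pass k, Cell a M (Some b)))"
| "stepc Skip k a M o' = (Run (Skip # k), Cell a M o')"
| "stepc (Seq c d) k a M o' = (Run (Seq c d # k), Cell a M o')"
| "stepc (If T c d) k a M o' = (case tcell T a M of
      None \<Rightarrow> Run (If T c d # k) | Some b \<Rightarrow> Pass ((if b then c else d) # k), Cell a M o')"
| "stepc (Loop i c) k a M o' = (case tcell (Tok i UNIV) a M of
      None \<Rightarrow> Run (Loop i c # k)
    | Some b \<Rightarrow> Pass (if b then c # Inc i # Loop i c # k else Zero i # k), Cell a M o')"

text \<open>Input bits turn into cells in place: three cells of each block get the dummy token 16,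
  which lies outside the range of real tokens, and the fourth gets the token of the block. Nothing
  has to be moved, so a single sweep decodes a word of any length.\<close>

fun mealy :: "mst \<Rightarrow> sym \<Rightarrow> mst \<times> sym" where
  "mealy (Init bs) (Raw b) =
    (if length bs = 3 then (Init [], Cell (Some (tokval (bs @ [b]))) {} None)
     else (Init (bs @ [b]), Cell (Some 16) {} None))"
| "mealy (Run []) (Cell a M o') = (Run [], case o' of Some b \<Rightarrow> Raw b | None \<Rightarrow> Junk)"
| "mealy (Run (c # k)) (Cell a M o') = stepc c k a M o'"
| "mealy q x = (q, x)"

text \<open>At the right end, \<open>Inc\<close> and \<open>Out\<close> have found every cell filled
  and append one; a test has found no deciding cell and is false, which for a loop means
  exit.\<close>

fun endc :: "cmd \<Rightarrow> cmd list \<Rightarrow> mst \<times> sym option" where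
  "endc (Inc r) k = (Run k, Some (Cell None {r} None))"
| "endc (Zero r) k = (Run k, None)"
| "endc (Copy r s) k = (Run k, None)"
| "endc (Out b) k = (Run k, Some (Cell None {} (Some b)))"
| "endc Skip k = (Run k, None)"
| "endc (Seq c d) k = (Run (c # d # k), None)"
| "endc (If T c d) k = (Run (d # k), None)"
| "endc (Loop i c) k = (Run (Zero i # k), None)"

fun endm :: "cmd \<Rightarrow> mst \<Rightarrow> mst \<times> sym option" where
  "endm P (Init bs) = (Run [P], None)"
| "endm P (Pass k) = (Run k, None)"
| "endm P (Run []) = (Done, None)"
| "endm P (Run (c # k)) = endc c k"
| "endm P Done = (Done, None)"

fun sweep :: "cmd \<Rightarrow> mst \<times> sym list \<Rightarrow> mst \<times> sym list" where
  "sweep P (q, []) = (case endm P q of (q', z) \<Rightarrow> (q', case z of None \<Rightarrow> [] | Some c \<Rightarrow> [c]))"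
| "sweep P (q, x # xs) = (case mealy q x of (q1, y) \<Rightarrow>
     (case sweep P (q1, xs) of (q2, ys) \<Rightarrow> (q2, y # ys)))"

lemma sweep_len: "length (snd (sweep P (q, xs))) \<le> Suc (length xs)"
  by (induction xs arbitrary: q) (auto split: prod.splits option.splits, metis snd_conv)

text \<open>Registers are coded like thermometers: cell i is filled for register r iff i < \<open>\<sigma> r\<close>. Increment
  and test are then left-to-right scans for the first unfilled cell.\<close>

definition mkcell :: "nat set \<Rightarrow> nat list \<Rightarrow> regs \<Rightarrow> bool list \<Rightarrow> nat \<Rightarrow> sym" where
  "mkcell G W \<sigma> out i = Cell (if i < length W then Some (W ! i) else None) {r \<in> G. i < \<sigma> r}
     (if i < length out then Some (out ! i) else None)"

definition rep :: "nat set \<Rightarrow> nat list \<Rightarrow> regs \<Rightarrow> bool list \<Rightarrow> sym list \<Rightarrow> bool" where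
  "rep G W \<sigma> out cs \<longleftrightarrow> length W \<le> length cs \<and> (\<forall>r\<in>G. \<sigma> r \<le> length cs) \<and> length out \<le> length cs
     \<and> (\<forall>i < length cs. cs ! i = mkcell G W \<sigma> out i)"

lemma sweep_Pass: "sweep P (Pass k, xs) = (Run k, xs)"
proof (induction xs)
  case (Cons x xs) then show ?case by (cases x) auto
qed simp

lemma sweep_stay:
  assumes "\<And>x. x \<in> set xs \<Longrightarrow> mealy q x = (q, g x)"
  shows "sweep P (q, xs @ ys) = (case sweep P (q, ys) of (q', zs) \<Rightarrow> (q', map g xs @ zs))"
  using assms by (induction xs) (auto split: prod.splits)

text \<open>The scheme shared by \<open>Inc\<close> and \<open>Out\<close>: the scan skips the
  \<open>v\<close> filled cells, and the first free place is the next cell or, if there is none, a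
  new one behind the last.\<close>

lemma sweep_fill:
  assumes stay: "\<And>i. i < v \<Longrightarrow> mealy q (cs ! i) = (q, cs ! i)"
    and v: "v \<le> length cs"
    and hit: "v < length cs \<Longrightarrow> mealy q (cs ! v) = (Pass k, y)"
    and at_end: "v = length cs \<Longrightarrow> endm P q = (Run k, Some y)"
  shows "sweep P (q, cs) = (Run k, if v < length cs then cs[v := y] else cs @ [y])"
proof -
  have 1: "sweep P (q, take v cs @ drop v cs) =
      (case sweep P (q, drop v cs) of (q', zs) \<Rightarrow> (q', map id (take v cs) @ zs))"
    by (rule sweep_stay) (use stay v in \<open>auto simp: in_set_conv_nth\<close>)
  show ?thesis
  proof (cases "v < length cs")
    case True
    then have "drop v cs = cs ! v # drop (Suc v) cs" by (rule Cons_nth_drop_Suc[symmetric])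
    with 1 hit True have "sweep P (q, take v cs @ drop v cs) = (Run k, take v cs @ y # drop (Suc v) cs)"
      by (simp add: sweep_Pass)
    then show ?thesis using True by (simp add: upd_conv_take_nth_drop del: sweep.simps)
  next
    case False
    then show ?thesis using 1 v at_end by simp
  qed
qed

lemma sweep_map:
  assumes "\<And>x. x \<in> set cs \<Longrightarrow> mealy q x = (q, g x)" "endm P q = (q', None)"
  shows "sweep P (q, cs) = (q', map g cs)"
  using sweep_stay[of cs q g P "[]"] assms by simp

lemma sweep_test:
  assumes v: "v \<le> length cs"
    and stay: "\<And>i. i < v \<Longrightarrow> mealy q (cs ! i) = (q, cs ! i)"
    and hit: "v < length cs \<Longrightarrow> mealy q (cs ! v) = (Pass k, cs ! v)"
    and at_end: "v = length cs \<Longrightarrow> endm P q = (Run k, None)"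
  shows "sweep P (q, cs) = (Run k, cs)"
proof -
  have 1: "sweep P (q, take v cs @ drop v cs) =
      (case sweep P (q, drop v cs) of (q', zs) \<Rightarrow> (q', map id (take v cs) @ zs))"
    by (rule sweep_stay) (use stay v in \<open>auto simp: in_set_conv_nth\<close>)
  show ?thesis
  proof (cases "v < length cs")
    case True
    then have *: "drop v cs = cs ! v # drop (Suc v) cs" by (rule Cons_nth_drop_Suc[symmetric])
    with 1 hit True have "sweep P (q, take v cs @ drop v cs) = (Run k, take v cs @ drop v cs)"
      by (simp add: sweep_Pass)
    then show ?thesis by simp
  next
    case False
    then show ?thesis using 1 v at_end by simp
  qed
qed

lemma sweep_Inc:
  assumes "rep G W \<sigma> out cs" "r \<in> G"
  shows "\<exists>cs'. sweep P (Run (Inc r # k), cs) = (Run k, cs') \<and> rep G W (\<sigma>(r := Suc (\<sigma> r))) out cs'"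
proof -
  let ?y = "mkcell G W (\<sigma>(r := Suc (\<sigma> r))) out (\<sigma> r)"
  let ?cs = "if \<sigma> r < length cs then cs[\<sigma> r := ?y] else cs @ [?y]"
  have le: "\<sigma> r \<le> length cs" using assms by (auto simp: rep_def)
  have eq: "\<And>i. i < length cs \<Longrightarrow> cs ! i = mkcell G W \<sigma> out i" using assms by (auto simp: rep_def)
  have "sweep P (Run (Inc r # k), cs) = (Run k, ?cs)"
  proof (rule sweep_fill)
    show "\<sigma> r \<le> length cs" by fact
    fix i assume "i < \<sigma> r"
    then show "mealy (Run (Inc r # k)) (cs ! i) = (Run (Inc r # k), cs ! i)"
      using le assms(2) by (simp add: eq mkcell_def)
  next
    assume "\<sigma> r < length cs"
    then show "mealy (Run (Inc r # k)) (cs ! \<sigma> r) = (Pass k, ?y)"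
      using assms(2) by (auto simp: eq mkcell_def)
  next
    assume v: "\<sigma> r = length cs"
    \<comment> \<open>Every other register is at most the old length, so the appended cell is marked
      for \<open>r\<close> alone.\<close>
    have "r' = r" if "r' \<in> G" "\<sigma> r < (\<sigma>(r := Suc (\<sigma> r))) r'" for r'
      using that assms(1) v by (cases "r' = r") (fastforce simp: rep_def)+
    then show "endm P (Run (Inc r # k)) = (Run k, Some ?y)"
      using v assms by (auto simp: mkcell_def rep_def)
  qed
  moreover have "rep G W (\<sigma>(r := Suc (\<sigma> r))) out ?cs"
  proof (cases "\<sigma> r < length cs")
    case True
    then show ?thesis using assms by (auto simp: rep_def nth_list_update mkcell_def)
  next
    case False
    then have "\<sigma> r = length cs" using le by simp
    then show ?thesis using assms by (auto simp: rep_def nth_append mkcell_def less_Suc_eq)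
  qed
  ultimately show ?thesis by blast
qed

lemma sweep_Out:
  assumes "rep G W \<sigma> out cs"
  shows "\<exists>cs'. sweep P (Run (Out b # k), cs) = (Run k, cs') \<and> rep G W \<sigma> (out @ [b]) cs'"
proof -
  let ?y = "mkcell G W \<sigma> (out @ [b]) (length out)"
  let ?cs = "if length out < length cs then cs[length out := ?y] else cs @ [?y]"
  have le: "length out \<le> length cs" using assms by (auto simp: rep_def)
  have eq: "\<And>i. i < length cs \<Longrightarrow> cs ! i = mkcell G W \<sigma> out i" using assms by (auto simp: rep_def)
  have "sweep P (Run (Out b # k), cs) = (Run k, ?cs)"
  proof (rule sweep_fill)
    show "length out \<le> length cs" by fact
    fix i assume "i < length out"
    then show "mealy (Run (Out b # k)) (cs ! i) = (Run (Out b # k), cs ! i)"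
      using le by (simp add: eq mkcell_def)
  next
    assume "length out < length cs"
    then show "mealy (Run (Out b # k)) (cs ! length out) = (Pass k, ?y)"
      by (auto simp: eq mkcell_def)
  next
    assume v: "length out = length cs"
    then have "(out @ [b]) ! length cs = b" by (metis nth_append_length)
    with v show "endm P (Run (Out b # k)) = (Run k, Some ?y)"
      using assms by (auto simp: mkcell_def rep_def)
  qed
  moreover have "rep G W \<sigma> (out @ [b]) ?cs"
  proof (cases "length out < length cs")
    case True
    then show ?thesis using assms by (auto simp: rep_def nth_list_update mkcell_def nth_append)
  next
    case False
    then have "length out = length cs" using le by simp
    then show ?thesis using assms by (auto simp: rep_def nth_append mkcell_def less_Suc_eq split: if_splits)
  qed
  ultimately show ?thesis by blast
qed

lemma rep_cell: "rep G W \<sigma> out cs \<Longrightarrow> x \<in> set cs \<Longrightarrow> \<exists>a M o'. x = Cell a M o'"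
  by (auto simp: rep_def in_set_conv_nth mkcell_def)

fun cellmap :: "(nat set \<Rightarrow> nat set) \<Rightarrow> sym \<Rightarrow> sym" where
  "cellmap f (Cell a M o') = Cell a (f M) o'" | "cellmap f x = x"

lemma sweep_Zero:
  assumes "rep G W \<sigma> out cs"
  shows "\<exists>cs'. sweep P (Run (Zero r # k), cs) = (Run k, cs') \<and> rep G W (\<sigma>(r := 0)) out cs'"
proof -
  have "sweep P (Run (Zero r # k), cs) = (Run k, map (cellmap (\<lambda>M. M - {r})) cs)"
    by (rule sweep_map) (use rep_cell[OF assms] in force)+
  moreover have "rep G W (\<sigma>(r := 0)) out (map (cellmap (\<lambda>M. M - {r})) cs)"
    using assms by (auto simp: rep_def mkcell_def)
  ultimately show ?thesis by blast
qed

lemma sweep_Copy: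
  assumes "rep G W \<sigma> out cs" "r \<in> G" "s \<in> G"
  shows "\<exists>cs'. sweep P (Run (Copy r s # k), cs) = (Run k, cs') \<and> rep G W (\<sigma>(r := \<sigma> s)) out cs'"
proof -
  let ?f = "cellmap (\<lambda>M. if s \<in> M then insert r M else M - {r})"
  have "sweep P (Run (Copy r s # k), cs) = (Run k, map ?f cs)"
    by (rule sweep_map) (use rep_cell[OF assms(1)] in force)+
  moreover have "rep G W (\<sigma>(r := \<sigma> s)) out (map ?f cs)"
    using assms by (auto simp: rep_def mkcell_def)
  ultimately show ?thesis by blast
qed

lemma sweep_nop:
  assumes "rep G W \<sigma> out cs" "\<And>a M o'. mealy q (Cell a M o') = (q, Cell a M o')"
    "endm P q = (q', None)"
  shows "sweep P (q, cs) = (q', cs)"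
  using sweep_map[of cs q id P q'] rep_cell[OF assms(1)] assms by fastforce

text \<open>The deciding cell is \<open>\<sigma> r\<close> for \<open>Tok\<close> and for a true
  \<open>Less\<close>, and the smaller of the two values for a true \<open>Neq\<close>. A false
  comparison has none, which is expressed by taking the length of the tape for
  \<open>v\<close>.\<close>

lemma tcell_first:
  assumes R: "rep G W \<sigma> out cs" and T: "treg T \<subseteq> G"
  obtains v where "v \<le> length cs"
    "\<And>i. i < v \<Longrightarrow> \<exists>a M o'. cs ! i = Cell a M o' \<and> tcell T a M = None"
    "v < length cs \<Longrightarrow> \<exists>a M o'. cs ! v = Cell a M o' \<and> tcell T a M = Some (tsem W \<sigma> T)"
    "v = length cs \<Longrightarrow> \<not> tsem W \<sigma> T"
proof -
  have eq: "\<And>i. i < length cs \<Longrightarrow> cs ! i = mkcell G W \<sigma> out i" using R by (auto simp: rep_def)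
  let ?a = "\<lambda>i. if i < length W then Some (W ! i) else None"
  let ?M = "\<lambda>i. {r \<in> G. i < \<sigma> r}"
  have W: "length W \<le> length cs" using R by (simp add: rep_def)
  have "\<exists>v \<le> length cs. (\<forall>i < v. tcell T (?a i) (?M i) = None)
     \<and> (v < length cs \<longrightarrow> tcell T (?a v) (?M v) = Some (tsem W \<sigma> T))
     \<and> (v = length cs \<longrightarrow> \<not> tsem W \<sigma> T)"
  proof (cases T)
    case (Tok r S)
    then have "\<sigma> r \<le> length cs" using R T by (auto simp: rep_def)
    then show ?thesis using Tok T W by (intro exI[of _ "\<sigma> r"]) auto
  next
    case (Less r s)
    then have "\<sigma> r \<le> length cs" "\<sigma> s \<le> length cs" using R T by (auto simp: rep_def)
    then show ?thesis using Less T
      by (intro exI[of _ "if \<sigma> r < \<sigma> s then \<sigma> r else length cs"]) auto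
  next
    case (Neq r s)
    then have "\<sigma> r \<le> length cs" "\<sigma> s \<le> length cs" using R T by (auto simp: rep_def)
    then show ?thesis using Neq T
      by (intro exI[of _ "if \<sigma> r \<noteq> \<sigma> s then min (\<sigma> r) (\<sigma> s) else length cs"])
        (auto simp: min_def)
  qed
  then obtain v where "v \<le> length cs" "\<forall>i < v. tcell T (?a i) (?M i) = None"
    "v < length cs \<Longrightarrow> tcell T (?a v) (?M v) = Some (tsem W \<sigma> T)"
    "v = length cs \<Longrightarrow> \<not> tsem W \<sigma> T" by blast
  then show ?thesis by (intro that[of v]) (auto simp: eq mkcell_def)
qed

lemma sweep_If:
  assumes R: "rep G W \<sigma> out cs" and T: "treg T \<subseteq> G"
  shows "sweep P (Run (If T c d # k), cs) = (Run ((if tsem W \<sigma> T then c else d) # k), cs)"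
proof -
  obtain v where v: "v \<le> length cs"
    "\<And>i. i < v \<Longrightarrow> \<exists>a M o'. cs ! i = Cell a M o' \<and> tcell T a M = None"
    "v < length cs \<Longrightarrow> \<exists>a M o'. cs ! v = Cell a M o' \<and> tcell T a M = Some (tsem W \<sigma> T)"
    "v = length cs \<Longrightarrow> \<not> tsem W \<sigma> T"
    using tcell_first[OF R T] by blast
  show ?thesis
    by (rule sweep_test[of v]) (use v in \<open>fastforce+\<close>)
qed

lemma sweep_Loop:
  assumes R: "rep G W \<sigma> out cs" and T: "i \<in> G"
  shows "sweep P (Run (Loop i c # k), cs)
    = (Run (if \<sigma> i < length W then c # Inc i # Loop i c # k else Zero i # k), cs)"
proof -
  obtain v where v: "v \<le> length cs"
    "\<And>j. j < v \<Longrightarrow> \<exists>a M o'. cs ! j = Cell a M o' \<and> tcell (Tok i UNIV) a M = None"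
    "v < length cs \<Longrightarrow> \<exists>a M o'. cs ! v = Cell a M o' \<and> tcell (Tok i UNIV) a M = Some (tsem W \<sigma> (Tok i UNIV))"
    "v = length cs \<Longrightarrow> \<not> tsem W \<sigma> (Tok i UNIV)"
    using tcell_first[OF R, of "Tok i UNIV"] T by (metis empty_subsetI insert_subset treg.simps(1))
  show ?thesis
    by (rule sweep_test[of v]) (use v in \<open>fastforce simp del: tcell.simps\<close>)+
qed

lemma sweep_Skip: "rep G W \<sigma> out cs \<Longrightarrow> sweep P (Run (Skip # k), cs) = (Run k, cs)"
  by (rule sweep_nop) auto

lemma sweep_Seq: "rep G W \<sigma> out cs \<Longrightarrow> sweep P (Run (Seq c d # k), cs) = (Run (c # d # k), cs)"
  by (rule sweep_nop) auto

definition reach :: "cmd \<Rightarrow> nat \<Rightarrow> mst \<times> sym list \<Rightarrow> mst \<times> sym list \<Rightarrow> bool" where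
  "reach P b x y \<longleftrightarrow> (\<exists>t \<le> b. (sweep P ^^ t) x = y)"

lemma reach_trans: "reach P a x y \<Longrightarrow> reach P b y z \<Longrightarrow> reach P (a + b) x z"
  unfolding reach_def
  by (metis (no_types, lifting) add.commute add_mono comp_apply funpow_add)

lemma reach_step: "sweep P x = y \<Longrightarrow> reach P 1 x y"
  unfolding reach_def by (intro exI[of _ 1]) auto

lemma reach_mono: "reach P a x y \<Longrightarrow> a \<le> b \<Longrightarrow> reach P b x y"
  unfolding reach_def using le_trans by blast

theorem run_reach:
  assumes "wfc c" "regset c \<subseteq> G" "rep G W \<sigma> out cs"
  shows "\<exists>cs'. reach P (cost c (length W)) (Run (c # k), cs) (Run k, cs')
     \<and> rep G W (fst (run W c \<sigma>)) (out @ snd (run W c \<sigma>)) cs'"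
  using assms
proof (induction c arbitrary: \<sigma> out cs k)
  case (Inc r)
  then obtain cs' where 1: "sweep P (Run (Inc r # k), cs) = (Run k, cs')"
    and 2:    "rep G W (fst (run W (Inc r) \<sigma>)) (out @ snd (run W (Inc r) \<sigma>)) cs'"
    using sweep_Inc[of G W \<sigma> out cs r P k] by auto
  show ?case using reach_step[OF 1] 2 unfolding cost.simps by blast
next
  case (Zero r)
  then obtain cs' where 1: "sweep P (Run (Zero r # k), cs) = (Run k, cs')"
    and 2:    "rep G W (fst (run W (Zero r) \<sigma>)) (out @ snd (run W (Zero r) \<sigma>)) cs'"
    using sweep_Zero[of G W \<sigma> out cs P r k] by auto
  show ?case using reach_step[OF 1] 2 unfolding cost.simps by blast
next
  case (Copy r s)
  then obtain cs' where 1: "sweep P (Run (Copy r s # k), cs) = (Run k, cs')"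
    and 2:    "rep G W (fst (run W (Copy r s) \<sigma>)) (out @ snd (run W (Copy r s) \<sigma>)) cs'"
    using sweep_Copy[of G W \<sigma> out cs r s P k] by auto
  show ?case using reach_step[OF 1] 2 unfolding cost.simps by blast
next
  case (Out b)
  then obtain cs' where 1: "sweep P (Run (Out b # k), cs) = (Run k, cs')"
    and 2:    "rep G W (fst (run W (Out b) \<sigma>)) (out @ snd (run W (Out b) \<sigma>)) cs'"
    using sweep_Out[of G W \<sigma> out cs P b k] by auto
  show ?case using reach_step[OF 1] 2 unfolding cost.simps by blast
next
  case Skip
  then show ?case using reach_step[OF sweep_Skip[of G W \<sigma> out cs P k]] by (intro exI[of _ cs]) simp
next
  case (Seq c d)
  have 0: "reach P 1 (Run (Seq c d # k), cs) (Run (c # d # k), cs)"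
    using Seq.prems by (intro reach_step sweep_Seq)
  obtain c1 where 1: "reach P (cost c (length W)) (Run (c # d # k), cs) (Run (d # k), c1)"
    "rep G W (fst (run W c \<sigma>)) (out @ snd (run W c \<sigma>)) c1"
    using Seq.IH(1)[of \<sigma> out cs "d # k"] Seq.prems by auto
  obtain c2 where 2: "reach P (cost d (length W)) (Run (d # k), c1) (Run k, c2)"
    "rep G W (fst (run W d (fst (run W c \<sigma>)))) ((out @ snd (run W c \<sigma>)) @ snd (run W d (fst (run W c \<sigma>)))) c2"
    using Seq.IH(2)[OF _ _ 1(2), of k] Seq.prems by auto
  show ?case
    using reach_trans[OF reach_trans[OF 0 1(1)] 2(1)] 2(2)
    by (intro exI[of _ c2]) (auto simp: case_prod_unfold Let_def)
next
  case (If T c d)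
  let ?e = "if tsem W \<sigma> T then c else d"
  have 0: "reach P 1 (Run (If T c d # k), cs) (Run (?e # k), cs)"
    using If.prems by (intro reach_step sweep_If) auto
  obtain c1 where 1: "reach P (cost ?e (length W)) (Run (?e # k), cs) (Run k, c1)"
    "rep G W (fst (run W ?e \<sigma>)) (out @ snd (run W ?e \<sigma>)) c1"
    using If.IH[of \<sigma> out cs k] If.prems by (cases "tsem W \<sigma> T") auto
  show ?case
    using reach_mono[OF reach_trans[OF 0 1(1)], of "cost (If T c d) (length W)"] 1(2)
    by (intro exI[of _ c1]) (auto split: if_splits)
next
  case (Loop i c)
  have iG: "i \<in> G" and im: "i \<notin> mods c" using Loop.prems by auto
  \<comment> \<open>Induction on the number \<open>m\<close> of iterations left, for arbitrary
    states, because the loop pushed back on the stack starts in the middle of its range.\<close>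
  have "\<exists>cs'. reach P (2 + m * (cost c (length W) + 2)) (Run (Loop i c # k), cs) (Run k, cs')
     \<and> rep G W ((fst (floop (run W c) i [\<sigma> i..<length W] \<sigma>))(i := 0))
         (out @ snd (floop (run W c) i [\<sigma> i..<length W] \<sigma>)) cs'"
    if "length W - \<sigma> i = m" "rep G W \<sigma> out cs" for m \<sigma> out cs
    using that
  proof (induction m arbitrary: \<sigma> out cs)
    case 0
    have 1: "reach P 1 (Run (Loop i c # k), cs) (Run (Zero i # k), cs)"
      using sweep_Loop[OF 0(2) iG, of P c k] 0(1) by (intro reach_step) auto
    obtain cs' where 2: "reach P 1 (Run (Zero i # k), cs) (Run k, cs')" "rep G W (\<sigma>(i := 0)) out cs'"
      using sweep_Zero[OF 0(2), of P i k] reach_step by blast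
    have e: "[\<sigma> i..<length W] = []" using 0(1) by simp
    have "reach P (2 + 0 * (cost c (length W) + 2)) (Run (Loop i c # k), cs) (Run k, cs')"
      using reach_trans[OF 1 2(1)] by (simp add: numeral_2_eq_2)
    then show ?case using 2(2) unfolding e floop.simps fst_conv snd_conv append_Nil2 by blast
  next
    case (Suc m)
    have lt: "\<sigma> i < length W" using Suc.prems(1) by simp
    have 1: "reach P 1 (Run (Loop i c # k), cs) (Run (c # Inc i # Loop i c # k), cs)"
      using sweep_Loop[OF Suc.prems(2) iG, of P c k] lt by (intro reach_step) auto
    define \<sigma>1 where "\<sigma>1 = fst (run W c \<sigma>)"
    define o1 where "o1 = snd (run W c \<sigma>)"
    obtain c1 where 2: "reach P (cost c (length W)) (Run (c # Inc i # Loop i c # k), cs) (Run (Inc i # Loop i c # k), c1)"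
      "rep G W \<sigma>1 (out @ o1) c1"
      using Loop.IH[OF _ _ Suc.prems(2), of "Inc i # Loop i c # k"] Loop.prems
      unfolding \<sigma>1_def o1_def by auto
    have s1: "\<sigma>1 i = \<sigma> i" unfolding \<sigma>1_def using run_unmod[OF im] .
    obtain c2 where 3: "reach P 1 (Run (Inc i # Loop i c # k), c1) (Run (Loop i c # k), c2)"
      "rep G W (\<sigma>1(i := Suc (\<sigma> i))) (out @ o1) c2"
      using sweep_Inc[OF 2(2) iG, of P "Loop i c # k"] reach_step unfolding s1 by blast
    have un: "[\<sigma> i..<length W] = \<sigma> i # [Suc (\<sigma> i)..<length W]" using lt by (simp add: upt_conv_Cons)
    \<comment> \<open>The machine enters the remaining iterations with the counter already
      incremented, \<open>floop\<close> with the old value. The next iteration overwrites it, and if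
      there is none the final reset does.\<close>
    have fl: "(fst (floop F i js (\<tau>(i := v))))(i := 0) = (fst (floop F i js \<tau>))(i := 0)
       \<and> snd (floop F i js (\<tau>(i := v))) = snd (floop F i js \<tau>)" for F js \<tau> v
      by (cases js) auto
    obtain c3 where 4: "reach P (2 + m * (cost c (length W) + 2)) (Run (Loop i c # k), c2) (Run k, c3)"
      "rep G W ((fst (floop (run W c) i [Suc (\<sigma> i)..<length W] \<sigma>1))(i := 0))
         ((out @ o1) @ snd (floop (run W c) i [Suc (\<sigma> i)..<length W] \<sigma>1)) c3"
    proof -
      have at: "(\<sigma>1(i := Suc (\<sigma> i))) i = Suc (\<sigma> i)" by simp
      have "length W - (\<sigma>1(i := Suc (\<sigma> i))) i = m" using Suc.prems(1) by simp
      from Suc.IH[OF this 3(2)] show ?thesis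
        using that fl[of "run W c" "[Suc (\<sigma> i)..<length W]" \<sigma>1 "Suc (\<sigma> i)"] unfolding at by metis
    qed
    have "reach P (1 + cost c (length W) + 1 + (2 + m * (cost c (length W) + 2))) (Run (Loop i c # k), cs) (Run k, c3)"
      using reach_trans[OF reach_trans[OF reach_trans[OF 1 2(1)] 3(1)] 4(1)] .
    then have "reach P (2 + Suc m * (cost c (length W) + 2)) (Run (Loop i c # k), cs) (Run k, c3)"
      by (rule reach_mono) simp
    moreover have fe: "floop (run W c) i [\<sigma> i..<length W] \<sigma> =
      (fst (floop (run W c) i [Suc (\<sigma> i)..<length W] \<sigma>1),
       o1 @ snd (floop (run W c) i [Suc (\<sigma> i)..<length W] \<sigma>1))"
      unfolding un \<sigma>1_def o1_def by (simp add: case_prod_unfold Let_def fun_upd_triv)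
    ultimately show ?case using 4(2) unfolding fe fst_conv snd_conv append_assoc by blast
  qed
  from this[OF refl Loop.prems(3)]
  obtain cs' where *: "reach P (2 + (length W - \<sigma> i) * (cost c (length W) + 2)) (Run (Loop i c # k), cs) (Run k, cs')"
     "rep G W ((fst (floop (run W c) i [\<sigma> i..<length W] \<sigma>))(i := 0))
         (out @ snd (floop (run W c) i [\<sigma> i..<length W] \<sigma>)) cs'" by blast
  have "(length W - \<sigma> i) * (cost c (length W) + 2) \<le> length W * (cost c (length W) + 2)"
    by (rule mult_right_mono) auto
  then have "reach P (cost (Loop i c) (length W)) (Run (Loop i c # k), cs) (Run k, cs')"
    using reach_mono[OF *(1)] by simp
  moreover have rl: "run W (Loop i c) \<sigma> = ((fst (floop (run W c) i [\<sigma> i..<length W] \<sigma>))(i := 0),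
      snd (floop (run W c) i [\<sigma> i..<length W] \<sigma>))"
    by (simp add: case_prod_unfold Let_def)
  ultimately show ?case using *(2) unfolding rl fst_conv snd_conv by blast
qed

section \<open>Simulation by a Turing machine\<close>

text \<open>The stacks that occur while \<open>c\<close> runs on top of \<open>k\<close>. They are
  finitely many because a loop puts itself back below its body at the depth where it was found; this
  yields the finite control of the Turing machine.\<close>

primrec conts :: "cmd \<Rightarrow> cmd list \<Rightarrow> cmd list set" where
  "conts (Inc r) k = {Inc r # k}"
| "conts (Zero r) k = {Zero r # k}"
| "conts (Copy r s) k = {Copy r s # k}"
| "conts (Out b) k = {Out b # k}"
| "conts Skip k = {Skip # k}"
| "conts (Seq c d) k = insert (Seq c d # k) (conts c (d # k) \<union> conts d k)"
| "conts (If T c d) k = insert (If T c d # k) (conts c k \<union> conts d k)"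
| "conts (Loop i c) k = {Loop i c # k, Inc i # Loop i c # k, Zero i # k} \<union> conts c (Inc i # Loop i c # k)"

fun succs :: "cmd list \<Rightarrow> cmd list set" where
  "succs [] = {}"
| "succs (Seq c d # k) = {c # d # k}"
| "succs (If T c d # k) = {c # k, d # k}"
| "succs (Loop i c # k) = {c # Inc i # Loop i c # k, Zero i # k}"
| "succs (c # k) = {k}"

lemma finite_conts: "finite (conts c k)"
  by (induction c arbitrary: k) auto

lemma conts_self: "c # k \<in> conts c k"
  by (cases c) auto

lemma conts_succs: "x \<in> conts c k \<Longrightarrow> succs x \<subseteq> insert k (conts c k)"
proof (induction c arbitrary: k)
  case (Seq c d)
  then show ?case using conts_self[of d k] conts_self[of c "d # k"] by fastforce
next
  case (If T c d)
  then show ?case using conts_self[of c k] conts_self[of d k] by fastforce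
next
  case (Loop i c)
  then show ?case using conts_self[of c "Inc i # Loop i c # k"] by fastforce
qed auto

lemma conts_regset:
  "x \<in> conts c k \<Longrightarrow> list_all (\<lambda>d. regset d \<subseteq> G) (c # k) \<Longrightarrow> list_all (\<lambda>d. regset d \<subseteq> G) x"
proof (induction c arbitrary: k)
  case (Seq c d)
  consider "x = Seq c d # k" | "x \<in> conts c (d # k)" | "x \<in> conts d k" using Seq.prems(1) by auto
  then show ?case
    by cases (use Seq.prems(2) Seq.IH(1)[of "d # k"] Seq.IH(2)[of k] in simp_all)
next
  case (If T c d)
  consider "x = If T c d # k" | "x \<in> conts c k" | "x \<in> conts d k" using If.prems(1) by auto
  then show ?case
    by cases (use If.prems(2) If.IH(1)[of k] If.IH(2)[of k] in simp_all)
next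
  case (Loop i c)
  consider "x = Loop i c # k" | "x = Inc i # Loop i c # k" | "x = Zero i # k"
    | "x \<in> conts c (Inc i # Loop i c # k)" using Loop.prems(1) by auto
  then show ?case
    by cases (use Loop.prems(2) Loop.IH[of "Inc i # Loop i c # k"] in simp_all)
qed simp_all

lemma finite_regset: "finite (regset c)"
proof (induction c)
  case (If T c d) then show ?case by (cases T) auto
qed auto

definition control :: "cmd \<Rightarrow> mst set" where
  "control P = Init ` {bs. set bs \<subseteq> UNIV \<and> length bs \<le> 3}
     \<union> Run ` insert [] (conts P []) \<union> Pass ` insert [] (conts P []) \<union> {Done}"

definition cells :: "cmd \<Rightarrow> sym set" where
  "cells P = {Raw True, Raw False, Junk}
     \<union> (\<lambda>(a, M, o'). Cell a M o') ` ((insert None (Some ` {..16})) \<times> Pow (regset P) \<times> UNIV)"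

lemma finite_control: "finite (control P)"
  unfolding control_def using finite_conts[of P "[]"] finite_lists_length_le[of "UNIV :: bool set" 3]
  by simp

lemma finite_cells: "finite (cells P)"
  unfolding cells_def using finite_regset[of P] by simp

lemma Cell_cells: "Cell a M o' \<in> cells P \<longleftrightarrow> (a = None \<or> (\<exists>t\<le>16. a = Some t)) \<and> M \<subseteq> regset P"
  by (auto simp: cells_def image_iff Bex_def)

lemma Raw_cells [simp]: "Raw b \<in> cells P" "Junk \<in> cells P" "Blank \<notin> cells P"
  by (cases b; simp add: cells_def image_iff)+

lemma tokval_less: "tokval bs < 16"
  by (auto simp: tokval_def)

lemma control_Run: "Run k \<in> control P \<longleftrightarrow> k = [] \<or> k \<in> conts P []"
  and control_Pass: "Pass k \<in> control P \<longleftrightarrow> k = [] \<or> k \<in> conts P []"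
  and control_Init: "Init bs \<in> control P \<longleftrightarrow> length bs \<le> 3"
  and control_Done: "Done \<in> control P"
  unfolding control_def by auto

lemma control_step:
  assumes "c # k \<in> conts P []"
  shows "\<forall>k' \<in> succs (c # k). k' = [] \<or> k' \<in> conts P []" "regset c \<subseteq> regset P"
  using conts_succs[OF assms] conts_regset[OF assms, of "regset P"] by auto

lemma mealy_closed:
  assumes "q \<in> control P" "x \<in> cells P"
  shows "fst (mealy q x) \<in> control P \<and> snd (mealy q x) \<in> cells P"
proof (cases q)
  case (Init bs)
  then show ?thesis using assms tokval_less
    by (cases x) (auto simp: control_Init Cell_cells less_imp_le)
next
  case (Pass k)
  then show ?thesis using assms by (cases x) auto
next
  case Done
  then show ?thesis using assms by (cases x) auto
next
  case (Run k)
  note R = this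
  show ?thesis
  proof (cases x)
    case (Cell a M o')
    show ?thesis
    proof (cases k)
      case Nil
      then show ?thesis using R assms Cell by (auto simp: Cell_cells split: option.splits)
    next
      case (Cons c k')
      then have ck: "c # k' \<in> conts P []" using R assms by (simp add: control_Run)
      note st = control_step[OF ck]
      have M: "a = None \<or> (\<exists>t\<le>16. a = Some t)" "M \<subseteq> regset P"
        using assms(2) Cell by (simp_all add: Cell_cells)
      have "fst (stepc c k' a M o') \<in> control P \<and> snd (stepc c k' a M o') \<in> cells P"
      proof (cases c)
        case (If T c1 d1)
        then show ?thesis using st ck M
          by (auto simp: Cell_cells control_Run control_Pass split: option.split)
      next
        case (Loop i c1)
        then show ?thesis using st ck M
          by (auto simp: Cell_cells control_Run control_Pass split: option.split)
      qed (use st ck M in \<open>auto simp: Cell_cells control_Run control_Pass\<close>)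
      then show ?thesis using R Cons Cell by simp
    qed
  qed (use R assms in auto)
qed

lemma endm_closed:
  assumes "q \<in> control P"
  shows "fst (endm P q) \<in> control P \<and> (\<forall>y. snd (endm P q) = Some y \<longrightarrow> y \<in> cells P)"
proof (cases q)
  case (Run k)
  show ?thesis
  proof (cases k)
    case Nil
    then show ?thesis using Run by (auto simp: control_Done)
  next
    case (Cons c k')
    then have ck: "c # k' \<in> conts P []" using Run assms by (simp add: control_Run)
    show ?thesis using Run Cons control_step[OF ck]
      by (cases c) (auto simp: Cell_cells control_Run)
  qed
qed (use assms in \<open>auto simp: control_Run control_Pass control_Done conts_self\<close>)

datatype tq = TR mst | TL mst | TH

text \<open>One sweep becomes a pass to the right that applies \<open>mealy\<close> and a way back
  that changes nothing. The blanks on both sides are the only end markers, so \<open>Blank\<close>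
  must not occur among the cells. Halting waits for the end of the way back, because the output is
  read from the head onwards.\<close>

fun adelta :: "cmd \<Rightarrow> tq \<Rightarrow> sym \<Rightarrow> tq \<times> sym \<times> move" where
  "adelta P (TR q) Blank = (case endm P q of (q', z) \<Rightarrow>
     (TL q', case z of None \<Rightarrow> Blank | Some y \<Rightarrow> y, MvL))"
| "adelta P (TR q) x = (case mealy q x of (q', y) \<Rightarrow> (TR q', y, MvR))"
| "adelta P (TL q) Blank = (if q = Done then TH else TR q, Blank, MvR)"
| "adelta P (TL q) x = (TL q, x, MvL)"
| "adelta P TH x = (TH, x, MvS)"

text \<open>Separates the run of the machine from the choice of numbers for states and symbols. Of
  the conventions of the machine model only those for halting state and blank enter the simulation
  of sweeps.\<close>

locale coded =
  fixes P :: cmd and M :: tmachine and eq :: "tq \<Rightarrow> nat" and es :: "sym \<Rightarrow> nat"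
  assumes delta: "\<And>q x. q \<in> insert TH (TR ` control P \<union> TL ` control P) \<Longrightarrow> x \<in> insert Blank (cells P)
      \<Longrightarrow> tm_delta M (eq q) (es x) = (case adelta P q x of (q', y, d) \<Rightarrow> (eq q', es y, d))"
    and TH1: "\<And>q. q \<in> TR ` control P \<union> TL ` control P \<Longrightarrow> eq q \<noteq> 1"
    and TH: "eq TH = 1"
    and Blank: "es Blank = 0"
begin

lemma step_tm:
  assumes "q \<in> TR ` control P \<union> TL ` control P" "x \<in> insert Blank (cells P)"
    "s = (case R of [] \<Rightarrow> 0 | z # _ \<Rightarrow> z)" "s = es x" "adelta P q x = (q', y, d)"
  shows "tm_step M (eq q, L, R) = (case d of
           MvS \<Rightarrow> (eq q', L, es y # tl R)
         | MvR \<Rightarrow> (eq q', es y # L, tl R)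
         | MvL \<Rightarrow> (case L of [] \<Rightarrow> (eq q', [], 0 # es y # tl R) | l # L' \<Rightarrow> (eq q', L', l # es y # tl R)))"
  using assms delta[of q x] TH1[of q] by (auto simp: tm_step_def Let_def)

text \<open>The configuration right after a step to the left across the border between
  \<open>A\<close> and \<open>B\<close>: the head is on the last symbol of \<open>A\<close>, or on
  the blank before the word if \<open>A\<close> is empty. \<open>L0\<close> is empty before the
  first sweep and one visited blank afterwards.\<close>

definition lcfg :: "mst \<Rightarrow> nat list \<Rightarrow> sym list \<Rightarrow> nat list \<Rightarrow> config" where
  "lcfg q L0 A B = (case rev (map es A) @ L0 of [] \<Rightarrow> (eq (TL q), [], 0 # B) | l # L' \<Rightarrow> (eq (TL q), L', l # B))"

lemma left_phase:
  assumes "q \<in> control P" "set A \<subseteq> cells P" "L0 = [] \<or> L0 = [0]"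
  shows "(tm_step M ^^ (length A + 1)) (lcfg q L0 A B) =
    (eq (if q = Done then TH else TR q), [0], map es A @ B)"
  using assms(2)
proof (induction A arbitrary: B rule: rev_induct)
  case Nil
  have "tm_step M (eq (TL q), [], 0 # B) = (eq (if q = Done then TH else TR q), [0], B)"
    using step_tm[of "TL q" Blank 0 "0 # B" "if q = Done then TH else TR q" Blank MvR "[]"] assms(1) Blank
    by auto
  then show ?case using assms(3) by (auto simp: lcfg_def)
next
  case (snoc x A)
  have "adelta P (TL q) x = (TL q, x, MvL)" using snoc.prems by (cases x) auto
  then have "tm_step M (lcfg q L0 (A @ [x]) B) = lcfg q L0 A (es x # B)"
    using step_tm[of "TL q" x "es x" "es x # B" "TL q" x MvL "rev (map es A) @ L0"] assms(1) snoc.prems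
    by (auto simp: lcfg_def split: list.split)
  moreover have "(tm_step M ^^ (length (A @ [x]) + 1)) c = (tm_step M ^^ (length A + 1)) (tm_step M c)" for c
    by (simp add: funpow_swap1)
  ultimately show ?case using snoc.IH[of "es x # B"] snoc.prems by simp
qed

text \<open>The turn at the right end writes either the appended cell or an explicit blank. Such a
  blank belongs to the tape but not to the word of cells; \<open>Z\<close> and \<open>Z'\<close>
  account for it.\<close>

lemma right_phase:
  assumes "q \<in> control P" "set A \<subseteq> cells P" "set xs \<subseteq> cells P" "Z = [] \<or> Z = [0]"
    "sweep P (q, xs) = (q', ys)"
  shows "\<exists>A' B Z'. (tm_step M ^^ (length xs + 1)) (eq (TR q), rev (map es A) @ L0, map es xs @ Z) = lcfg q' L0 A' B
     \<and> set A' \<subseteq> cells P \<and> length A' = length A + length xs \<and> map es A' @ B = map es A @ map es ys @ Z'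
     \<and> (Z' = [] \<or> Z' = [0]) \<and> q' \<in> control P \<and> set ys \<subseteq> cells P"
  using assms
proof (induction xs arbitrary: q A ys)
  case Nil
  obtain z where e: "endm P q = (q', z)" and ys: "ys = (case z of None \<Rightarrow> [] | Some c \<Rightarrow> [c])"
    using Nil.prems(5) by (auto split: prod.splits)
  let ?y = "case z of None \<Rightarrow> Blank | Some y \<Rightarrow> y"
  have c: "q' \<in> control P" "set ys \<subseteq> cells P" using endm_closed[OF Nil.prems(1)] e ys
    by (auto split: option.splits)
  have a: "adelta P (TR q) Blank = (TL q', ?y, MvL)" using e by simp
  have "tm_step M (eq (TR q), rev (map es A) @ L0, Z) = lcfg q' L0 A [es ?y]"
    using step_tm[of "TR q" Blank 0 Z "TL q'" ?y MvL "rev (map es A) @ L0"] Nil.prems(1,4) Blank e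
    by (auto simp: lcfg_def split: list.splits)
  moreover have "map es A @ [es ?y] = map es A @ map es ys @ (if z = None then [0] else [])"
    using ys Blank by (auto split: option.splits)
  ultimately show ?case using c Nil.prems(2)
    by (intro exI[of _ A] exI[of _ "[es ?y]"] exI[of _ "if z = None then [0] else []"]) auto
next
  case (Cons x xs)
  obtain q1 y ys' where m: "mealy q x = (q1, y)" and s: "sweep P (q1, xs) = (q', ys')" and ys: "ys = y # ys'"
    using Cons.prems(5) by (auto split: prod.splits)
  have c: "q1 \<in> control P" "y \<in> cells P" using mealy_closed[of q P x] Cons.prems(1,3) m by auto
  have a: "adelta P (TR q) x = (TR q1, y, MvR)" using m Cons.prems(3) by (cases x) auto
  have 1: "tm_step M (eq (TR q), rev (map es A) @ L0, map es (x # xs) @ Z)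
      = (eq (TR q1), rev (map es (A @ [y])) @ L0, map es xs @ Z)"
    using step_tm[of "TR q" x "es x" "map es (x # xs) @ Z" "TR q1" y MvR "rev (map es A) @ L0"] Cons.prems(1,3) a
    by auto
  have "set (A @ [y]) \<subseteq> cells P" using Cons.prems(2) c by auto
  from Cons.IH[OF c(1) this _ Cons.prems(4) s] Cons.prems(3)
  obtain A' B Z' where 2: "(tm_step M ^^ (length xs + 1)) (eq (TR q1), rev (map es (A @ [y])) @ L0, map es xs @ Z) = lcfg q' L0 A' B"
     "set A' \<subseteq> cells P" "length A' = length (A @ [y]) + length xs" "map es A' @ B = map es (A @ [y]) @ map es ys' @ Z'"
     "Z' = [] \<or> Z' = [0]" "q' \<in> control P" "set ys' \<subseteq> cells P" by auto
  have "(tm_step M ^^ (length (x # xs) + 1)) (eq (TR q), rev (map es A) @ L0, map es (x # xs) @ Z) = lcfg q' L0 A' B"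
    using 1 2(1) by (simp add: funpow_swap1)
  then show ?case using 2 c ys by (intro exI[of _ A'] exI[of _ B] exI[of _ Z']) auto
qed

lemma macro_step:
  assumes "q \<in> control P" "set xs \<subseteq> cells P" "Z = [] \<or> Z = [0]" "L0 = [] \<or> L0 = [0]"
    "sweep P (q, xs) = (q', ys)"
  shows "\<exists>Z'. (tm_step M ^^ (2 * length xs + 2)) (eq (TR q), L0, map es xs @ Z)
       = (eq (if q' = Done then TH else TR q'), [0], map es ys @ Z')
     \<and> (Z' = [] \<or> Z' = [0]) \<and> q' \<in> control P \<and> set ys \<subseteq> cells P"
proof -
  obtain A' B Z' where 1: "(tm_step M ^^ (length xs + 1)) (eq (TR q), L0, map es xs @ Z) = lcfg q' L0 A' B"
    "set A' \<subseteq> cells P" "length A' = length xs" "map es A' @ B = map es ys @ Z'"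
    "Z' = [] \<or> Z' = [0]" "q' \<in> control P" "set ys \<subseteq> cells P"
    using right_phase[OF assms(1) _ assms(2,3,5), of "[]" L0] by auto
  have "(tm_step M ^^ ((length xs + 1) + (length xs + 1))) (eq (TR q), L0, map es xs @ Z)
       = (eq (if q' = Done then TH else TR q'), [0], map es ys @ Z')"
    using left_phase[OF 1(6,2) assms(4), of B] 1(1,3,4) unfolding funpow_add by simp
  then show ?thesis using 1 by (intro exI[of _ Z']) (simp add: mult_2 add.assoc)
qed

text \<open>A sweep adds at most one cell, so each of the \<open>t\<close> sweeps runs over at most
  \<open>length xs + t\<close> cells, once in either direction, with two extra steps for turning.
  The machine halts at the first \<open>Done\<close>; later sweeps change nothing.\<close>

lemma macro_steps:
  assumes "q \<in> control P" "set xs \<subseteq> cells P" "Z = [] \<or> Z = [0]" "L0 = [] \<or> L0 = [0]" "q \<noteq> Done"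
    "(sweep P ^^ t) (q, xs) = (Done, ys)"
  shows "\<exists>s Z'. s \<le> t * (2 * (length xs + t) + 2) \<and> (tm_step M ^^ s) (eq (TR q), L0, map es xs @ Z)
       = (1, [0], map es ys @ Z')
     \<and> (Z' = [] \<or> Z' = [0])"
  using assms
proof (induction t arbitrary: q xs Z L0)
  case (Suc t)
  obtain q1 xs1 where s: "sweep P (q, xs) = (q1, xs1)" by fastforce
  then have s2: "(sweep P ^^ t) (q1, xs1) = (Done, ys)" using Suc.prems(6) by (simp add: funpow_swap1)
  have len: "length xs1 \<le> Suc (length xs)" using sweep_len[of P q xs] s by simp
  obtain Z1 where 1: "(tm_step M ^^ (2 * length xs + 2)) (eq (TR q), L0, map es xs @ Z)
       = (eq (if q1 = Done then TH else TR q1), [0], map es xs1 @ Z1)"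
     "Z1 = [] \<or> Z1 = [0]" "q1 \<in> control P" "set xs1 \<subseteq> cells P"
    using macro_step[OF Suc.prems(1-4) s] by blast
  show ?case
  proof (cases "q1 = Done")
    case True
    have m: "mealy Done x = (Done, x)" for x by (cases x) auto
    have "sweep P (Done, xs) = (Done, xs)" for xs
      by (induction xs) (auto simp: m)
    then have "(sweep P ^^ t) (Done, xs1) = (Done, xs1)" by (induction t) auto
    then have "ys = xs1" using s2 True by simp
    then show ?thesis using 1 True TH
      by (intro exI[of _ "2 * length xs + 2"] exI[of _ Z1]) (auto simp: algebra_simps)
  next
    case False
    obtain s' Z' where 2: "s' \<le> t * (2 * (length xs1 + t) + 2)"
      "(tm_step M ^^ s') (eq (TR q1), [0], map es xs1 @ Z1) = (1, [0], map es ys @ Z')"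
      "Z' = [] \<or> Z' = [0]"
      using Suc.IH[OF 1(3,4,2) _ False s2, of "[0]"] by blast
    have "(tm_step M ^^ (s' + (2 * length xs + 2))) (eq (TR q), L0, map es xs @ Z) = (1, [0], map es ys @ Z')"
    proof -
      have "(tm_step M ^^ (s' + (2 * length xs + 2))) c
        = (tm_step M ^^ s') ((tm_step M ^^ (2 * length xs + 2)) c)" for c
        unfolding funpow_add[of s'] by simp
      then show ?thesis using 1(1) 2(2) False by (simp del: funpow.simps)
    qed
    moreover have "s' + (2 * length xs + 2) \<le> Suc t * (2 * (length xs + Suc t) + 2)"
    proof -
      have "t * (2 * (length xs1 + t) + 2) \<le> t * (2 * (length xs + Suc t) + 2)"
        using len by (intro mult_left_mono) auto
      then show ?thesis using 2(1) by simp
    qed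
    ultimately show ?thesis using 2(3) by blast
  qed
qed auto

end

section \<open>Numbering of states and symbols\<close>

lemma exists_numbering:
  assumes "finite A" "set xs \<subseteq> A" "distinct xs"
  shows "\<exists>f. bij_betw f A {..<card A} \<and> (\<forall>i < length xs. f (xs ! i) = i)"
proof -
  obtain zs where z: "set zs = A - set xs" "distinct zs"
    using finite_distinct_list[of "A - set xs"] assms(1) by auto
  let ?l = "xs @ zs"
  have l: "distinct ?l" "set ?l = A" using z assms by auto
  have len: "length ?l = card A" using l distinct_card by metis
  have b: "bij_betw (nth ?l) {..<card A} A" using bij_betw_nth[OF l(1)] l(2) len by auto
  have "inv_into {..<card A} (nth ?l) (xs ! i) = i" if "i < length xs" for i
  proof -
    have "i \<in> {..<card A}" using that len by simp
    moreover have "xs ! i = ?l ! i" using that by (simp add: nth_append)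
    ultimately show ?thesis using b by (metis bij_betw_def inv_into_f_f)
  qed
  then show ?thesis using bij_betw_inv_into[OF b] by blast
qed

lemma exists_coded:
  obtains M eq es where "coded P M eq es" "tm_wf M" "eq (TR (Init [])) = 0" "es (Raw False) = 1" "es (Raw True) = 2"
    "inj_on es (insert Blank (cells P))"
proof -
  let ?Q = "insert TH (TR ` control P \<union> TL ` control P)"
  let ?S = "insert Blank (cells P)"
  have fQ: "finite ?Q" using finite_control by auto
  have fS: "finite ?S" using finite_cells by auto
  \<comment> \<open>The machine model fixes the numbers of the start state, the halting state, the
    blank and both bits; the rest of the numbering is arbitrary.\<close>
  obtain eq where eq: "bij_betw eq ?Q {..<card ?Q}" "\<forall>i<2. eq ([TR (Init []), TH] ! i) = i"
    using exists_numbering[OF fQ, of "[TR (Init []), TH]"] by (auto simp: control_Init numeral_2_eq_2)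
  obtain es where es: "bij_betw es ?S {..<card ?S}" "\<forall>i<3. es ([Blank, Raw False, Raw True] ! i) = i"
    using exists_numbering[OF fS, of "[Blank, Raw False, Raw True]"] by (auto simp: numeral_3_eq_3)
  have e0: "eq (TR (Init [])) = 0" "eq TH = 1" using eq(2)[rule_format, of 0] eq(2)[rule_format, of 1] by auto
  have s0: "es Blank = 0" "es (Raw False) = 1" "es (Raw True) = 2"
    using es(2)[rule_format, of 0] es(2)[rule_format, of 1] es(2)[rule_format, of 2] by auto
  define dq where "dq = inv_into ?Q eq"
  define ds where "ds = inv_into ?S es"
  have dq: "dq (eq q) = q" if "q \<in> ?Q" for q
    unfolding dq_def by (rule inv_into_f_f) (use eq(1) that in \<open>auto simp: bij_betw_def\<close>)
  have ds: "ds (es q) = q" if "q \<in> ?S" for q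
    unfolding ds_def by (rule inv_into_f_f) (use es(1) that in \<open>auto simp: bij_betw_def\<close>)
  have dq': "dq i \<in> ?Q" if "i < card ?Q" for i
    unfolding dq_def by (rule inv_into_into) (use eq(1) that in \<open>auto simp: bij_betw_def\<close>)
  have ds': "ds i \<in> ?S" if "i < card ?S" for i
    unfolding ds_def by (rule inv_into_into) (use es(1) that in \<open>auto simp: bij_betw_def\<close>)
  define M where "M = \<lparr>tm_states = card ?Q, tm_syms = card ?S,
    tm_delta = (\<lambda>i s. case adelta P (dq i) (ds s) of (q', y, d) \<Rightarrow> (eq q', es y, d))\<rparr>"
  have cl: "fst (adelta P q x) \<in> ?Q \<and> fst (snd (adelta P q x)) \<in> ?S" if "q \<in> ?Q" "x \<in> ?S" for q x
    using that
  proof (cases q)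
    case (TR q0)
    then have "q0 \<in> control P" using that by auto
    then show ?thesis using TR that endm_closed[of q0 P] mealy_closed[of q0 P x]
      by (cases x) (auto split: prod.splits option.splits)
  next
    case (TL q0)
    then show ?thesis using that by (cases x) auto
  qed auto
  have eqb: "eq q < card ?Q" if "q \<in> ?Q" for q using eq(1) that by (auto simp: bij_betw_def)
  have esb: "es q < card ?S" if "q \<in> ?S" for q using es(1) that by (auto simp: bij_betw_def)
  have "eq TH < card ?Q" "es (Raw True) < card ?S" by (intro eqb esb; simp)+
  then have "tm_wf M"
    unfolding tm_wf_def M_def using cl[OF dq' ds'] eqb esb e0 s0
    by (auto split: prod.splits) (metis fst_conv snd_conv)+
  moreover have "coded P M eq es"
  proof
    fix q x assume "q \<in> ?Q" "x \<in> ?S"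
    then show "tm_delta M (eq q) (es x) = (case adelta P q x of (q', y, d) \<Rightarrow> (eq q', es y, d))"
      using dq ds by (simp add: M_def)
  next
    fix q assume "q \<in> TR ` control P \<union> TL ` control P"
    then show "eq q \<noteq> 1" using e0 dq[of TH] dq[of q] by auto
  qed (use e0 s0 in auto)
  ultimately show ?thesis using that e0 s0 es(1) by (auto simp: bij_betw_def)
qed

text \<open>The tokens that the first sweep leaves behind, for arbitrary words: an incomplete last
  block yields dummies only.\<close>

fun pre :: "bool list \<Rightarrow> bool list \<Rightarrow> nat list" where
  "pre bs [] = []"
| "pre bs (b # w) = (if length bs = 3 then tokval (bs @ [b]) # pre [] w else 16 # pre (bs @ [b]) w)"

lemma length_pre [simp]: "length (pre bs w) = length w"
  by (induction bs w rule: pre.induct) auto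

lemma sweep_Init: "sweep P (Init bs, map Raw w) = (Run [P], map (\<lambda>t. Cell (Some t) {} None) (pre bs w))"
  by (induction bs w rule: pre.induct) auto

lemma rep_Init: "rep G (pre [] w) (\<lambda>_. 0) [] (map (\<lambda>t. Cell (Some t) {} None) (pre [] w))"
  by (auto simp: rep_def mkcell_def)

lemma sweep_Run_Nil:
  assumes "rep G W \<sigma> out cs"
  obtains cs' where "sweep P (Run [], cs) = (Done, map Raw out @ cs')" "set cs' \<subseteq> {Junk}"
proof -
  let ?g = "\<lambda>x. case x of Cell a M (Some b) \<Rightarrow> Raw b | _ \<Rightarrow> Junk"
  have "sweep P (Run [], cs) = (Done, map ?g cs)"
    by (rule sweep_map) (use rep_cell[OF assms] in \<open>fastforce split: option.splits\<close>)+
  moreover have "map ?g cs = map Raw out @ replicate (length cs - length out) Junk"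
    by (rule nth_equalityI) (use assms in \<open>auto simp: rep_def mkcell_def nth_append\<close>)
  ultimately show ?thesis using that by (metis set_replicate_conv_if empty_subsetI order_refl)
qed

section \<open>Polynomial bounds on the running time\<close>

definition poly_bounded :: "(nat \<Rightarrow> nat) \<Rightarrow> bool" where
  "poly_bounded g \<longleftrightarrow> (\<exists>k. \<forall>n. g n \<le> k * (n + 1) ^ k)"

lemma poly_bounded_const: "poly_bounded (\<lambda>n. c)"
  unfolding poly_bounded_def by (intro exI[of _ c]) simp

lemma poly_bounded_id: "poly_bounded (\<lambda>n. n)"
  unfolding poly_bounded_def by (intro exI[of _ 1]) simp

lemma poly_bounded_add:
  assumes "poly_bounded f" "poly_bounded g"
  shows "poly_bounded (\<lambda>n. f n + g n)"
proof -
  obtain k l where k: "\<And>n. f n \<le> k * (n + 1) ^ k" "\<And>n. g n \<le> l * (n + 1) ^ l"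
    using assms unfolding poly_bounded_def by auto
  have "f n + g n \<le> (k + l) * (n + 1) ^ (k + l)" for n
  proof -
    have "f n \<le> k * (n + 1) ^ (k + l)"
      using k(1)[of n] by (rule order_trans) (intro mult_left_mono power_increasing, auto)
    moreover have "g n \<le> l * (n + 1) ^ (k + l)"
      using k(2)[of n] by (rule order_trans) (intro mult_left_mono power_increasing, auto)
    ultimately show ?thesis by (simp add: add_mult_distrib)
  qed
  then show ?thesis unfolding poly_bounded_def by blast
qed

lemma poly_bounded_mult:
  assumes "poly_bounded f" "poly_bounded g"
  shows "poly_bounded (\<lambda>n. f n * g n)"
proof -
  obtain k l where k: "\<And>n. f n \<le> k * (n + 1) ^ k" "\<And>n. g n \<le> l * (n + 1) ^ l"
    using assms unfolding poly_bounded_def by auto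
  \<comment> \<open>One number has to serve as coefficient and as exponent; this one is at least the
    coefficient \<open>k * l\<close> and the exponent \<open>k + l\<close> of the product.\<close>
  have "f n * g n \<le> (k * l + k + l) * (n + 1) ^ (k * l + k + l)" for n
  proof -
    have "f n * g n \<le> (k * (n + 1) ^ k) * (l * (n + 1) ^ l)"
      using k by (intro mult_mono) auto
    also have "\<dots> = (k * l) * (n + 1) ^ (k + l)" by (simp add: power_add)
    also have "\<dots> \<le> (k * l + k + l) * (n + 1) ^ (k * l + k + l)"
      by (intro mult_mono power_increasing) auto
    finally show ?thesis .
  qed
  then show ?thesis unfolding poly_bounded_def by blast
qed

lemma poly_bounded_cost: "poly_bounded (cost c)"
proof (induction c)
  case (Seq c d)
  have "cost (Seq c d) = (\<lambda>n. 1 + cost c n + cost d n)" by auto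
  then show ?case using Seq by (simp only:) (intro poly_bounded_add poly_bounded_const)
next
  case (If T c d)
  have "cost (If T c d) = (\<lambda>n. 1 + cost c n + cost d n)" by auto
  then show ?case using If by (simp only:) (intro poly_bounded_add poly_bounded_const)
next
  case (Loop i c)
  have "cost (Loop i c) = (\<lambda>n. 2 + n * (cost c n + 2))" by auto
  then show ?case using Loop
    by (simp only:) (intro poly_bounded_add poly_bounded_mult poly_bounded_id poly_bounded_const)
qed (use poly_bounded_const in \<open>auto simp: fun_eq_iff poly_bounded_def\<close>)

theorem poly_time_run:
  assumes "wfc P"
  shows "poly_time_computable (\<lambda>w. snd (run (pre [] w) P (\<lambda>_. 0)))"
proof -
  obtain M eq es where M: "coded P M eq es" "tm_wf M" "eq (TR (Init [])) = 0" "es (Raw False) = 1" "es (Raw True) = 2"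
    "inj_on es (insert Blank (cells P))" using exists_coded by blast
  interpret coded P M eq es by (rule M)
  \<comment> \<open>One sweep decodes the input and one writes the output; the program takes the
    others.\<close>
  let ?T = "\<lambda>n. 2 + cost P n"
  let ?B = "\<lambda>n. ?T n * (2 * (n + ?T n) + 2)"
  have "poly_bounded ?B"
    by (intro poly_bounded_add poly_bounded_mult poly_bounded_cost poly_bounded_const poly_bounded_id)
  then obtain k where k: "\<And>n. ?B n \<le> k * (n + 1) ^ k" unfolding poly_bounded_def by auto
  have "\<exists>t \<le> k * (length w + 1) ^ k.
      fst (tm_run M w t) = 1 \<and> tm_output (tm_run M w t) = snd (run (pre [] w) P (\<lambda>_. 0))" for w
  proof -
    let ?n = "length w" and ?W = "pre [] w" and ?out = "snd (run (pre [] w) P (\<lambda>_. 0))"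
    let ?c0 = "map (\<lambda>t. Cell (Some t) {} None) ?W"
    have 1: "reach P 1 (Init [], map Raw w) (Run [P], ?c0)"
      by (intro reach_step sweep_Init)
    obtain c1 where 2: "reach P (cost P ?n) (Run [P], ?c0) (Run [], c1)"
      "rep (regset P) ?W (fst (run ?W P (\<lambda>_. 0))) ?out c1"
      using run_reach[OF assms order_refl rep_Init, of P w "[]"] by auto
    obtain cs' where 3: "sweep P (Run [], c1) = (Done, map Raw ?out @ cs')" "set cs' \<subseteq> {Junk}"
      using sweep_Run_Nil[OF 2(2)] by metis
    have "reach P (1 + cost P ?n + 1) (Init [], map Raw w) (Done, map Raw ?out @ cs')"
      using reach_trans[OF reach_trans[OF 1 2(1)] reach_step[OF 3(1)]] .
    then obtain t where t: "t \<le> ?T ?n" "(sweep P ^^ t) (Init [], map Raw w) = (Done, map Raw ?out @ cs')"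
      unfolding reach_def by auto
    obtain s Z' where s: "s \<le> t * (2 * (length (map Raw w) + t) + 2)"
      "(tm_step M ^^ s) (eq (TR (Init [])), [], map es (map Raw w) @ []) = (1, [0], map es (map Raw ?out @ cs') @ Z')"
      "Z' = [] \<or> Z' = [0]"
    proof -
      have "set (map Raw w) \<subseteq> cells P" by auto
      moreover have "Init [] \<in> control P" by (simp add: control_Init)
      ultimately show ?thesis
        using macro_steps[of "Init []" "map Raw w" "[]" "[]" t "map Raw ?out @ cs'"] t(2) that
        unfolding append_Nil2 by blast
    qed
    have esb: "es (Raw b) = bit_sym b" for b using M by (cases b) (auto simp: bit_sym_def)
    have r: "tm_run M w s = (1, [0], map bit_sym ?out @ map es cs' @ Z')"
      using s(2) M(3) unfolding tm_run_def by (simp add: esb comp_def)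
    \<comment> \<open>The numbering is injective on the cells, so \<open>Junk\<close> differs from
      both bits and stops the reading of the output.\<close>
    have J: "es Junk \<noteq> 1 \<and> es Junk \<noteq> 2" 
      using inj_onD[OF M(6), of Junk "Raw False"] inj_onD[OF M(6), of Junk "Raw True"] M(4,5) by auto
    have tw: "takeWhile (\<lambda>s. s = 1 \<or> s = 2) (map es cs' @ Z') = []"
    proof (cases cs')
      case Nil then show ?thesis using s(3) by auto
    next
      case (Cons a l) then show ?thesis using 3(2) J by auto
    qed
    have b1: "\<And>x. x \<in> set (map bit_sym ?out) \<Longrightarrow> x = 1 \<or> x = 2" by (auto simp: bit_sym_def)
    have "takeWhile (\<lambda>s. s = 1 \<or> s = 2) (map bit_sym ?out @ map es cs' @ Z') = map bit_sym ?out"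
      using takeWhile_append2[of "map bit_sym ?out" "\<lambda>s. s = 1 \<or> s = 2" "map es cs' @ Z'"] b1 tw by simp
    moreover have "map (\<lambda>s. s = 2) (map bit_sym ?out) = ?out"
      by (simp add: comp_def bit_sym_def map_idI)
    ultimately have o: "tm_output (tm_run M w s) = ?out" unfolding r tm_output_def by simp
    have "t * (2 * (length (map Raw w) + t) + 2) \<le> ?B ?n"
      using t(1) by (intro mult_mono) auto
    then have "s \<le> k * (?n + 1) ^ k" using s(1) k[of ?n] by linarith
    then show ?thesis using o r by auto
  qed
  then show ?thesis unfolding poly_time_computable_def using M(2) by blast
qed

section \<open>The formula of low degree\<close>

text \<open>\<open>Dig p\<close> and \<open>DigV p\<close> stand for the integer whose digits follow position \<open>p\<close> of the input,
  with and without a sign.\<close>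

datatype coef = One | Dig nat | DigV nat
type_synonym mono = "coef \<times> (nat \<times> nat) list"
type_synonym apoly = "mono list"

text \<open>Blocks of variables, each indexed by positions: 0 existential and 1 universal copies of the
  original variables at their occurrences, (2, 3, 4) lower end, upper end and denominator of an
  interval, (5, 6) numerator and denominator of an exact value.\<close>

definition mon :: "(nat \<times> nat) list \<Rightarrow> mono" where "mon fs = (One, fs)"

definition eqf :: "apoly \<Rightarrow> apoly \<Rightarrow> apoly qff" where "eqf p q = And (Le p q) (Le q p)"

definition outside :: "mono \<Rightarrow> nat \<Rightarrow> apoly qff" where
  "outside q t = Or (Le [q] [mon [(2, t)]]) (Le [mon [(3, t)]] [q])"

text \<open>Whether two leaves carry the same variable is decided by the formula itself, which compares
  the indices as integer constants.\<close>

definition f_link :: "nat \<Rightarrow> nat \<Rightarrow> nat \<Rightarrow> apoly qff" where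
  "f_link b p q = Or (Or (Le [(DigV p, []), mon []] [(DigV q, [])]) (Le [(DigV q, []), mon []] [(DigV p, [])]))
     (Le [mon [(b, p)]] [mon [(b, q)]])"

definition f_pos :: "nat \<Rightarrow> apoly qff" where "f_pos t = Le [mon [(4, t)]] []"

text \<open>Negates the demand that the interval of leaf \<open>t\<close> contain the value of the
  copy \<open>q\<close>, if both carry the same variable. Demanding this for all copies replaces
  equality of the universal copies, which as a premise would be negated to a strict condition.
  Existential copies are linked by conjuncts of \<open>Phi'\<close>. The comparison with the digits
  at \<open>M\<close> tells the two kinds of variables apart.\<close>

definition f_var :: "nat \<Rightarrow> nat \<Rightarrow> nat \<Rightarrow> apoly qff" where
  "f_var M t q = And (eqf [(DigV t, [])] [(DigV q, [])])
     (Or (And (Le [(DigV t, []), mon []] [(DigV M, [])]) (outside (mon [(0, q), (4, t)]) t))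
         (And (Le [(DigV M, [])] [(DigV t, [])]) (outside (mon [(1, q), (4, t)]) t)))"

definition f_const :: "nat \<Rightarrow> apoly qff" where "f_const t = outside (Dig t, [(4, t)]) t"

definition f_add :: "nat \<Rightarrow> nat \<Rightarrow> nat \<Rightarrow> apoly qff" where
  "f_add t a b = Or
     (Le [mon [(4, t), (2, a), (4, b)], mon [(4, t), (2, b), (4, a)]] [mon [(2, t), (4, a), (4, b)]])
     (Le [mon [(3, t), (4, a), (4, b)]] [mon [(4, t), (3, a), (4, b)], mon [(4, t), (3, b), (4, a)]])"

definition f_corner :: "nat \<Rightarrow> nat \<Rightarrow> nat \<Rightarrow> nat \<Rightarrow> nat \<Rightarrow> apoly qff" where
  "f_corner t a b f g = Or
     (Le [mon [(4, t), (f, a), (g, b)]] [mon [(2, t), (4, a), (4, b)]])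
     (Le [mon [(3, t), (4, a), (4, b)]] [mon [(4, t), (f, a), (g, b)]])"

text \<open>The signs of the endpoints are unknown, hence so are the extreme corners; an interval
  that contains all four corner products covers every case.\<close>

definition f_mul :: "nat \<Rightarrow> nat \<Rightarrow> nat \<Rightarrow> apoly qff" where
  "f_mul t a b = Or (Or (f_corner t a b 2 2) (f_corner t a b 2 3)) (Or (f_corner t a b 3 2) (f_corner t a b 3 3))"

definition f_atom :: "nat \<Rightarrow> nat \<Rightarrow> apoly qff" where
  "f_atom a b = Le [mon [(2, a), (4, b)]] [mon [(3, b), (4, a)]]"

text \<open>On the unit circle with nonnegative denominator, the equations for the subterms force the
  denominators to be positive, which no non-strict condition could demand directly.\<close>

definition e_unit :: "nat \<Rightarrow> apoly qff" where
  "e_unit t = And (Le [] [mon [(6, t)]]) (eqf [mon [(5, t), (5, t)], mon [(6, t), (6, t)]] [mon []])"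

definition e_var :: "nat \<Rightarrow> apoly qff" where "e_var t = eqf [mon [(5, t)]] [mon [(1, t), (6, t)]]"

definition e_const :: "nat \<Rightarrow> apoly qff" where "e_const t = eqf [mon [(5, t)]] [(Dig t, [(6, t)])]"

definition e_add :: "nat \<Rightarrow> nat \<Rightarrow> nat \<Rightarrow> apoly qff" where
  "e_add t a b = eqf [mon [(5, t), (6, a), (6, b)]] [mon [(6, t), (5, a), (6, b)], mon [(6, t), (5, b), (6, a)]]"

definition e_mul :: "nat \<Rightarrow> nat \<Rightarrow> nat \<Rightarrow> apoly qff" where
  "e_mul t a b = eqf [mon [(5, t), (6, a), (6, b)]] [mon [(6, t), (5, a), (5, b)]]"

definition e_atom :: "nat \<Rightarrow> nat \<Rightarrow> apoly qff" where
  "e_atom a b = Le [mon [(5, a), (6, b)]] [mon [(5, b), (6, a)]]"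

lemmas f_defs = mon_def eqf_def outside_def f_link_def f_pos_def f_var_def f_const_def f_add_def
  f_corner_def f_mul_def f_atom_def e_unit_def e_var_def e_const_def e_add_def e_mul_def e_atom_def

text \<open>A token occupies four cells of the tape, so consecutive positions differ by 4.\<close>

definition second :: "nat \<Rightarrow> tm_term \<Rightarrow> nat" where
  "second p t = p + 4 + 4 * length (enc_term t)"

primrec nodes :: "nat \<Rightarrow> tm_term \<Rightarrow> (nat \<times> tm_term) list" where
  "nodes p (Var i) = [(p, Var i)]"
| "nodes p (Const c) = [(p, Const c)]"
| "nodes p (Add a b) = (p, Add a b) # nodes (p + 4) a @ nodes (second p a) b"
| "nodes p (Mul a b) = (p, Mul a b) # nodes (p + 4) a @ nodes (second p a) b"

definition second_qff :: "nat \<Rightarrow> tm_term qff \<Rightarrow> nat" where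
  "second_qff p a = p + 4 + 4 * length (enc_qff enc_term a)"

primrec qnodes :: "nat \<Rightarrow> tm_term qff \<Rightarrow> (nat \<times> tm_term) list" where
  "qnodes p (Le s t) = nodes (p + 4) s @ nodes (second p s) t"
| "qnodes p (And a b) = qnodes (p + 4) a @ qnodes (second_qff p a) b"
| "qnodes p (Or a b) = qnodes (p + 4) a @ qnodes (second_qff p a) b"

primrec skel :: "(nat \<Rightarrow> nat \<Rightarrow> apoly qff) \<Rightarrow> nat \<Rightarrow> tm_term qff \<Rightarrow> apoly qff" where
  "skel mk p (Le s t) = mk (p + 4) (second p s)"
| "skel mk p (And a b) = And (skel mk (p + 4) a) (skel mk (second_qff p a) b)"
| "skel mk p (Or a b) = Or (skel mk (p + 4) a) (skel mk (second_qff p a) b)"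

definition leaves :: "(nat \<times> tm_term) list \<Rightarrow> nat list" where
  "leaves ns = concat (map (\<lambda>(p, t). case t of Var i \<Rightarrow> [p] | _ \<Rightarrow> []) ns)"

fun f_node :: "nat \<Rightarrow> nat list \<Rightarrow> nat \<times> tm_term \<Rightarrow> apoly qff list" where
  "f_node M ls (p, Var i) = f_pos p # map (f_var M p) ls"
| "f_node M ls (p, Const c) = [f_pos p, f_const p]"
| "f_node M ls (p, Add a b) = [f_pos p, f_add p (p + 4) (second p a)]"
| "f_node M ls (p, Mul a b) = [f_pos p, f_mul p (p + 4) (second p a)]"

fun e_node :: "nat \<times> tm_term \<Rightarrow> apoly qff list" where
  "e_node (p, Var i) = [e_unit p, e_var p]"
| "e_node (p, Const c) = [e_unit p, e_const p]"
| "e_node (p, Add a b) = [e_unit p, e_add p (p + 4) (second p a)]"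
| "e_node (p, Mul a b) = [e_unit p, e_mul p (p + 4) (second p a)]"

definition links :: "nat \<Rightarrow> nat list \<Rightarrow> apoly qff list" where
  "links b ls = concat (map (\<lambda>p. map (f_link b p) ls) ls)"

text \<open>The folds are shaped for prefix notation: every item is preceded by its own connective,
  so a loop can print it without knowing whether another one follows.\<close>

definition Phi' :: "nat \<Rightarrow> (nat \<times> tm_term) list \<Rightarrow> nat \<Rightarrow> tm_term qff \<Rightarrow> apoly qff" where
  "Phi' M ns p \<Phi> = foldr And (links 0 (leaves ns))
     (foldr Or (concat (map (f_node M (leaves ns)) ns)) (skel f_atom p \<Phi>))"

text \<open>\<Psi> may not mention existential variables, yet \<open>ns\<close> also lists the
  subterms of \<Phi>. All leaves are therefore read in block 1, with universal stand-ins for the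
  existential variables. Equality of copies can be demanded outright, since this formula is a
  premise of the sentence itself.\<close>

definition Psi' :: "(nat \<times> tm_term) list \<Rightarrow> nat \<Rightarrow> tm_term qff \<Rightarrow> apoly qff" where
  "Psi' ns p \<Psi> = foldr And (links 1 (leaves ns)) (foldr And (concat (map e_node ns)) (skel e_atom p \<Psi>))"

section \<open>Equivalence over the reals\<close>

definition meval :: "(coef \<Rightarrow> int) \<Rightarrow> (nat \<Rightarrow> nat \<Rightarrow> real) \<Rightarrow> mono \<Rightarrow> real" where
  "meval cv \<rho> m = of_int (cv (fst m)) * (\<Prod>(b, k) \<leftarrow> snd m. \<rho> b k)"

definition aeval :: "(coef \<Rightarrow> int) \<Rightarrow> (nat \<Rightarrow> nat \<Rightarrow> real) \<Rightarrow> apoly \<Rightarrow> real" where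
  "aeval cv \<rho> P = (\<Sum>m \<leftarrow> P. meval cv \<rho> m)"

primrec qe :: "(coef \<Rightarrow> int) \<Rightarrow> (nat \<Rightarrow> nat \<Rightarrow> real) \<Rightarrow> apoly qff \<Rightarrow> bool" where
  "qe cv \<rho> (Le p q) = (aeval cv \<rho> p \<le> aeval cv \<rho> q)"
| "qe cv \<rho> (And a b) = (qe cv \<rho> a \<and> qe cv \<rho> b)"
| "qe cv \<rho> (Or a b) = (qe cv \<rho> a \<or> qe cv \<rho> b)"

lemma qe_foldr_And: "qe cv \<rho> (foldr And fs \<phi>) \<longleftrightarrow> (\<forall>f\<in>set fs. qe cv \<rho> f) \<and> qe cv \<rho> \<phi>"
  by (induction fs) auto

lemma qe_foldr_Or: "qe cv \<rho> (foldr Or fs \<phi>) \<longleftrightarrow> (\<exists>f\<in>set fs. qe cv \<rho> f) \<or> qe cv \<rho> \<phi>"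
  by (induction fs) auto

lemma leaves_iff: "p \<in> set (leaves ns) \<longleftrightarrow> (\<exists>i. (p, Var i) \<in> set ns)"
  by (force simp: leaves_def split: tm_term.splits)

text \<open>The properties of the input on which the equivalence rests. Environments assign a value
  to each block and position, before any numbering of variables; \<open>cv\<close> gives the
  integers that the digits in the input denote.\<close>

locale parsed =
  fixes ns :: "(nat \<times> tm_term) list" and cv :: "coef \<Rightarrow> int" and M m :: nat
  assumes inj: "(p, t) \<in> set ns \<Longrightarrow> (p, t') \<in> set ns \<Longrightarrow> t = t'"
    and sub: "(p, Add a b) \<in> set ns \<Longrightarrow> (p + 4, a) \<in> set ns \<and> (second p a, b) \<in> set ns"
      "(p, Mul a b) \<in> set ns \<Longrightarrow> (p + 4, a) \<in> set ns \<and> (second p a, b) \<in> set ns"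
    and cv: "cv One = 1" "(p, Var i) \<in> set ns \<Longrightarrow> cv (DigV p) = int i"
      "(p, Const c) \<in> set ns \<Longrightarrow> cv (Dig p) = c" "cv (DigV M) = int m"
begin

lemma mon_val [simp]:
  "aeval cv \<rho> [] = 0"
  "aeval cv \<rho> (x # xs) = meval cv \<rho> x + aeval cv \<rho> xs"
  "meval cv \<rho> (mon fs) = (\<Prod>(b, k) \<leftarrow> fs. \<rho> b k)"
  "meval cv \<rho> (c, fs) = of_int (cv c) * (\<Prod>(b, k) \<leftarrow> fs. \<rho> b k)"
  by (simp_all add: aeval_def meval_def mon_def cv)

text \<open>Each link is a single inequality, but the list runs over ordered pairs of leaves and so
  contains both directions.\<close>

lemma links_iff:
  "(\<forall>f\<in>set (links b (leaves ns)). qe cv \<rho> f) \<longleftrightarrow>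
   (\<forall>i p q. (p, Var i) \<in> set ns \<longrightarrow> (q, Var i) \<in> set ns \<longrightarrow> \<rho> b p = \<rho> b q)"
proof -
  have eq: "qe cv \<rho> (f_link b p q) \<longleftrightarrow> (i = j \<longrightarrow> \<rho> b p \<le> \<rho> b q)"
    if "(p, Var i) \<in> set ns" "(q, Var j) \<in> set ns" for p q i j
    using cv(2)[OF that(1)] cv(2)[OF that(2)] by (simp add: f_link_def) linarith
  have "(\<forall>f\<in>set (links b (leaves ns)). qe cv \<rho> f) \<longleftrightarrow>
    (\<forall>p\<in>set (leaves ns). \<forall>q\<in>set (leaves ns). qe cv \<rho> (f_link b p q))"
    by (simp add: links_def)
  also have "\<dots> \<longleftrightarrow> (\<forall>i j p q. (p, Var i) \<in> set ns \<longrightarrow> (q, Var j) \<in> set ns \<longrightarrow> i = j \<longrightarrow> \<rho> b p \<le> \<rho> b q)"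
    unfolding Ball_def leaves_iff using eq by blast
  also have "\<dots> \<longleftrightarrow> (\<forall>i p q. (p, Var i) \<in> set ns \<longrightarrow> (q, Var i) \<in> set ns \<longrightarrow> \<rho> b p = \<rho> b q)"
    by (metis order_antisym order_refl)
  finally show ?thesis .
qed

lemma qe_var:
  assumes "(p, Var i) \<in> set ns" "(q, Var j) \<in> set ns"
  shows "qe cv \<rho> (f_var M p q) \<longleftrightarrow> i = j \<and> \<not> (\<rho> 2 p < \<rho> (if i < m then 0 else 1) q * \<rho> 4 p \<and>
     \<rho> (if i < m then 0 else 1) q * \<rho> 4 p < \<rho> 3 p)"
  using cv(2)[OF assms(1)] cv(2)[OF assms(2)] cv(4) by (auto simp: f_var_def eqf_def outside_def)

text \<open>A bilinear function on a rectangle attains its minimum at a corner: for fixed y one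
  endpoint in x does not increase the product, and then one endpoint in y does not.\<close>

lemma corners:
  fixes c l u l' u' x y :: real
  assumes "l \<le> x" "x \<le> u" "l' \<le> y" "y \<le> u'"
    and "c < l * l'" "c < l * u'" "c < u * l'" "c < u * u'"
  shows "c < x * y"
proof -
  have "\<exists>z\<in>{l, u}. z * y \<le> x * y"
    using mult_right_mono[OF assms(1), of y] mult_right_mono_neg[OF assms(2), of y] by (cases "y \<ge> 0") auto
  then obtain z where z: "z \<in> {l, u}" "z * y \<le> x * y" by blast
  have "\<exists>w\<in>{l', u'}. z * w \<le> z * y"
    using mult_left_mono[OF assms(3), of z] mult_left_mono_neg[OF assms(4), of z] by (cases "z \<ge> 0") auto
  then show ?thesis using z assms by fastforce
qed

text \<open>Interval arithmetic by induction on the term. Any choice of one copy per variable may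
  serve as \<open>x\<close>: the copies may disagree, because every leaf interval contains all of
  them.\<close>

lemma sound:
  assumes np: "\<forall>f\<in>set (concat (map (f_node M (leaves ns)) ns)). \<not> qe cv \<rho> f"
    and x: "\<And>p i. (p, Var i) \<in> set ns \<Longrightarrow> \<exists>q. (q, Var i) \<in> set ns \<and> x i = \<rho> (if i < m then 0 else 1) q"
  shows "(p, t) \<in> set ns \<Longrightarrow> \<rho> 4 p > 0 \<and> \<rho> 2 p < eval_term t x * \<rho> 4 p \<and> eval_term t x * \<rho> 4 p < \<rho> 3 p"
proof (induction t arbitrary: p)
  case (Var i)
  then have f: "\<And>f. f \<in> set (f_node M (leaves ns) (p, Var i)) \<Longrightarrow> \<not> qe cv \<rho> f" using np by fastforce
  obtain q where q: "(q, Var i) \<in> set ns" "x i = \<rho> (if i < m then 0 else 1) q" using x[OF Var] by blast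
  have "q \<in> set (leaves ns)" using q leaves_iff by blast
  then have "\<not> qe cv \<rho> (f_var M p q)" "\<not> qe cv \<rho> (f_pos p)" using f by auto
  then show ?case using q unfolding qe_var[OF Var q(1)] by (simp add: f_pos_def)
next
  case (Const c)
  then have f: "\<And>f. f \<in> set (f_node M (leaves ns) (p, Const c)) \<Longrightarrow> \<not> qe cv \<rho> f" using np by fastforce
  then show ?case using cv(3)[OF Const] f[of "f_pos p"] f[of "f_const p"]
    by (auto simp: f_pos_def f_const_def outside_def)
next
  case (Add a b)
  let ?a = "p + 4" and ?b = "second p a"
  have f: "\<And>f. f \<in> set (f_node M (leaves ns) (p, Add a b)) \<Longrightarrow> \<not> qe cv \<rho> f" using np Add.prems by fastforce
  have n: "\<rho> 4 p > 0"
    "\<rho> 2 p * (\<rho> 4 ?a * \<rho> 4 ?b) < \<rho> 4 p * (\<rho> 2 ?a * \<rho> 4 ?b) + \<rho> 4 p * (\<rho> 2 ?b * \<rho> 4 ?a)"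
    "\<rho> 4 p * (\<rho> 3 ?a * \<rho> 4 ?b) + \<rho> 4 p * (\<rho> 3 ?b * \<rho> 4 ?a) < \<rho> 3 p * (\<rho> 4 ?a * \<rho> 4 ?b)"
    using f[of "f_pos p"] f[of "f_add p ?a ?b"] by (auto simp: f_pos_def f_add_def)
  define va vb where "va = eval_term a x" and "vb = eval_term b x"
  have ia: "\<rho> 4 ?a > 0" "\<rho> 2 ?a < va * \<rho> 4 ?a" "va * \<rho> 4 ?a < \<rho> 3 ?a"
    using Add.IH(1)[of ?a] sub(1)[OF Add.prems] va_def by auto
  have ib: "\<rho> 4 ?b > 0" "\<rho> 2 ?b < vb * \<rho> 4 ?b" "vb * \<rho> 4 ?b < \<rho> 3 ?b"
    using Add.IH(2)[of ?b] sub(1)[OF Add.prems] vb_def by auto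
  have e: "\<rho> 4 p * ((va * \<rho> 4 ?a) * \<rho> 4 ?b) + \<rho> 4 p * ((vb * \<rho> 4 ?b) * \<rho> 4 ?a)
      = ((va + vb) * \<rho> 4 p) * (\<rho> 4 ?a * \<rho> 4 ?b)" by (simp add: algebra_simps)
  have "\<rho> 4 p * (\<rho> 2 ?a * \<rho> 4 ?b) \<le> \<rho> 4 p * ((va * \<rho> 4 ?a) * \<rho> 4 ?b)"
    "\<rho> 4 p * (\<rho> 2 ?b * \<rho> 4 ?a) \<le> \<rho> 4 p * ((vb * \<rho> 4 ?b) * \<rho> 4 ?a)"
    "\<rho> 4 p * ((va * \<rho> 4 ?a) * \<rho> 4 ?b) \<le> \<rho> 4 p * (\<rho> 3 ?a * \<rho> 4 ?b)"
    "\<rho> 4 p * ((vb * \<rho> 4 ?b) * \<rho> 4 ?a) \<le> \<rho> 4 p * (\<rho> 3 ?b * \<rho> 4 ?a)"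
    using ia ib n(1) by (intro mult_left_mono mult_right_mono; simp)+
  then have "\<rho> 2 p * (\<rho> 4 ?a * \<rho> 4 ?b) < ((va + vb) * \<rho> 4 p) * (\<rho> 4 ?a * \<rho> 4 ?b)"
    "((va + vb) * \<rho> 4 p) * (\<rho> 4 ?a * \<rho> 4 ?b) < \<rho> 3 p * (\<rho> 4 ?a * \<rho> 4 ?b)"
    using n e by linarith+
  then show ?case using n(1) ia(1) ib(1) by (simp add: mult_less_cancel_right_pos va_def vb_def)
next
  case (Mul a b)
  let ?a = "p + 4" and ?b = "second p a"
  have f: "\<And>f. f \<in> set (f_node M (leaves ns) (p, Mul a b)) \<Longrightarrow> \<not> qe cv \<rho> f" using np Mul.prems by fastforce
  have n0: "\<rho> 4 p > 0" using f[of "f_pos p"] by (auto simp: f_pos_def)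
  have n: "\<rho> 2 p * (\<rho> 4 ?a * \<rho> 4 ?b) < \<rho> 4 p * (\<rho> f ?a * \<rho> g ?b)"
    "\<rho> 4 p * (\<rho> f ?a * \<rho> g ?b) < \<rho> 3 p * (\<rho> 4 ?a * \<rho> 4 ?b)" if "f \<in> {2, 3}" "g \<in> {2, 3}" for f g
    using that f[of "f_mul p ?a ?b"] by (auto simp: f_mul_def f_corner_def)
  define va vb where "va = eval_term a x" and "vb = eval_term b x"
  have ia: "\<rho> 4 ?a > 0" "\<rho> 2 ?a < va * \<rho> 4 ?a" "va * \<rho> 4 ?a < \<rho> 3 ?a"
    using Mul.IH(1)[of ?a] sub(2)[OF Mul.prems] va_def by auto
  have ib: "\<rho> 4 ?b > 0" "\<rho> 2 ?b < vb * \<rho> 4 ?b" "vb * \<rho> 4 ?b < \<rho> 3 ?b"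
    using Mul.IH(2)[of ?b] sub(2)[OF Mul.prems] vb_def by auto
  \<comment> \<open>\<open>c\<close> and \<open>d\<close> are the endpoints of the parent multiplied
    by the denominators of both children, so that they compare with products of numerators.\<close>
  define c where "c = \<rho> 2 p * (\<rho> 4 ?a * \<rho> 4 ?b) / \<rho> 4 p"
  define d where "d = \<rho> 3 p * (\<rho> 4 ?a * \<rho> 4 ?b) / \<rho> 4 p"
  have cd: "c < \<rho> f ?a * \<rho> g ?b" "\<rho> f ?a * \<rho> g ?b < d" if "f \<in> {2, 3}" "g \<in> {2, 3}" for f g
    unfolding c_def d_def using n[OF that] n0 by (simp_all add: field_simps)
  have 1: "c < (va * \<rho> 4 ?a) * (vb * \<rho> 4 ?b)"
    by (rule corners[of "\<rho> 2 ?a" _ "\<rho> 3 ?a" "\<rho> 2 ?b" _ "\<rho> 3 ?b"]) (use ia ib cd in auto)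
  \<comment> \<open>The upper bound is the lower bound for the rectangle reflected in its first
    coordinate.\<close>
  have "- d < (- (va * \<rho> 4 ?a)) * (vb * \<rho> 4 ?b)"
    by (rule corners[of "- \<rho> 3 ?a" _ "- \<rho> 2 ?a" "\<rho> 2 ?b" _ "\<rho> 3 ?b"]) (use ia ib cd in auto)
  then have 2: "(va * \<rho> 4 ?a) * (vb * \<rho> 4 ?b) < d" by simp
  have "\<rho> 2 p * (\<rho> 4 ?a * \<rho> 4 ?b) < ((va * vb) * \<rho> 4 p) * (\<rho> 4 ?a * \<rho> 4 ?b)"
    "((va * vb) * \<rho> 4 p) * (\<rho> 4 ?a * \<rho> 4 ?b) < \<rho> 3 p * (\<rho> 4 ?a * \<rho> 4 ?b)"
    using 1 2 n0 unfolding c_def d_def by (simp_all add: field_simps)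
  then show ?case using n0 ia(1) ib(1) by (simp add: mult_less_cancel_right_pos va_def vb_def)
qed

text \<open>An atom that holds for the values holds for the lower end on the left and the upper end
  on the right. Formulas have no negation, so the weakening passes through both connectives.\<close>

lemma sound_skel:
  assumes iv: "\<And>p t. (p, t) \<in> set ns \<Longrightarrow> \<rho> 4 p > 0 \<and> \<rho> 2 p < eval_term t x * \<rho> 4 p \<and> eval_term t x * \<rho> 4 p < \<rho> 3 p"
  shows "set (qnodes p \<Phi>) \<subseteq> set ns \<Longrightarrow> eval_qff eval_term \<Phi> x \<Longrightarrow> qe cv \<rho> (skel f_atom p \<Phi>)"
proof (induction \<Phi> arbitrary: p)
  case (Le s t)
  have self: "(q, u) \<in> set (nodes q u)" for q u by (cases u) auto
  let ?a = "p + 4" and ?b = "second p s"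
  have a: "(?a, s) \<in> set ns" "(?b, t) \<in> set ns" using Le.prems(1) self by (auto simp del: nodes.simps)
  note ia = iv[OF a(1)] and ib = iv[OF a(2)]
  have "\<rho> 2 ?a * \<rho> 4 ?b \<le> (eval_term s x * \<rho> 4 ?a) * \<rho> 4 ?b" using ia ib by (intro mult_right_mono) auto
  also have "\<dots> = eval_term s x * (\<rho> 4 ?a * \<rho> 4 ?b)" by simp
  also have "\<dots> \<le> eval_term t x * (\<rho> 4 ?a * \<rho> 4 ?b)" using ia ib Le.prems(2) by (intro mult_right_mono) auto
  also have "\<dots> = (eval_term t x * \<rho> 4 ?b) * \<rho> 4 ?a" by simp
  also have "\<dots> \<le> \<rho> 3 ?b * \<rho> 4 ?a" using ia ib by (intro mult_right_mono) auto
  finally show ?case by (simp add: f_atom_def)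
qed auto

end

text \<open>Half-widths of intervals centred at the exact values. For products, (a + r) * (b + s)
  differs from a * b by at most \<bar>a\<bar> * \<bar>s\<bar> + \<bar>b\<bar> * \<bar>r\<bar> +
  \<bar>r\<bar> * \<bar>s\<bar>; the additional \<open>h\<close> at each node makes the containment
  strict.\<close>

primrec radius :: "(nat \<Rightarrow> real) \<Rightarrow> real \<Rightarrow> tm_term \<Rightarrow> real" where
  "radius x h (Var i) = h"
| "radius x h (Const c) = h"
| "radius x h (Add a b) = radius x h a + radius x h b + h"
| "radius x h (Mul a b) = \<bar>eval_term a x\<bar> * radius x h b + \<bar>eval_term b x\<bar> * radius x h a
     + radius x h a * radius x h b + h"

lemma radius_pos: "h > 0 \<Longrightarrow> radius x h t > 0"
proof (induction t)
  case (Mul a b)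
  then have "\<bar>eval_term a x\<bar> * radius x h b \<ge> 0" "\<bar>eval_term b x\<bar> * radius x h a \<ge> 0"
    "radius x h a * radius x h b > 0" by simp_all
  then show ?case using Mul.prems by simp
qed auto

lemma radius_tendsto: "((\<lambda>h. radius x h t) \<longlongrightarrow> 0) (at_right 0)"
proof (induction t)
  case (Add a b)
  then show ?case using tendsto_add[OF tendsto_add[OF Add] tendsto_ident_at] by simp
next
  case (Mul a b)
  have "((\<lambda>h. \<bar>eval_term a x\<bar> * radius x h b + \<bar>eval_term b x\<bar> * radius x h a
     + radius x h a * radius x h b + h) \<longlongrightarrow> \<bar>eval_term a x\<bar> * 0 + \<bar>eval_term b x\<bar> * 0 + 0 * 0 + 0) (at_right 0)"
    by (intro tendsto_add tendsto_mult tendsto_const Mul tendsto_ident_at)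
  then show ?case by simp
qed (auto intro: tendsto_ident_at)

primrec relaxed :: "(nat \<Rightarrow> real) \<Rightarrow> real \<Rightarrow> tm_term qff \<Rightarrow> bool" where
  "relaxed x h (Le s t) = (eval_term s x - radius x h s \<le> eval_term t x + radius x h t)"
| "relaxed x h (And a b) = (relaxed x h a \<and> relaxed x h b)"
| "relaxed x h (Or a b) = (relaxed x h a \<or> relaxed x h b)"

text \<open>A false atom is false with a positive margin, and the radii of its two sides fall below
  it for small \<open>h\<close>. A disjunction needs the margins of both parts at once, hence the
  formulation with \<open>eventually\<close>.\<close>

lemma relaxed_limit:
  "\<not> eval_qff eval_term \<Phi> x \<Longrightarrow> eventually (\<lambda>h. \<not> relaxed x h \<Phi>) (at_right 0)"
proof (induction \<Phi>)
  case (Le s t)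
  have "((\<lambda>h. eval_term s x - radius x h s - (eval_term t x + radius x h t)) \<longlongrightarrow>
      eval_term s x - 0 - (eval_term t x + 0)) (at_right 0)"
    by (intro tendsto_diff tendsto_add tendsto_const radius_tendsto)
  then have "eventually (\<lambda>h. eval_term s x - radius x h s - (eval_term t x + radius x h t) > 0) (at_right 0)"
    using Le by (intro order_tendstoD) auto
  then show ?case by (rule eventually_mono) simp
next
  case (And a b)
  then show ?case by (auto elim: eventually_mono)
next
  case (Or a b)
  then have "eventually (\<lambda>h. \<not> relaxed x h a \<and> \<not> relaxed x h b) (at_right 0)"
    by (intro eventually_conj) auto
  then show ?case by (rule eventually_mono) simp
qed

lemma relaxed_imp:
  assumes "\<And>h. h > 0 \<Longrightarrow> relaxed x h \<Phi>"
  shows "eval_qff eval_term \<Phi> x"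
proof (rule ccontr)
  assume "\<not> ?thesis"
  then have "eventually (\<lambda>h. \<not> relaxed x h \<Phi>) (at_right 0)" by (rule relaxed_limit)
  moreover have "eventually (\<lambda>h. relaxed x h \<Phi>) (at_right 0)"
    using assms by (auto simp: eventually_at_right_less eventually_at_filter)
  ultimately have "eventually (\<lambda>h::real. False) (at_right 0)" by eventually_elim auto
  then show False by simp
qed

text \<open>The summand 1 keeps the denominator at most 1; the other two bound the absolute value of
  both endpoints, so that these scale into [-1, 1] as well.\<close>

definition den :: "(nat \<Rightarrow> real) \<Rightarrow> real \<Rightarrow> tm_term \<Rightarrow> real" where
  "den x h t = 1 / (1 + \<bar>eval_term t x\<bar> + radius x h t)"

lemma den:
  assumes "h > 0"
  shows "den x h t > 0" "den x h t \<le> 1" "\<bar>(eval_term t x - radius x h t) * den x h t\<bar> \<le> 1"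
    "\<bar>(eval_term t x + radius x h t) * den x h t\<bar> \<le> 1"
proof -
  have r: "radius x h t > 0" by (rule radius_pos[OF assms])
  show "den x h t > 0" "den x h t \<le> 1" unfolding den_def using r by (auto simp: divide_simps)
  show "\<bar>(eval_term t x - radius x h t) * den x h t\<bar> \<le> 1" "\<bar>(eval_term t x + radius x h t) * den x h t\<bar> \<le> 1"
    unfolding den_def using r by (auto simp: divide_simps)
qed

context parsed
begin

text \<open>Intervals of these radii around the exact values meet every premise, with the slack
  \<open>h\<close> at each node times positive denominators.\<close>

lemma complete:
  assumes h: "h > 0"
    and x: "\<And>p i. (p, Var i) \<in> set ns \<Longrightarrow> \<rho> (if i < m then 0 else 1) p = x i"
    and D: "\<And>p t. (p, t) \<in> set ns \<Longrightarrow> \<rho> 4 p = den x h t"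
    and L: "\<And>p t. (p, t) \<in> set ns \<Longrightarrow> \<rho> 2 p = (eval_term t x - radius x h t) * den x h t"
    and U: "\<And>p t. (p, t) \<in> set ns \<Longrightarrow> \<rho> 3 p = (eval_term t x + radius x h t) * den x h t"
  shows "\<forall>f\<in>set (concat (map (f_node M (leaves ns)) ns)). \<not> qe cv \<rho> f"
proof -
  note d = den(1)[OF h, of x] and r = radius_pos[OF h, of x]
  have "\<not> qe cv \<rho> f" if pt: "(p, t) \<in> set ns" and f: "f \<in> set (f_node M (leaves ns) (p, t))" for p t f
  proof (cases "f = f_pos p")
    case True
    then show ?thesis using D[OF pt] d[of t] by (simp add: f_pos_def)
  next
    case False
    show ?thesis
    proof (cases t)
      case (Var i)
      then obtain q j where q: "f = f_var M p q" "(q, Var j) \<in> set ns" using f False by (auto simp: leaves_iff)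
      have p: "(p, Var i) \<in> set ns" using pt Var by simp
      have "(x i - h) * den x h (Var i) < x i * den x h (Var i)" "x i * den x h (Var i) < (x i + h) * den x h (Var i)"
        using d[of "Var i"] h by simp_all
      then have "i = j \<Longrightarrow> \<rho> 2 p < \<rho> (if i < m then 0 else 1) q * \<rho> 4 p \<and> \<rho> (if i < m then 0 else 1) q * \<rho> 4 p < \<rho> 3 p"
        using x[OF q(2)] D[OF p] L[OF p] U[OF p] by simp
      then show ?thesis unfolding q(1) qe_var[OF p q(2)] by blast
    next
      case (Const c)
      have p: "(p, Const c) \<in> set ns" using pt Const by simp
      have "(c - h) * den x h (Const c) < c * den x h (Const c)" "c * den x h (Const c) < (c + h) * den x h (Const c)"
        using d[of "Const c"] h by simp_all
      moreover have "f = f_const p" using f False Const by auto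
      ultimately show ?thesis
        using D[OF p] L[OF p] U[OF p] cv(3)[OF p] by (simp add: f_const_def outside_def)
    next
      case (Add a b)
      have p: "(p, Add a b) \<in> set ns" using pt Add by simp
      let ?a = "p + 4" and ?b = "second p a"
      have a: "(?a, a) \<in> set ns" and b: "(?b, b) \<in> set ns" using sub(1)[OF p] by auto
      \<comment> \<open>With this common factor the two sides of either inequality differ by exactly
        \<open>h * k\<close>.\<close>
      define k where "k = den x h t * den x h a * den x h b"
      have k: "k > 0" unfolding k_def using d by simp
      have k': "h * k > 0" using k h by simp
      have "f = f_add p ?a ?b" using f False Add by auto
      then show ?thesis
        using k' unfolding k_def Add
        by (simp add: f_add_def D[OF a] D[OF b] D[OF p] L[OF a] L[OF b] L[OF p] U[OF a] U[OF b] U[OF p] algebra_simps)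
    next
      case (Mul a b)
      have p: "(p, Mul a b) \<in> set ns" using pt Mul by simp
      let ?a = "p + 4" and ?b = "second p a"
      have a: "(?a, a) \<in> set ns" and b: "(?b, b) \<in> set ns" using sub(2)[OF p] by auto
      define k where "k = den x h (Mul a b) * den x h a * den x h b"
      have k: "k > 0" unfolding k_def using d by simp
      define va vb ra rb where "va = eval_term a x" and "vb = eval_term b x" and "ra = radius x h a" and "rb = radius x h b"
      have rr: "ra > 0" "rb > 0" unfolding ra_def rb_def using r by auto
      \<comment> \<open>The signs \<open>s\<close> and \<open>s'\<close> select a corner: -1 for the
        lower end, 1 for the upper end of the respective factor.\<close>
      have key: "va * vb - (\<bar>va\<bar> * rb + \<bar>vb\<bar> * ra + ra * rb + h) < (va + s * ra) * (vb + s' * rb)"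
         "(va + s * ra) * (vb + s' * rb) < va * vb + (\<bar>va\<bar> * rb + \<bar>vb\<bar> * ra + ra * rb + h)"
        if "s \<in> {-1, 1}" "s' \<in> {-1, 1}" for s s' :: real
      proof -
        have "\<bar>s' * va * rb\<bar> = \<bar>va\<bar> * rb" "\<bar>s * vb * ra\<bar> = \<bar>vb\<bar> * ra" "\<bar>s * s' * (ra * rb)\<bar> = ra * rb"
          using that rr by (auto simp: abs_mult)
        moreover have "(va + s * ra) * (vb + s' * rb) = va * vb + s' * va * rb + s * vb * ra + s * s' * (ra * rb)"
          by (simp add: algebra_simps)
        ultimately show "va * vb - (\<bar>va\<bar> * rb + \<bar>vb\<bar> * ra + ra * rb + h) < (va + s * ra) * (vb + s' * rb)"
         "(va + s * ra) * (vb + s' * rb) < va * vb + (\<bar>va\<bar> * rb + \<bar>vb\<bar> * ra + ra * rb + h)"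
          using h by linarith+
      qed
      have c: "\<not> qe cv \<rho> (f_corner p ?a ?b fa fb)" if "(fa, s) \<in> {(2, -1), (3, 1)}" "(fb, s') \<in> {(2, -1), (3, 1)}"
        for fa fb and s s' :: real
      proof -
        have ss: "s \<in> {-1, 1}" "s' \<in> {-1, 1}" using that by auto
        have 1: "\<rho> fa ?a = (va + s * ra) * den x h a" "\<rho> fb ?b = (vb + s' * rb) * den x h b"
          using that L[OF a] U[OF a] L[OF b] U[OF b] by (auto simp: va_def vb_def ra_def rb_def)
        have 2: "\<rho> 2 p * (\<rho> 4 ?a * \<rho> 4 ?b) = (va * vb - (\<bar>va\<bar> * rb + \<bar>vb\<bar> * ra + ra * rb + h)) * k"
          "\<rho> 3 p * (\<rho> 4 ?a * \<rho> 4 ?b) = (va * vb + (\<bar>va\<bar> * rb + \<bar>vb\<bar> * ra + ra * rb + h)) * k"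
          using D[OF a] D[OF b] L[OF p] U[OF p] by (simp_all add: k_def va_def vb_def ra_def rb_def)
        have 3: "\<rho> 4 p * (\<rho> fa ?a * \<rho> fb ?b) = ((va + s * ra) * (vb + s' * rb)) * k"
          unfolding 1 using D[OF p] by (simp add: k_def)
        show ?thesis
          using mult_strict_right_mono[OF key(1)[OF ss] k] mult_strict_right_mono[OF key(2)[OF ss] k] 2 3
          by (simp add: f_corner_def)
      qed
      have "f = f_mul p ?a ?b" using f False Mul by auto
      then show ?thesis using c[of 2 "-1" 2 "-1"] c[of 2 "-1" 3 1] c[of 3 1 2 "-1"] c[of 3 1 3 1]
        by (simp add: f_mul_def)
    qed
  qed
  then show ?thesis by auto
qed

lemma complete_skel:
  assumes h: "h > 0"
    and D: "\<And>p t. (p, t) \<in> set ns \<Longrightarrow> \<rho> 4 p = den x h t"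
    and L: "\<And>p t. (p, t) \<in> set ns \<Longrightarrow> \<rho> 2 p = (eval_term t x - radius x h t) * den x h t"
    and U: "\<And>p t. (p, t) \<in> set ns \<Longrightarrow> \<rho> 3 p = (eval_term t x + radius x h t) * den x h t"
  shows "set (qnodes p \<Phi>) \<subseteq> set ns \<Longrightarrow> qe cv \<rho> (skel f_atom p \<Phi>) \<Longrightarrow> relaxed x h \<Phi>"
proof (induction \<Phi> arbitrary: p)
  case (Le s t)
  have self: "(q, u) \<in> set (nodes q u)" for q u by (cases u) auto
  have a: "(p + 4, s) \<in> set ns" "(second p s, t) \<in> set ns" using Le.prems(1) self by (auto simp del: nodes.simps)
  have k: "den x h s * den x h t > 0" using den(1)[OF h] by simp
  have "(eval_term s x - radius x h s) * (den x h s * den x h t) \<le> (eval_term t x + radius x h t) * (den x h s * den x h t)"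
    using Le.prems(2) D[OF a(1)] D[OF a(2)] L[OF a(1)] U[OF a(2)] by (simp add: f_atom_def mult_ac)
  then show ?case using mult_le_cancel_right_pos[OF k] by simp
qed auto

text \<open>A denominator 0 would force the numerator to be 0 too, which contradicts the unit
  circle; so the denominator is positive. At inner nodes the equation is first divided by the
  denominators of the children, positive by induction.\<close>

lemma exact_unique:
  assumes np: "\<forall>f\<in>set (concat (map e_node ns)). qe cv \<rho> f"
    and x: "\<And>p i. (p, Var i) \<in> set ns \<Longrightarrow> x i = \<rho> 1 p"
  shows "(p, t) \<in> set ns \<Longrightarrow> \<rho> 6 p > 0 \<and> \<rho> 5 p = eval_term t x * \<rho> 6 p"
proof (induction t arbitrary: p)
  case (Var i)
  then have f: "\<And>f. f \<in> set (e_node (p, Var i)) \<Longrightarrow> qe cv \<rho> f" using np by fastforce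
  have "\<rho> 6 p \<ge> 0" "\<rho> 5 p * \<rho> 5 p + \<rho> 6 p * \<rho> 6 p = 1" "\<rho> 5 p = x i * \<rho> 6 p"
    using f[of "e_unit p"] f[of "e_var p"] x[OF Var] by (auto simp: e_unit_def e_var_def eqf_def)
  then show ?case by (cases "\<rho> 6 p = 0") auto
next
  case (Const c)
  then have f: "\<And>f. f \<in> set (e_node (p, Const c)) \<Longrightarrow> qe cv \<rho> f" using np by fastforce
  have "\<rho> 6 p \<ge> 0" "\<rho> 5 p * \<rho> 5 p + \<rho> 6 p * \<rho> 6 p = 1" "\<rho> 5 p = c * \<rho> 6 p"
    using f[of "e_unit p"] f[of "e_const p"] cv(3)[OF Const] by (auto simp: e_unit_def e_const_def eqf_def)
  then show ?case by (cases "\<rho> 6 p = 0") auto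
next
  case (Add a b)
  let ?a = "p + 4" and ?b = "second p a"
  have f: "\<And>f. f \<in> set (e_node (p, Add a b)) \<Longrightarrow> qe cv \<rho> f" using np Add.prems by fastforce
  have n: "\<rho> 6 p \<ge> 0" "\<rho> 5 p * \<rho> 5 p + \<rho> 6 p * \<rho> 6 p = 1"
    "\<rho> 5 p * (\<rho> 6 ?a * \<rho> 6 ?b) = \<rho> 6 p * (\<rho> 5 ?a * \<rho> 6 ?b) + \<rho> 6 p * (\<rho> 5 ?b * \<rho> 6 ?a)"
    using f[of "e_unit p"] f[of "e_add p ?a ?b"] by (auto simp: e_unit_def e_add_def eqf_def)
  have i: "\<rho> 6 ?a > 0" "\<rho> 5 ?a = eval_term a x * \<rho> 6 ?a" "\<rho> 6 ?b > 0" "\<rho> 5 ?b = eval_term b x * \<rho> 6 ?b"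
    using Add.IH sub(1)[OF Add.prems] by auto
  have "\<rho> 5 p * (\<rho> 6 ?a * \<rho> 6 ?b) = ((eval_term a x + eval_term b x) * \<rho> 6 p) * (\<rho> 6 ?a * \<rho> 6 ?b)"
    using n(3) i by (simp add: algebra_simps)
  then have "\<rho> 5 p = (eval_term a x + eval_term b x) * \<rho> 6 p" using i by simp
  then show ?case using n(1,2) by (cases "\<rho> 6 p = 0") auto
next
  case (Mul a b)
  let ?a = "p + 4" and ?b = "second p a"
  have f: "\<And>f. f \<in> set (e_node (p, Mul a b)) \<Longrightarrow> qe cv \<rho> f" using np Mul.prems by fastforce
  have n: "\<rho> 6 p \<ge> 0" "\<rho> 5 p * \<rho> 5 p + \<rho> 6 p * \<rho> 6 p = 1"
    "\<rho> 5 p * (\<rho> 6 ?a * \<rho> 6 ?b) = \<rho> 6 p * (\<rho> 5 ?a * \<rho> 5 ?b)"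
    using f[of "e_unit p"] f[of "e_mul p ?a ?b"] by (auto simp: e_unit_def e_mul_def eqf_def)
  have i: "\<rho> 6 ?a > 0" "\<rho> 5 ?a = eval_term a x * \<rho> 6 ?a" "\<rho> 6 ?b > 0" "\<rho> 5 ?b = eval_term b x * \<rho> 6 ?b"
    using Mul.IH sub(2)[OF Mul.prems] by auto
  have "\<rho> 5 p * (\<rho> 6 ?a * \<rho> 6 ?b) = ((eval_term a x * eval_term b x) * \<rho> 6 p) * (\<rho> 6 ?a * \<rho> 6 ?b)"
    using n(3) i by (simp add: algebra_simps)
  then have "\<rho> 5 p = (eval_term a x * eval_term b x) * \<rho> 6 p" using i by simp
  then show ?case using n(1,2) by (cases "\<rho> 6 p = 0") auto
qed

lemma exact_skel:
  assumes iv: "\<And>p t. (p, t) \<in> set ns \<Longrightarrow> \<rho> 6 p > 0 \<and> \<rho> 5 p = eval_term t x * \<rho> 6 p"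
  shows "set (qnodes p \<Psi>) \<subseteq> set ns \<Longrightarrow> qe cv \<rho> (skel e_atom p \<Psi>) \<longleftrightarrow> eval_qff eval_term \<Psi> x"
proof (induction \<Psi> arbitrary: p)
  case (Le s t)
  have self: "(q, u) \<in> set (nodes q u)" for q u by (cases u) auto
  let ?a = "p + 4" and ?b = "second p s"
  have a: "(?a, s) \<in> set ns" "(?b, t) \<in> set ns" using Le.prems(1) self by (auto simp del: nodes.simps)
  note ia = iv[OF a(1)] and ib = iv[OF a(2)]
  have "\<rho> 5 ?a * \<rho> 6 ?b \<le> \<rho> 5 ?b * \<rho> 6 ?a \<longleftrightarrow>
      eval_term s x * (\<rho> 6 ?a * \<rho> 6 ?b) \<le> eval_term t x * (\<rho> 6 ?a * \<rho> 6 ?b)"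
    using ia ib by (simp add: mult_ac)
  also have "\<dots> \<longleftrightarrow> eval_term s x \<le> eval_term t x" using ia ib by (intro mult_le_cancel_right_pos) simp
  finally show ?case by (simp add: e_atom_def)
qed auto

text \<open>For a node of value v, the pair in blocks 5 and 6 is the point where the ray through (v,
  1) meets the unit circle.\<close>

lemma exact_exists:
  assumes x: "\<And>p i. (p, Var i) \<in> set ns \<Longrightarrow> x i = \<rho> 1 p"
    and E: "\<And>p t. (p, t) \<in> set ns \<Longrightarrow> \<rho> 6 p = 1 / sqrt (1 + (eval_term t x)\<^sup>2)"
    and Z: "\<And>p t. (p, t) \<in> set ns \<Longrightarrow> \<rho> 5 p = eval_term t x / sqrt (1 + (eval_term t x)\<^sup>2)"
  shows "\<forall>f\<in>set (concat (map e_node ns)). qe cv \<rho> f"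
proof -
  have EZ: "\<rho> 5 p = eval_term t x * \<rho> 6 p" "\<rho> 6 p \<ge> 0" "\<rho> 5 p * \<rho> 5 p + \<rho> 6 p * \<rho> 6 p = 1" if "(p, t) \<in> set ns" for p t
  proof -
    have "1 + (eval_term t x)\<^sup>2 > 0" by (simp add: add_pos_nonneg)
    then show "\<rho> 5 p * \<rho> 5 p + \<rho> 6 p * \<rho> 6 p = 1"
      unfolding E[OF that] Z[OF that] by (simp add: field_simps power2_eq_square)
  qed (simp_all add: E[OF that] Z[OF that])
  have "qe cv \<rho> f" if pt: "(p, t) \<in> set ns" and f: "f \<in> set (e_node (p, t))" for p t f
  proof (cases "f = e_unit p")
    case True
    then show ?thesis using EZ[OF pt] by (simp add: e_unit_def eqf_def)
  next
    case False
    show ?thesis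
    proof (cases t)
      case (Var i)
      then show ?thesis using f False pt EZ(1)[OF pt] x by (auto simp: e_var_def eqf_def)
    next
      case (Const c)
      then show ?thesis using f False pt EZ(1)[OF pt] cv(3) by (auto simp: e_const_def eqf_def)
    next
      case (Add a b)
      then have s: "(p + 4, a) \<in> set ns" "(second p a, b) \<in> set ns" using sub(1) pt by auto
      have "f = e_add p (p + 4) (second p a)" using f False Add by auto
      then show ?thesis using EZ(1)[OF pt] EZ(1)[OF s(1)] EZ(1)[OF s(2)] Add
        by (simp add: e_add_def eqf_def algebra_simps)
    next
      case (Mul a b)
      then have s: "(p + 4, a) \<in> set ns" "(second p a, b) \<in> set ns" using sub(2) pt by auto
      have "f = e_mul p (p + 4) (second p a)" using f False Mul by auto
      then show ?thesis using EZ(1)[OF pt] EZ(1)[OF s(1)] EZ(1)[OF s(2)] Mul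
        by (simp add: e_mul_def eqf_def algebra_simps)
    qed
  qed
  then show ?thesis by auto
qed

end

section \<open>Transfer to sentences\<close>

lemma eval_term_cong: "(\<And>i. i \<in> vars_term t \<Longrightarrow> x i = y i) \<Longrightarrow> eval_term t x = eval_term t y"
  by (induction t) auto

lemma eval_qff_cong:
  "(\<And>i. i \<in> vars_qff vars_term \<Phi> \<Longrightarrow> x i = y i) \<Longrightarrow> eval_qff eval_term \<Phi> x = eval_qff eval_term \<Phi> y"
proof (induction \<Phi>)
  case (Le s t)
  then show ?case using eval_term_cong[of s x y] eval_term_cong[of t x y] by (auto simp: vars_qff_def)
next
  case (And a b)
  then show ?case by (auto simp: vars_qff_def)
next
  case (Or a b)
  then show ?case by (auto simp: vars_qff_def)
qed

lemma vars_qff_simps: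
  "vars_qff vs (Le p q) = vs p \<union> vs q"
  "vars_qff vs (And a b) = vars_qff vs a \<union> vars_qff vs b"
  "vars_qff vs (Or a b) = vars_qff vs a \<union> vars_qff vs b"
  by (auto simp: vars_qff_def)

text \<open>The default 0 off the image keeps the whole assignment within [-1, 1].\<close>

lemma extend_inj:
  assumes "inj_on f A"
  shows "\<exists>Y :: 'b \<Rightarrow> real. (\<forall>a\<in>A. Y (f a) = g a) \<and> (\<forall>y. y \<notin> f ` A \<longrightarrow> Y y = 0)"
  by (rule exI[of _ "\<lambda>y. if y \<in> f ` A then g (inv_into A f y) else 0"]) (use assms in auto)

text \<open>The two output formats use different numberings of the variables. The equivalence
  depends only on injectivity and on block 0 falling into the existential variables and the other
  blocks into the universal ones.\<close>

locale numbered = parsed +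
  fixes \<iota> :: "nat \<Rightarrow> nat \<Rightarrow> nat" and m' n' N n :: nat
  assumes i0: "k < N \<Longrightarrow> \<iota> 0 k < m'"
    and i1: "1 \<le> b \<Longrightarrow> b < 7 \<Longrightarrow> k < N \<Longrightarrow> m' \<le> \<iota> b k \<and> \<iota> b k < m' + n'"
    and iinj: "b < 7 \<Longrightarrow> k < N \<Longrightarrow> c < 7 \<Longrightarrow> l < N \<Longrightarrow> \<iota> b k = \<iota> c l \<Longrightarrow> b = c \<and> k = l"
    and pos: "(p, t) \<in> set ns \<Longrightarrow> p < N"
    and vars: "(p, Var i) \<in> set ns \<Longrightarrow> i < m + n"
begin

definition val :: "(nat \<Rightarrow> real) \<Rightarrow> (nat \<Rightarrow> real) \<Rightarrow> nat \<Rightarrow> nat \<Rightarrow> real" where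
  "val X Y b k = join m' X Y (\<iota> b k)"

definition T :: "nat \<Rightarrow> tm_term" where "T p = the (map_of ns p)"

lemma T: "(p, t) \<in> set ns \<Longrightarrow> T p = t"
  unfolding T_def using inj map_of_SomeD weak_map_of_SomeI by (metis option.sel)

text \<open>\<open>None\<close> stands for the classes without a premise; together with the flag
  \<open>bd\<close> for bounded quantifiers this lets one argument serve all three classes.\<close>

definition guard :: "tm_term qff option \<Rightarrow> nat \<Rightarrow> (nat \<Rightarrow> nat \<Rightarrow> real) \<Rightarrow> bool" where
  "guard \<Psi> q \<rho> = (case \<Psi> of None \<Rightarrow> True | Some \<psi> \<Rightarrow> qe cv \<rho> (Psi' ns q \<psi>))"

definition premise :: "tm_term qff option \<Rightarrow> (nat \<Rightarrow> real) \<Rightarrow> bool" where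
  "premise \<Psi> x = (case \<Psi> of None \<Rightarrow> True | Some \<psi> \<Rightarrow> eval_qff eval_term \<psi> x)"

definition some_leaf :: "nat \<Rightarrow> nat" where "some_leaf i = (SOME p. (p, Var i) \<in> set ns)"

lemma some_leaf: "(p, Var i) \<in> set ns \<Longrightarrow> (some_leaf i, Var i) \<in> set ns"
  unfolding some_leaf_def by (rule someI)

lemma qnodes_vars:
  assumes "i \<in> vars_qff vars_term \<psi>" "set (qnodes q \<psi>) \<subseteq> set ns"
  shows "\<exists>p. (p, Var i) \<in> set ns"
proof -
  have t: "i \<in> vars_term t \<Longrightarrow> \<exists>p. (p, Var i) \<in> set (nodes k t)" for k t
  proof (induction t arbitrary: k)
    case (Add a b)
    then show ?case using Add.IH(1)[of "k + 4"] Add.IH(2)[of "second k a"] by auto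
  next
    case (Mul a b)
    then show ?case using Mul.IH(1)[of "k + 4"] Mul.IH(2)[of "second k a"] by auto
  qed auto
  have "i \<in> vars_qff vars_term \<psi> \<Longrightarrow> \<exists>p. (p, Var i) \<in> set (qnodes q \<psi>)"
  proof (induction \<psi> arbitrary: q)
    case (Le u v)
    then show ?case using t[of u "q + 4"] t[of v "second q u"] by (auto simp: vars_qff_simps)
  next
    case (And a b)
    then show ?case using And.IH(1)[of "q + 4"] And.IH(2)[of "second_qff q a"] by (auto simp: vars_qff_simps)
  next
    case (Or a b)
    then show ?case using Or.IH(1)[of "q + 4"] Or.IH(2)[of "second_qff q a"] by (auto simp: vars_qff_simps)
  qed
  then show ?thesis using assms by blast
qed

text \<open>X' repeats each existential value at all its occurrences. Given Y', either a premise
  about intervals fails and its negation is a true disjunct, or the intervals enclose the values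
  under the assignment that reads one copy of each universal variable, and the old sentence applies
  to that assignment.\<close>

lemma old_to_new:
  assumes nodes: "set (qnodes p \<Phi>) \<subseteq> set ns"
    and psi: "\<And>\<psi>. \<Psi> = Some \<psi> \<Longrightarrow> set (qnodes q \<psi>) \<subseteq> set ns \<and> vars_qff vars_term \<psi> \<subseteq> {m..}"
    and old: "\<And>Y. (bd \<longrightarrow> (\<forall>j<n. \<bar>Y j\<bar> \<le> 1)) \<Longrightarrow> (bd \<longrightarrow> (\<forall>i<m. \<bar>X i\<bar> \<le> 1))
        \<and> (premise \<Psi> (join m X Y) \<longrightarrow> eval_qff eval_term \<Phi> (join m X Y))"
  shows "\<exists>X'. \<forall>Y'. (bd \<longrightarrow> (\<forall>j<n'. \<bar>Y' j\<bar> \<le> 1)) \<longrightarrow> (bd \<longrightarrow> (\<forall>i<m'. \<bar>X' i\<bar> \<le> 1))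
        \<and> (guard \<Psi> q (val X' Y') \<longrightarrow> qe cv (val X' Y') (Phi' M ns p \<Phi>))"
proof -
  have Xb: "bd \<Longrightarrow> i < m \<Longrightarrow> \<bar>X i\<bar> \<le> 1" for i using old[of "\<lambda>_. 0"] by auto
  let ?xv = "\<lambda>p. case T p of Var i \<Rightarrow> if i < m then X i else 0 | _ \<Rightarrow> 0"
  obtain X' where X': "\<forall>a\<in>{..<N}. X' (\<iota> 0 a) = ?xv a" "\<forall>y. y \<notin> \<iota> 0 ` {..<N} \<longrightarrow> X' y = 0"
    using extend_inj[of "\<iota> 0" "{..<N}" ?xv] iinj[of 0 _ 0] by (auto simp: inj_on_def)
  have X'b: "\<bar>X' i\<bar> \<le> 1" if bd for i
  proof (cases "i \<in> \<iota> 0 ` {..<N}")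
    case True
    then obtain a where "a < N" "i = \<iota> 0 a" by auto
    then show ?thesis using X'(1) Xb[OF that] by (auto split: tm_term.splits)
  qed (use X' in auto)
  show ?thesis
  proof (intro exI allI impI conjI)
    fix Y' :: "nat \<Rightarrow> real" assume Yb: "bd \<longrightarrow> (\<forall>j<n'. \<bar>Y' j\<bar> \<le> 1)"
    show "\<bar>X' i\<bar> \<le> 1" if bd "i < m'" for i using X'b that by blast
    assume G: "guard \<Psi> q (val X' Y')"
    define \<rho> where "\<rho> = val X' Y'"
    have r0: "\<rho> 0 p = (if i < m then X i else 0)" if "(p, Var i) \<in> set ns" for p i
      using X'(1) pos[OF that] T[OF that] i0[OF pos[OF that]] by (simp add: \<rho>_def val_def join_def)
    have r1: "bd \<Longrightarrow> \<bar>\<rho> 1 p\<bar> \<le> 1" if "(p, t) \<in> set ns" for p t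
    proof -
      assume bd
      moreover have "m' \<le> \<iota> 1 p" "\<iota> 1 p < m' + n'" using i1[of 1 p] pos[OF that] by auto
      ultimately show ?thesis using Yb by (simp add: \<rho>_def val_def join_def)
    qed
    define Y where "Y = (\<lambda>j. if \<exists>p. (p, Var (m + j)) \<in> set ns then \<rho> 1 (some_leaf (m + j)) else 0)"
    define x where "x = join m X Y"
    have "bd \<longrightarrow> (\<forall>j<n. \<bar>Y j\<bar> \<le> 1)"
      unfolding Y_def using r1[OF some_leaf] by auto
    note o = old[OF this, folded x_def]
    have x1: "x i = \<rho> 1 (some_leaf i)" if "\<not> i < m" "(p, Var i) \<in> set ns" for p i
      using that by (auto simp: x_def join_def Y_def)
    have x: "\<exists>q. (q, Var i) \<in> set ns \<and> x i = \<rho> (if i < m then 0 else 1) q" if "(p, Var i) \<in> set ns" for p i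
    proof (cases "i < m")
      case True
      then show ?thesis using that r0[OF that] by (auto simp: x_def join_def)
    next
      case False
      then show ?thesis using x1[OF False that] some_leaf[OF that] by auto
    qed
    have l0: "\<forall>f\<in>set (links 0 (leaves ns)). qe cv \<rho> f"
      unfolding links_iff using r0 by auto
    have pr: "premise \<Psi> x"
    proof (cases \<Psi>)
      case (Some \<psi>)
      then have g: "qe cv \<rho> (Psi' ns q \<psi>)" using G by (simp add: guard_def \<rho>_def)
      \<comment> \<open>\<open>Psi'\<close> reads every leaf in block 1, so its exact values belong
        to \<open>x2\<close>. This may differ from \<open>x\<close> at existential variables, which
        do not occur in \<open>\<psi>\<close>.\<close>
      define x2 where "x2 = (\<lambda>i. \<rho> 1 (some_leaf i))"
      have "x2 i = \<rho> 1 p" if "(p, Var i) \<in> set ns" for p i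
        using g some_leaf[OF that] that unfolding Psi'_def qe_foldr_And links_iff x2_def by blast
      then have iv: "\<And>p t. (p, t) \<in> set ns \<Longrightarrow> \<rho> 6 p > 0 \<and> \<rho> 5 p = eval_term t x2 * \<rho> 6 p"
        using exact_unique[of \<rho> x2] g unfolding Psi'_def qe_foldr_And by blast
      have nq: "set (qnodes q \<psi>) \<subseteq> set ns" using psi[OF Some] by simp
      have "eval_qff eval_term \<psi> x2"
        using exact_skel[of \<rho> x2, OF iv nq] g unfolding Psi'_def qe_foldr_And by blast
      moreover have "x2 i = x i" if v: "i \<in> vars_qff vars_term \<psi>" for i
      proof -
        obtain p where "(p, Var i) \<in> set ns" using qnodes_vars[OF v nq] by blast
        moreover have "\<not> i < m" using psi[OF Some] v by auto
        ultimately show ?thesis using x1 x2_def by simp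
      qed
      ultimately show ?thesis using eval_qff_cong[of \<psi> x2 x] Some by (simp add: premise_def)
    qed (simp add: premise_def)
    have "qe cv \<rho> (foldr Or (concat (map (f_node M (leaves ns)) ns)) (skel f_atom p \<Phi>))"
    proof (cases "\<forall>f\<in>set (concat (map (f_node M (leaves ns)) ns)). \<not> qe cv \<rho> f")
      case True
      have "qe cv \<rho> (skel f_atom p \<Phi>)"
      proof (rule sound_skel[OF _ nodes])
        show "\<And>p t. (p, t) \<in> set ns \<Longrightarrow> \<rho> 4 p > 0 \<and> \<rho> 2 p < eval_term t x * \<rho> 4 p \<and> eval_term t x * \<rho> 4 p < \<rho> 3 p"
          by (rule sound[OF True]) (use x in blast)+
      qed (use o pr in blast)
      then show ?thesis unfolding qe_foldr_Or by blast
    qed (unfold qe_foldr_Or, blast)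
    then show "qe cv (val X' Y') (Phi' M ns p \<Phi>)"
      using l0 unfolding Phi'_def qe_foldr_And \<rho>_def by blast
  qed
qed

lemma new_to_old:
  assumes nodes: "set (qnodes p \<Phi>) \<subseteq> set ns"
    and psi: "\<And>\<psi>. \<Psi> = Some \<psi> \<Longrightarrow> set (qnodes q \<psi>) \<subseteq> set ns \<and> vars_qff vars_term \<psi> \<subseteq> {m..}"
    and new: "\<And>Y'. (bd \<longrightarrow> (\<forall>j<n'. \<bar>Y' j\<bar> \<le> 1)) \<Longrightarrow> (bd \<longrightarrow> (\<forall>i<m'. \<bar>X' i\<bar> \<le> 1))
        \<and> (guard \<Psi> q (val X' Y') \<longrightarrow> qe cv (val X' Y') (Phi' M ns p \<Phi>))"
  shows "\<exists>X. \<forall>Y. (bd \<longrightarrow> (\<forall>j<n. \<bar>Y j\<bar> \<le> 1)) \<longrightarrow> (bd \<longrightarrow> (\<forall>i<m. \<bar>X i\<bar> \<le> 1))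
        \<and> (premise \<Psi> (join m X Y) \<longrightarrow> eval_qff eval_term \<Phi> (join m X Y))"
proof -
  have X'b: "bd \<Longrightarrow> i < m' \<Longrightarrow> \<bar>X' i\<bar> \<le> 1" for i using new[of "\<lambda>_. 0"] by auto
  define X where "X = (\<lambda>i. if \<exists>p. (p, Var i) \<in> set ns then X' (\<iota> 0 (some_leaf i)) else 0)"
  show ?thesis
  proof (intro exI allI impI conjI)
    fix Y :: "nat \<Rightarrow> real" assume Yb: "bd \<longrightarrow> (\<forall>j<n. \<bar>Y j\<bar> \<le> 1)"
    show "\<bar>X i\<bar> \<le> 1" if bd "i < m" for i
      using X'b[OF that(1) i0[OF pos[OF some_leaf]]] by (auto simp: X_def)
    assume pr: "premise \<Psi> (join m X Y)"
    define x where "x = join m X Y"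
    \<comment> \<open>Block 1 has a copy for every leaf, even of an existential variable. Such
      copies get the value 0, which is the same at all leaves and respects the bound.\<close>
    define x0 where "x0 = (\<lambda>i. if i < m then 0 else x i)"
    have x0b: "\<bar>x0 i\<bar> \<le> 1" if "(p, Var i) \<in> set ns" bd for p i
      using Yb that vars[OF that(1)] by (auto simp: x0_def x_def join_def)
    \<comment> \<open>\<open>X\<close> is already fixed, whereas the auxiliary universal variables
      are chosen anew for each \<open>h\<close>; this is what allows the limit in \<open>h\<close>
      at the end.\<close>
    have "relaxed x h \<Phi>" if h: "h > 0" for h
    proof -
      define g where "g b p = (if b = 1 then (case T p of Var i \<Rightarrow> x0 i | _ \<Rightarrow> 0)
        else if b = 2 then (eval_term (T p) x - radius x h (T p)) * den x h (T p)
        else if b = 3 then (eval_term (T p) x + radius x h (T p)) * den x h (T p)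
        else if b = 4 then den x h (T p)
        else if b = 5 then eval_term (T p) x0 / sqrt (1 + (eval_term (T p) x0)\<^sup>2)
        else 1 / sqrt (1 + (eval_term (T p) x0)\<^sup>2))" for b p :: nat
      let ?A = "{(b, p). 1 \<le> b \<and> b < 7 \<and> (\<exists>t. (p, t) \<in> set ns)}"
      let ?f = "\<lambda>(b, p). \<iota> b p - m'"
      have "inj_on ?f ?A"
      proof (rule inj_onI, clarify)
        fix b p c r t u
        assume a: "1 \<le> b" "b < 7" "1 \<le> c" "c < 7" "(p, t) \<in> set ns" "(r, u) \<in> set ns" "\<iota> b p - m' = \<iota> c r - m'"
        then have "\<iota> b p = \<iota> c r" using i1[of b p] i1[of c r] pos[of p t] pos[of r u] by auto
        then show "b = c \<and> p = r" using iinj[of b p c r] a pos by blast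
      qed
      from extend_inj[OF this, of "\<lambda>(b, p). g b p"] obtain Y' where
        Y'0: "\<forall>a\<in>?A. Y' (?f a) = (\<lambda>(b, p). g b p) a" and
        Y'2: "\<forall>y. y \<notin> ?f ` ?A \<longrightarrow> Y' y = 0" by blast
      have Y'1: "Y' (\<iota> b p - m') = g b p" if "1 \<le> b" "b < 7" "(p, t) \<in> set ns" for b p t
        using bspec[OF Y'0, of "(b, p)"] that by auto
      have gb: "\<bar>g b p\<bar> \<le> 1" if pt: "(p, t) \<in> set ns" and bd for b p t
      proof -
        have s: "1 \<le> sqrt (1 + v\<^sup>2)" "\<bar>v\<bar> \<le> sqrt (1 + v\<^sup>2)" for v :: real
          by (simp_all add: real_le_rsqrt)
        have "\<bar>v / sqrt (1 + v\<^sup>2)\<bar> \<le> 1" "\<bar>1 / sqrt (1 + v\<^sup>2)\<bar> \<le> 1" for v :: real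
          using s[of v] by (auto simp: abs_divide divide_le_eq_1 add_pos_nonneg)
        moreover have "\<bar>case T p of Var i \<Rightarrow> x0 i | _ \<Rightarrow> 0\<bar> \<le> 1"
          using T[OF pt] pt x0b \<open>bd\<close> by (auto split: tm_term.splits)
        moreover have "\<bar>den x h (T p)\<bar> \<le> 1" using den(1,2)[OF h, of x "T p"] by simp
        ultimately show ?thesis using den(3,4)[OF h, of "T p" x] unfolding g_def by simp
      qed
      have Y'b: "bd \<longrightarrow> (\<forall>j<n'. \<bar>Y' j\<bar> \<le> 1)"
      proof (intro impI allI)
        fix j assume bd
        show "\<bar>Y' j\<bar> \<le> 1"
        proof (cases "j \<in> ?f ` ?A")
          case True
          then obtain b p t where "1 \<le> b" "b < 7" "(p, t) \<in> set ns" "j = \<iota> b p - m'" by auto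
          then show ?thesis using Y'1[of b p t] gb[of p t b] \<open>bd\<close> by simp
        qed (simp add: Y'2)
      qed
      define \<rho> where "\<rho> = val X' Y'"
      have rb: "\<rho> b p = g b p" if "1 \<le> b" "b < 7" "(p, t) \<in> set ns" for b p t
        using Y'1[OF that] i1[OF that(1,2) pos[OF that(3)]] by (simp add: \<rho>_def val_def join_def)
      have r0: "\<rho> 0 p = X' (\<iota> 0 p)" if "(p, t) \<in> set ns" for p t
        using i0[OF pos[OF that]] by (simp add: \<rho>_def val_def join_def)
      have r1: "\<rho> 1 p = x0 i" if "(p, Var i) \<in> set ns" for p i
        using rb[OF _ _ that, of 1] T[OF that] by (simp add: g_def)
      have G: "guard \<Psi> q \<rho>"
      proof (cases \<Psi>)
        case (Some \<psi>)
        have nq: "set (qnodes q \<psi>) \<subseteq> set ns" using psi[OF Some] by simp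
        have E: "\<rho> 6 p = 1 / sqrt (1 + (eval_term t x0)\<^sup>2)"
          and Z: "\<rho> 5 p = eval_term t x0 / sqrt (1 + (eval_term t x0)\<^sup>2)" if "(p, t) \<in> set ns" for p t
          using rb[OF _ _ that] T[OF that] by (simp_all add: g_def)
        have 1: "\<forall>f\<in>set (concat (map e_node ns)). qe cv \<rho> f"
          by (rule exact_exists[of x0]) (use r1 E Z in auto)
        have 2: "\<forall>f\<in>set (links 1 (leaves ns)). qe cv \<rho> f"
          unfolding links_iff using r1 by auto
        have iv: "\<rho> 6 p > 0 \<and> \<rho> 5 p = eval_term t x0 * \<rho> 6 p" if "(p, t) \<in> set ns" for p t
          using E[OF that] Z[OF that] by (simp add: add_pos_nonneg)
        have "eval_qff eval_term \<psi> x" using pr Some by (simp add: premise_def x_def)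
        moreover have "eval_qff eval_term \<psi> x0 = eval_qff eval_term \<psi> x"
          by (rule eval_qff_cong) (use psi[OF Some] in \<open>auto simp: x0_def\<close>)
        ultimately have "qe cv \<rho> (skel e_atom q \<psi>)" using exact_skel[of \<rho> x0, OF iv nq] by blast
        then show ?thesis using 1 2 Some unfolding guard_def Psi'_def by (simp add: qe_foldr_And)
      qed (simp add: guard_def)
      have P: "qe cv \<rho> (Phi' M ns p \<Phi>)" using new[OF Y'b] G by (simp add: \<rho>_def)
      then have "\<forall>f\<in>set (links 0 (leaves ns)). qe cv \<rho> f" unfolding Phi'_def qe_foldr_And by blast
      then have lk: "\<rho> 0 p = \<rho> 0 r" if "(p, Var i) \<in> set ns" "(r, Var i) \<in> set ns" for i p r
        unfolding links_iff using that by blast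
      have x: "\<rho> (if i < m then 0 else 1) p = x i" if "(p, Var i) \<in> set ns" for p i
      proof (cases "i < m")
        case True
        have "x i = \<rho> 0 (some_leaf i)" using True that r0[OF some_leaf[OF that]] by (auto simp: x_def join_def X_def)
        then show ?thesis using lk[OF that some_leaf[OF that]] True by simp
      next
        case False
        then show ?thesis using r1[OF that] by (simp add: x0_def)
      qed
      have DLU: "\<rho> 4 p = den x h t" "\<rho> 2 p = (eval_term t x - radius x h t) * den x h t"
        "\<rho> 3 p = (eval_term t x + radius x h t) * den x h t" if "(p, t) \<in> set ns" for p t
        using rb[OF _ _ that] T[OF that] by (simp_all add: g_def)
      have "\<forall>f\<in>set (concat (map (f_node M (leaves ns)) ns)). \<not> qe cv \<rho> f"
        by (rule complete[of h _ x, OF h x DLU])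
      then have "qe cv \<rho> (skel f_atom p \<Phi>)" using P unfolding Phi'_def qe_foldr_And qe_foldr_Or by blast
      then show ?thesis using complete_skel[of h \<rho> x, OF h DLU nodes] by blast
    qed
    then show "eval_qff eval_term \<Phi> (join m X Y)" using relaxed_imp[of x \<Phi>] by (simp add: x_def)
  qed
qed

end

section \<open>From abstract monomials to polynomials\<close>

definition expo :: "(nat \<Rightarrow> nat \<Rightarrow> nat) \<Rightarrow> nat \<Rightarrow> (nat \<times> nat) list \<Rightarrow> nat list" where
  "expo \<iota> l fs = map (\<lambda>i. length (filter (\<lambda>(b, k). \<iota> b k = i) fs)) [0..<l]"

definition tr_std :: "(nat \<Rightarrow> nat \<Rightarrow> nat) \<Rightarrow> nat \<Rightarrow> (coef \<Rightarrow> int) \<Rightarrow> apoly \<Rightarrow> std_poly" where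
  "tr_std \<iota> l cv P = map (\<lambda>(c, fs). (expo \<iota> l fs, cv c)) P"

definition tr_mono :: "(nat \<Rightarrow> nat \<Rightarrow> nat) \<Rightarrow> (coef \<Rightarrow> int) \<Rightarrow> mono \<Rightarrow> tm_term" where
  "tr_mono \<iota> cv m = foldr (\<lambda>(b, k). Mul (Var (\<iota> b k))) (snd m) (Const (cv (fst m)))"

definition tr_term :: "(nat \<Rightarrow> nat \<Rightarrow> nat) \<Rightarrow> (coef \<Rightarrow> int) \<Rightarrow> apoly \<Rightarrow> tm_term" where
  "tr_term \<iota> cv P = foldr (\<lambda>m. Add (tr_mono \<iota> cv m)) P (Const 0)"

lemma prod_expo:
  fixes x :: "nat \<Rightarrow> real"
  assumes "\<forall>(b, k) \<in> set fs. \<iota> b k < l"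
  shows "(\<Prod>i<length (expo \<iota> l fs). x i ^ (expo \<iota> l fs ! i)) = (\<Prod>(b, k) \<leftarrow> fs. x (\<iota> b k))"
proof -
  have "(\<Prod>i<l. x i ^ length (filter (\<lambda>(b, k). \<iota> b k = i) fs)) = (\<Prod>(b, k) \<leftarrow> fs. x (\<iota> b k))"
    using assms
  proof (induction fs)
    case (Cons f fs)
    obtain b k where f: "f = (b, k)" by fastforce
    \<comment> \<open>Prepending a factor raises a single exponent by one, expressed here by an
      additional factor that is 1 at all other indices.\<close>
    have "(\<Prod>i<l. x i ^ length (filter (\<lambda>(b, k). \<iota> b k = i) (f # fs)))
      = (\<Prod>i<l. (if i = \<iota> b k then x i else 1) * x i ^ length (filter (\<lambda>(b, k). \<iota> b k = i) fs))"
      by (intro prod.cong) (auto simp: f)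
    also have "\<dots> = x (\<iota> b k) * (\<Prod>i<l. x i ^ length (filter (\<lambda>(b, k). \<iota> b k = i) fs))"
      using Cons.prems by (simp add: prod.distrib f)
    finally show ?case using Cons f by simp
  qed simp
  then show ?thesis by (simp add: expo_def)
qed

definition good_mono :: "nat \<Rightarrow> nat \<Rightarrow> mono \<Rightarrow> bool" where
  "good_mono N d m \<longleftrightarrow> length (snd m) \<le> d \<and> (\<forall>(b, k) \<in> set (snd m). b < 7 \<and> k < N)"

definition good :: "nat \<Rightarrow> apoly qff \<Rightarrow> bool" where
  "good N \<phi> \<longleftrightarrow> (\<forall>P \<in> polys_qff \<phi>. \<forall>m \<in> set P. good_mono N 4 m)"

lemma eval_tr_std:
  assumes "\<forall>m \<in> set P. \<forall>(b, k) \<in> set (snd m). \<iota> b k < l"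
  shows "eval_std (tr_std \<iota> l cv P) x = aeval cv (\<lambda>b k. x (\<iota> b k)) P"
  using assms
proof (induction P)
  case (Cons m P)
  then show ?case using prod_expo[of "snd m" \<iota> l x]
    by (auto simp: eval_std_def aeval_def meval_def tr_std_def case_prod_unfold)
qed (simp add: eval_std_def aeval_def tr_std_def)

lemma eval_tr_term: "eval_term (tr_term \<iota> cv P) x = aeval cv (\<lambda>b k. x (\<iota> b k)) P"
proof (induction P)
  case (Cons m P)
  have "eval_term (foldr (\<lambda>(b, k). Mul (Var (\<iota> b k))) fs (Const c)) x = of_int c * (\<Prod>(b, k) \<leftarrow> fs. x (\<iota> b k))" for fs c
    by (induction fs) auto
  then show ?case using Cons by (simp add: tr_term_def aeval_def tr_mono_def meval_def)
qed (simp add: aeval_def tr_term_def)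

lemma sum_expo: "sum_list (expo \<iota> l fs) \<le> length fs"
proof (induction fs)
  case (Cons f fs)
  obtain b k where f: "f = (b, k)" by fastforce
  have "sum_list (expo \<iota> l (f # fs)) = (\<Sum>i<l. (if i = \<iota> b k then 1 else 0) + length (filter (\<lambda>(b, k). \<iota> b k = i) fs))"
    by (auto simp: expo_def f interv_sum_list_conv_sum_set_nat atLeast0LessThan intro!: sum.cong)
  also have "\<dots> \<le> 1 + sum_list (expo \<iota> l fs)"
    by (auto simp: sum.distrib expo_def interv_sum_list_conv_sum_set_nat atLeast0LessThan)
  finally show ?case using Cons by simp
qed (simp add: expo_def)

lemma std_deg_tr_std: "\<forall>m \<in> set P. length (snd m) \<le> d \<Longrightarrow> std_deg_le (tr_std \<iota> l cv P) d"
  by (auto simp: std_deg_le_def tr_std_def intro!: order_trans[OF sum_expo])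

lemma term_deg_tr_term: 
  assumes "\<forall>m \<in> set P. length (snd m) \<le> d" "\<forall>m \<in> set P. \<forall>(b, k) \<in> set (snd m). \<iota> b k < l"
  shows "term_deg_le (tr_term \<iota> cv P) d"
  unfolding term_deg_le_def using std_deg_tr_std[OF assms(1)] eval_tr_std[OF assms(2)] eval_tr_term by metis

lemma vars_tr_std: "vars_std (tr_std \<iota> l cv P) \<subseteq> (\<Union>m \<in> set P. (\<lambda>(b, k). \<iota> b k) ` set (snd m))"
proof
  fix i assume "i \<in> vars_std (tr_std \<iota> l cv P)"
  then obtain c fs where m: "(c, fs) \<in> set P" "i < length (expo \<iota> l fs)" "expo \<iota> l fs ! i > 0"
    by (auto simp: vars_std_def tr_std_def)
  then have "filter (\<lambda>(b, k). \<iota> b k = i) fs \<noteq> []" by (auto simp: expo_def)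
  then obtain b k where "(b, k) \<in> set fs" "\<iota> b k = i" by (auto simp: filter_empty_conv)
  then show "i \<in> (\<Union>m \<in> set P. (\<lambda>(b, k). \<iota> b k) ` set (snd m))" using m(1) by force
qed

lemma vars_tr_term: "vars_term (tr_term \<iota> cv P) \<subseteq> (\<Union>m \<in> set P. (\<lambda>(b, k). \<iota> b k) ` set (snd m))"
proof (induction P)
  case (Cons m P)
  have "vars_term (foldr (\<lambda>(b, k). Mul (Var (\<iota> b k))) fs (Const c)) \<subseteq> (\<lambda>(b, k). \<iota> b k) ` set fs" for fs c
    by (induction fs) auto
  then show ?case using Cons by (auto simp: tr_term_def tr_mono_def)
qed (simp add: tr_term_def)

lemma polys_map_qff: "polys_qff (map_qff f \<phi>) = f ` polys_qff \<phi>"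
  by (induction \<phi>) auto

lemma polys_foldr:
  "polys_qff (foldr And fs \<phi>) = (\<Union>f\<in>set fs. polys_qff f) \<union> polys_qff \<phi>"
  "polys_qff (foldr Or fs \<phi>) = (\<Union>f\<in>set fs. polys_qff f) \<union> polys_qff \<phi>"
  by (induction fs) auto

lemma good_Or: "good N (foldr Or fs \<phi>) \<longleftrightarrow> (\<forall>f\<in>set fs. good N f) \<and> good N \<phi>"
  and good_And: "good N (foldr And fs \<phi>) \<longleftrightarrow> (\<forall>f\<in>set fs. good N f) \<and> good N \<phi>"
  by (auto simp: good_def polys_foldr)

context parsed
begin

lemma good_formulas:
  assumes pos: "\<And>p t. (p, t) \<in> set ns \<Longrightarrow> p < N"
  shows "\<And>b f. b \<le> 1 \<Longrightarrow> f \<in> set (links b (leaves ns)) \<Longrightarrow> good N f"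
    and "\<And>f. f \<in> set (concat (map (f_node M (leaves ns)) ns)) \<Longrightarrow> good N f"
    and "\<And>f. f \<in> set (concat (map e_node ns)) \<Longrightarrow> good N f"
    and "\<And>p \<Phi>. set (qnodes p \<Phi>) \<subseteq> set ns \<Longrightarrow> good N (skel f_atom p \<Phi>) \<and> good N (skel e_atom p \<Phi>)"
proof -
  have lf: "p < N" if "p \<in> set (leaves ns)" for p using that leaves_iff pos by blast
  show "good N f" if "b \<le> 1" "f \<in> set (links b (leaves ns))" for b f
    using that lf by (auto simp: links_def good_def f_link_def mon_def good_mono_def)
  have "good N f" if "(p, t) \<in> set ns" "f \<in> set (f_node M (leaves ns) (p, t))" for f p t
  proof (cases t)
    case (Var i)
    then show ?thesis using that lf pos[OF that(1)]
      by (auto simp: good_def good_mono_def f_defs)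
  next
    case (Const c)
    then show ?thesis using that pos[OF that(1)] by (auto simp: good_def good_mono_def f_defs)
  next
    case (Add a b)
    then have s: "(p + 4, a) \<in> set ns" "(second p a, b) \<in> set ns" using sub(1) that by auto
    show ?thesis using that Add pos[OF that(1)] pos[OF s(1)] pos[OF s(2)]
      by (auto simp: good_def good_mono_def f_defs)
  next
    case (Mul a b)
    then have s: "(p + 4, a) \<in> set ns" "(second p a, b) \<in> set ns" using sub(2) that by auto
    show ?thesis using that Mul pos[OF that(1)] pos[OF s(1)] pos[OF s(2)]
      by (auto simp: good_def good_mono_def f_defs)
  qed
  then show "good N f" if "f \<in> set (concat (map (f_node M (leaves ns)) ns))" for f using that by auto
  have "good N f" if "(p, t) \<in> set ns" "f \<in> set (e_node (p, t))" for f p t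
  proof (cases t)
    case (Var i)
    then show ?thesis using that lf pos[OF that(1)]
      by (auto simp: good_def good_mono_def f_defs)
  next
    case (Const c)
    then show ?thesis using that pos[OF that(1)] by (auto simp: good_def good_mono_def f_defs)
  next
    case (Add a b)
    then have s: "(p + 4, a) \<in> set ns" "(second p a, b) \<in> set ns" using sub(1) that by auto
    show ?thesis using that Add pos[OF that(1)] pos[OF s(1)] pos[OF s(2)]
      by (auto simp: good_def good_mono_def f_defs)
  next
    case (Mul a b)
    then have s: "(p + 4, a) \<in> set ns" "(second p a, b) \<in> set ns" using sub(2) that by auto
    show ?thesis using that Mul pos[OF that(1)] pos[OF s(1)] pos[OF s(2)]
      by (auto simp: good_def good_mono_def f_defs)
  qed
  then show "good N f" if "f \<in> set (concat (map e_node ns))" for f using that by auto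
  have self: "(q, u) \<in> set (nodes q u)" for q u by (cases u) auto
  show "good N (skel f_atom p \<Phi>) \<and> good N (skel e_atom p \<Phi>)" if "set (qnodes p \<Phi>) \<subseteq> set ns" for p \<Phi>
    using that
  proof (induction \<Phi> arbitrary: p)
    case (Le s t)
    have "(p + 4, s) \<in> set ns" "(second p s, t) \<in> set ns" using Le self by (auto simp del: nodes.simps)
    then show ?case using pos by (auto simp: good_def good_mono_def f_defs)
  qed (auto simp: good_def)
qed

lemma good_Phi': "(\<And>p t. (p, t) \<in> set ns \<Longrightarrow> p < N) \<Longrightarrow> set (qnodes p \<Phi>) \<subseteq> set ns \<Longrightarrow> good N (Phi' M ns p \<Phi>)"
  unfolding Phi'_def good_And good_Or using good_formulas[of N] by blast

lemma good_Psi': "(\<And>p t. (p, t) \<in> set ns \<Longrightarrow> p < N) \<Longrightarrow> set (qnodes p \<Phi>) \<subseteq> set ns \<Longrightarrow> good N (Psi' ns p \<Phi>)"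
  unfolding Psi'_def good_And good_Or using good_formulas[of N] by blast

text \<open>Ensures that the new premise is free of existential variables, as membership in the
  third class demands.\<close>

lemma no_block0: 
  assumes "P \<in> polys_qff (Psi' ns p \<Psi>)" "mo \<in> set P" "(b, k) \<in> set (snd mo)"
  shows "1 \<le> b"
proof -
  let ?ok = "\<lambda>\<phi>. \<forall>P \<in> polys_qff \<phi>. \<forall>m \<in> set P. \<forall>(b, k) \<in> set (snd m). 1 \<le> b"
  have "?ok f" if "f \<in> set (links 1 (leaves ns))" for f
    using that by (auto simp: links_def f_defs)
  moreover have "?ok f" if "f \<in> set (e_node z)" for f z
    using that by (cases z rule: e_node.cases) (auto simp: f_defs)
  moreover have "?ok (skel e_atom p \<Psi>)" for p
  proof (induction \<Psi> arbitrary: p)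
    case (Le u v)
    then show ?case by (simp add: f_defs)
  qed (unfold skel.simps polys_qff.simps ball_Un, blast+)
  moreover have "P \<in> polys_qff (skel e_atom p \<Psi>) \<or> (\<exists>f \<in> set (links 1 (leaves ns)). P \<in> polys_qff f)
     \<or> (\<exists>z f. f \<in> set (e_node z) \<and> P \<in> polys_qff f)"
    using assms(1) unfolding Psi'_def polys_foldr by auto
  ultimately show ?thesis using assms(2,3) by blast
qed

end

section \<open>Positions of the subterms\<close>

lemma nodes_range: "(q, u) \<in> set (nodes p t) \<Longrightarrow> p \<le> q \<and> q + 4 \<le> p + 4 * length (enc_term t)"
proof (induction t arbitrary: p)
  case (Add a b)
  show ?case using Add.prems Add.IH(1)[of "p + 4"] Add.IH(2)[of "second p a"] by (auto simp: second_def)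
next
  case (Mul a b)
  show ?case using Mul.prems Mul.IH(1)[of "p + 4"] Mul.IH(2)[of "second p a"] by (auto simp: second_def)
qed auto

lemma nodes_self: "(p, t) \<in> set (nodes p t)"
  by (cases t) auto

lemma distinct_map_fst_append:
  assumes "distinct (map fst xs)" "distinct (map fst ys)"
    and "\<And>q u. (q, u) \<in> set xs \<Longrightarrow> q < b" "\<And>q u. (q, u) \<in> set ys \<Longrightarrow> b \<le> (q :: nat)"
  shows "distinct (map fst (xs @ ys))"
  using assms by (fastforce simp: not_le)

text \<open>The children occupy disjoint stretches of the input behind their root, so a position can
  serve as the name of a subterm.\<close>

lemma distinct_nodes: "distinct (map fst (nodes p t))"
proof (induction t arbitrary: p)
  case (Add a b)
  have "distinct (map fst (nodes (p + 4) a @ nodes (second p a) b))"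
    by (rule distinct_map_fst_append[OF Add, where b = "second p a"])
      (use nodes_range in \<open>fastforce simp: second_def\<close>)+
  then show ?case using nodes_range[of p _ "p + 4" a] nodes_range[of p _ "second p a" b]
    by (fastforce simp: second_def)
next
  case (Mul a b)
  have "distinct (map fst (nodes (p + 4) a @ nodes (second p a) b))"
    by (rule distinct_map_fst_append[OF Mul, where b = "second p a"])
      (use nodes_range in \<open>fastforce simp: second_def\<close>)+
  then show ?case using nodes_range[of p _ "p + 4" a] nodes_range[of p _ "second p a" b]
    by (fastforce simp: second_def)
qed auto

lemma nodes_sub:
  "(q, Add a b) \<in> set (nodes p t) \<Longrightarrow> (q + 4, a) \<in> set (nodes p t) \<and> (second q a, b) \<in> set (nodes p t)"
  "(q, Mul a b) \<in> set (nodes p t) \<Longrightarrow> (q + 4, a) \<in> set (nodes p t) \<and> (second q a, b) \<in> set (nodes p t)"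
proof (induction t arbitrary: p)
  case (Add c d)
  { case 1 then show ?case using Add.IH(1)[of "p + 4"] Add.IH(3)[of "second p c"] nodes_self by auto }
  { case 2 then show ?case using Add.IH(2)[of "p + 4"] Add.IH(4)[of "second p c"] by auto }
next
  case (Mul c d)
  { case 1 then show ?case using Mul.IH(1)[of "p + 4"] Mul.IH(3)[of "second p c"] by auto }
  { case 2 then show ?case using Mul.IH(2)[of "p + 4"] Mul.IH(4)[of "second p c"] nodes_self by auto }
qed auto

text \<open>The lower bound is strict because a formula opens with a connective or a comparison, and
  these are not nodes.\<close>

lemma qnodes_range: "(q, u) \<in> set (qnodes p \<Phi>) \<Longrightarrow> p < q \<and> q + 4 \<le> p + 4 * length (enc_qff enc_term \<Phi>)"
proof (induction \<Phi> arbitrary: p)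
  case (Le s t)
  then show ?case using nodes_range[of q u "p + 4" s] nodes_range[of q u "second p s" t]
    by (auto simp: second_def)
next
  case (And a b)
  show ?case using And.prems And.IH(1)[of "p + 4"] And.IH(2)[of "second_qff p a"] by (auto simp: second_qff_def)
next
  case (Or a b)
  show ?case using Or.prems Or.IH(1)[of "p + 4"] Or.IH(2)[of "second_qff p a"] by (auto simp: second_qff_def)
qed

lemma distinct_qnodes: "distinct (map fst (qnodes p \<Phi>))"
proof (induction \<Phi> arbitrary: p)
  case (Le s t)
  show ?case unfolding qnodes.simps
    by (rule distinct_map_fst_append[OF distinct_nodes distinct_nodes, where b = "second p s"])
      (use nodes_range in \<open>fastforce simp: second_def\<close>)+
next
  case (And a b)
  show ?case unfolding qnodes.simps
    by (rule distinct_map_fst_append[OF And, where b = "second_qff p a"])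
      (use qnodes_range in \<open>fastforce simp: second_qff_def\<close>)+
next
  case (Or a b)
  show ?case unfolding qnodes.simps
    by (rule distinct_map_fst_append[OF Or, where b = "second_qff p a"])
      (use qnodes_range in \<open>fastforce simp: second_qff_def\<close>)+
qed

lemma qnodes_sub:
  "(q, Add a b) \<in> set (qnodes p \<Phi>) \<Longrightarrow> (q + 4, a) \<in> set (qnodes p \<Phi>) \<and> (second q a, b) \<in> set (qnodes p \<Phi>)"
  "(q, Mul a b) \<in> set (qnodes p \<Phi>) \<Longrightarrow> (q + 4, a) \<in> set (qnodes p \<Phi>) \<and> (second q a, b) \<in> set (qnodes p \<Phi>)"
  by (induction \<Phi> arbitrary: p) (use nodes_sub in auto)

lemma nodes_Var: "(q, Var i) \<in> set (nodes p t) \<Longrightarrow> i \<in> vars_term t"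
  by (induction t arbitrary: p) auto

lemma qnodes_Var: "(q, Var i) \<in> set (qnodes p \<Phi>) \<Longrightarrow> i \<in> vars_qff vars_term \<Phi>"
  by (induction \<Phi> arbitrary: p) (auto simp: vars_qff_simps dest: nodes_Var)

definition cval :: "(nat \<times> tm_term) list \<Rightarrow> nat \<Rightarrow> nat \<Rightarrow> coef \<Rightarrow> int" where
  "cval ns M m c = (case c of One \<Rightarrow> 1
     | DigV p \<Rightarrow> if p = M then int m else (case map_of ns p of Some (Var i) \<Rightarrow> int i | _ \<Rightarrow> 0)
     | Dig p \<Rightarrow> (case map_of ns p of Some (Const k) \<Rightarrow> k | _ \<Rightarrow> 0))"

lemma parsed_cval:
  assumes "distinct (map fst ns)" "\<And>p t. (p, t) \<in> set ns \<Longrightarrow> p \<noteq> M"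
    and "\<And>p a b. (p, Add a b) \<in> set ns \<Longrightarrow> (p + 4, a) \<in> set ns \<and> (second p a, b) \<in> set ns"
      "\<And>p a b. (p, Mul a b) \<in> set ns \<Longrightarrow> (p + 4, a) \<in> set ns \<and> (second p a, b) \<in> set ns"
  shows "parsed ns (cval ns M m) M m"
proof
  have mo: "map_of ns p = Some t" if "(p, t) \<in> set ns" for p t using assms(1) that by simp
  show "t = t'" if "(p, t) \<in> set ns" "(p, t') \<in> set ns" for p t t'
    using mo[OF that(1)] mo[OF that(2)] by simp
  show "cval ns M m (DigV p) = int i" if "(p, Var i) \<in> set ns" for p i
    using mo[OF that] assms(2)[OF that] by (simp add: cval_def)
  show "cval ns M m (Dig p) = c" if "(p, Const c) \<in> set ns" for p c
    using mo[OF that] by (simp add: cval_def)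
qed (use assms in \<open>auto simp: cval_def\<close>)

context numbered
begin

lemma transl:
  assumes "good N \<phi>" "\<And>P. \<forall>m \<in> set P. good_mono N 4 m \<Longrightarrow> ev (tr P) x = aeval cv (\<lambda>b k. x (\<iota> b k)) P"
  shows "eval_qff ev (map_qff tr \<phi>) x = qe cv (\<lambda>b k. x (\<iota> b k)) \<phi>"
  using assms(1) by (induction \<phi>) (auto simp: good_def assms(2))

lemma good_vars:
  assumes "good_mono N 4 mo" "(b, k) \<in> set (snd mo)"
  shows "\<iota> b k < m' + n'" "1 \<le> b \<Longrightarrow> m' \<le> \<iota> b k"
proof -
  have "b < 7" "k < N" using assms by (auto simp: good_mono_def)
  then show "\<iota> b k < m' + n'" "1 \<le> b \<Longrightarrow> m' \<le> \<iota> b k"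
    using i0[of k] i1[of b k] by (cases "b = 0"; force)+
qed

lemma old_iff_new:
  assumes "set (qnodes p \<Phi>) \<subseteq> set ns"
    and "\<And>\<psi>. \<Psi> = Some \<psi> \<Longrightarrow> set (qnodes q \<psi>) \<subseteq> set ns \<and> vars_qff vars_term \<psi> \<subseteq> {m..}"
  shows "(\<exists>X'. \<forall>Y'. (bd \<longrightarrow> (\<forall>j<n'. \<bar>Y' j\<bar> \<le> 1)) \<longrightarrow> (bd \<longrightarrow> (\<forall>i<m'. \<bar>X' i\<bar> \<le> 1))
        \<and> (guard \<Psi> q (val X' Y') \<longrightarrow> qe cv (val X' Y') (Phi' M ns p \<Phi>)))
    \<longleftrightarrow> (\<exists>X. \<forall>Y. (bd \<longrightarrow> (\<forall>j<n. \<bar>Y j\<bar> \<le> 1)) \<longrightarrow> (bd \<longrightarrow> (\<forall>i<m. \<bar>X i\<bar> \<le> 1))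
        \<and> (premise \<Psi> (join m X Y) \<longrightarrow> eval_qff eval_term \<Phi> (join m X Y)))"
  (is "(\<exists>X'. ?new X') \<longleftrightarrow> (\<exists>X. ?old X)")
proof
  assume "\<exists>X'. ?new X'"
  then obtain X' where "?new X'" ..
  then show "\<exists>X. ?old X" by (intro new_to_old[OF assms, where X' = X']) auto
next
  assume "\<exists>X. ?old X"
  then obtain X where "?old X" ..
  then show "\<exists>X'. ?new X'" by (intro old_to_new[OF assms, where X = X]) auto
qed

end

fun split_sentence :: "'p sentence \<Rightarrow> nat \<times> nat \<times> 'p qff option \<times> 'p qff" where
  "split_sentence (S2 m n \<Phi>) = (m, n, None, \<Phi>)"
| "split_sentence (BS2 m n \<Phi>) = (m, n, None, \<Phi>)"
| "split_sentence (BS2pp m n \<Psi> \<Phi>) = (m, n, Some \<Psi>, \<Phi>)"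

fun class_of :: "'p sentence \<Rightarrow> sclass" where
  "class_of (S2 m n \<Phi>) = Sigma2"
| "class_of (BS2 m n \<Phi>) = BSigma2"
| "class_of (BS2pp m n \<Psi> \<Phi>) = BSigma2pp"

text \<open>A token is stored in the last of its four cells, hence the final 3.\<close>

definition start :: "tm_term sentence \<Rightarrow> nat" where
  "start s = (case split_sentence s of (m, n, _) \<Rightarrow> 4 * (1 + length (enc_nat m) + length (enc_nat n)) + 3)"

definition middle :: "tm_term sentence \<Rightarrow> nat" where
  "middle s = start s + (case split_sentence s of (_, _, None, _) \<Rightarrow> 0 | (_, _, Some \<psi>, _) \<Rightarrow> 4 * length (enc_qff enc_term \<psi>))"

definition snodes :: "tm_term sentence \<Rightarrow> (nat \<times> tm_term) list" where
  "snodes s = (case split_sentence s of (_, _, None, \<Phi>) \<Rightarrow> qnodes (start s) \<Phi>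
     | (_, _, Some \<psi>, \<Phi>) \<Rightarrow> qnodes (start s) \<psi> @ qnodes (middle s) \<Phi>)"

text \<open>The digits of m follow the class token, which sits at tape position 3.\<close>

fun transf :: "(apoly \<Rightarrow> 'p) \<Rightarrow> nat \<Rightarrow> nat \<Rightarrow> tm_term sentence \<Rightarrow> 'p sentence" where
  "transf tr m' n' (S2 m n \<Phi>) = (let s = S2 m n \<Phi> in S2 m' n' (map_qff tr (Phi' 3 (snodes s) (middle s) \<Phi>)))"
| "transf tr m' n' (BS2 m n \<Phi>) = (let s = BS2 m n \<Phi> in BS2 m' n' (map_qff tr (Phi' 3 (snodes s) (middle s) \<Phi>)))"
| "transf tr m' n' (BS2pp m n \<Psi> \<Phi>) = (let s = BS2pp m n \<Psi> \<Phi> in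
     BS2pp m' n' (map_qff tr (Psi' (snodes s) (start s) \<Psi>)) (map_qff tr (Phi' 3 (snodes s) (middle s) \<Phi>)))"

definition scval :: "tm_term sentence \<Rightarrow> coef \<Rightarrow> int" where
  "scval s = cval (snodes s) 3 (fst (split_sentence s))"

lemma in_class_class_of: "in_class vs C s \<Longrightarrow> class_of s = C"
  by (cases s; cases C) auto

lemma numbered_sentence:
  assumes C: "in_class vars_term C s"
    and i0: "\<And>k. k < N \<Longrightarrow> \<iota> 0 k < m'"
    and i1: "\<And>b k. 1 \<le> b \<Longrightarrow> b < 7 \<Longrightarrow> k < N \<Longrightarrow> m' \<le> \<iota> b k \<and> \<iota> b k < m' + n'"
    and iinj: "\<And>b k c l. b < 7 \<Longrightarrow> k < N \<Longrightarrow> c < 7 \<Longrightarrow> l < N \<Longrightarrow> \<iota> b k = \<iota> c l \<Longrightarrow> b = c \<and> k = l"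
    and N: "4 * length (enc_sentence enc_term s) \<le> N"
  shows "numbered (snodes s) (scval s) 3 (fst (split_sentence s)) \<iota> m' n' N (fst (snd (split_sentence s)))"
proof -
  obtain m n \<Psi> \<Phi> where s: "split_sentence s = (m, n, \<Psi>, \<Phi>)" by (metis prod_cases4)
  \<comment> \<open>Nodes lie strictly behind \<open>start s\<close>, so none of them has position
    3, which stands for the digits of m.\<close>
  have st: "start s \<ge> 3" by (simp add: start_def s)
  have len: "middle s + 4 * length (enc_qff enc_term \<Phi>) = 4 * length (enc_sentence enc_term s) + 3"
    using s by (cases s) (auto simp: middle_def start_def)
  have sn: "snodes s = (case \<Psi> of None \<Rightarrow> [] | Some \<psi> \<Rightarrow> qnodes (start s) \<psi>) @ qnodes (middle s) \<Phi>"
    using s by (simp add: snodes_def middle_def split: option.splits)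
  have mid: "middle s = start s + (case \<Psi> of None \<Rightarrow> 0 | Some \<psi> \<Rightarrow> 4 * length (enc_qff enc_term \<psi>))"
    using s by (simp add: middle_def split: option.splits)
  have r: "start s < q \<and> q + 4 \<le> middle s + 4 * length (enc_qff enc_term \<Phi>)" if "(q, t) \<in> set (snodes s)" for q t
    using that qnodes_range[of q t "middle s" \<Phi>] qnodes_range[of q t "start s" "the \<Psi>"] mid
    by (cases \<Psi>) (auto simp: sn)
  have d: "distinct (map fst (snodes s))"
  proof (cases \<Psi>)
    case None
    then show ?thesis by (simp add: sn distinct_qnodes)
  next
    case (Some \<psi>)
    then show ?thesis using distinct_qnodes qnodes_range[of _ _ "middle s" \<Phi>] qnodes_range[of _ _ "start s" \<psi>] mid
      by (fastforce simp: sn)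
  qed
  have p: "parsed (snodes s) (scval s) 3 m"
    unfolding scval_def s fst_conv
    by (rule parsed_cval[OF d]) (use r st qnodes_sub in \<open>fastforce simp: sn split: option.splits\<close>)+
  have v: "i < m + n" if "(q, Var i) \<in> set (snodes s)" for q i
  proof -
    have "i \<in> vars_qff vars_term \<Phi> \<or> (\<exists>\<psi>. \<Psi> = Some \<psi> \<and> i \<in> vars_qff vars_term \<psi>)"
      using that by (cases \<Psi>) (auto simp: sn dest: qnodes_Var)
    then show ?thesis using C s by (cases s; cases C) auto
  qed
  show ?thesis
    unfolding s fst_conv snd_conv numbered_def numbered_axioms_def
  proof (intro conjI allI impI p)
    fix q t assume "(q, t) \<in> set (snodes s)"
    then show "q < N" using r[of q t] len N by simp
  qed (use i0 i1 iinj v in blast)+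
qed

text \<open>Stated for an arbitrary translation \<open>tr\<close> of polynomials with its own
  evaluation, variables and degree condition \<open>D\<close>, so that it covers both output
  formats.\<close>

theorem transf_correct:
  assumes C: "in_class vars_term C s"
    and num: "numbered (snodes s) (scval s) 3 (fst (split_sentence s)) \<iota> m' n' N (fst (snd (split_sentence s)))"
    and ev: "\<And>P x. \<forall>m \<in> set P. good_mono N 4 m \<Longrightarrow> ev (tr P) x = aeval (scval s) (\<lambda>b k. x (\<iota> b k)) P"
    and vs: "\<And>P. vs (tr P) \<subseteq> (\<Union>m \<in> set P. (\<lambda>(b, k). \<iota> b k) ` set (snd m))"
    and dg: "\<And>P. \<forall>m \<in> set P. good_mono N 4 m \<Longrightarrow> D (tr P)"
  shows "in_class vs C (transf tr m' n' s) \<and> (\<forall>P \<in> sentence_polys (transf tr m' n' s). D P)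
    \<and> (holds ev (transf tr m' n' s) \<longleftrightarrow> holds eval_term s)"
proof -
  obtain m n \<Psi> \<Phi> where s: "split_sentence s = (m, n, \<Psi>, \<Phi>)" by (metis prod_cases4)
  let ?ns = "snodes s" and ?\<Phi>' = "Phi' 3 (snodes s) (middle s) \<Phi>"
  interpret numbered ?ns "scval s" 3 m \<iota> m' n' N n using num by (simp add: s)
  have sn: "?ns = (case \<Psi> of None \<Rightarrow> [] | Some \<psi> \<Rightarrow> qnodes (start s) \<psi>) @ qnodes (middle s) \<Phi>"
    using s by (simp add: snodes_def middle_def split: option.splits)
  have n1: "set (qnodes (middle s) \<Phi>) \<subseteq> set ?ns" by (auto simp: sn)
  have n2: "set (qnodes (start s) \<psi>) \<subseteq> set ?ns" if "\<Psi> = Some \<psi>" for \<psi> using that by (auto simp: sn)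
  have n3: "vars_qff vars_term \<psi> \<subseteq> {m..}" if "\<Psi> = Some \<psi>" for \<psi>
    using that C s by (cases s; cases C) auto
  have g1: "good N ?\<Phi>'" by (rule good_Phi'[OF _ n1]) (rule pos)
  have g2: "good N (Psi' ?ns (start s) \<psi>)" if "\<Psi> = Some \<psi>" for \<psi>
    by (rule good_Psi'[OF _ n2[OF that]]) (rule pos)
  have v: "vars_qff vs (map_qff tr \<phi>) \<subseteq> {..<m' + n'}" if "good N \<phi>" for \<phi>
  proof
    fix i assume "i \<in> vars_qff vs (map_qff tr \<phi>)"
    then obtain P where P: "P \<in> polys_qff \<phi>" "i \<in> vs (tr P)" by (auto simp: vars_qff_def polys_map_qff)
    then obtain mo b k where "mo \<in> set P" "(b, k) \<in> set (snd mo)" "i = \<iota> b k" using vs[of P] by fastforce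
    then show "i \<in> {..<m' + n'}" using good_vars(1)[of mo b k] that P(1) by (auto simp: good_def)
  qed
  have v2: "vars_qff vs (map_qff tr (Psi' ?ns (start s) \<psi>)) \<subseteq> {m'..<m' + n'}" if "\<Psi> = Some \<psi>" for \<psi>
  proof
    fix i assume "i \<in> vars_qff vs (map_qff tr (Psi' ?ns (start s) \<psi>))"
    then obtain P where P: "P \<in> polys_qff (Psi' ?ns (start s) \<psi>)" "i \<in> vs (tr P)"
      by (auto simp: vars_qff_def polys_map_qff)
    then obtain mo b k where mo: "mo \<in> set P" "(b, k) \<in> set (snd mo)" "i = \<iota> b k" using vs[of P] by fastforce
    moreover have "good_mono N 4 mo" using g2[OF that] P(1) mo by (auto simp: good_def)
    ultimately show "i \<in> {m'..<m' + n'}"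
      using good_vars[of mo b k] no_block0[OF P(1) mo(1,2)] by auto
  qed
  have d: "\<forall>P \<in> polys_qff (map_qff tr \<phi>). D P" if "good N \<phi>" for \<phi>
    using that dg by (auto simp: polys_map_qff good_def)
  have e: "eval_qff ev (map_qff tr \<phi>) (join m' X Y) = qe (scval s) (val X Y) \<phi>" if "good N \<phi>" for \<phi> X Y
    unfolding val_def by (rule transl[where ev = ev and tr = tr, OF that]) (rule ev)
  have eq: "(\<exists>X'. \<forall>Y'. (bd \<longrightarrow> (\<forall>j<n'. \<bar>Y' j\<bar> \<le> 1)) \<longrightarrow> (bd \<longrightarrow> (\<forall>i<m'. \<bar>X' i\<bar> \<le> 1))
        \<and> (guard \<Psi> (start s) (val X' Y') \<longrightarrow> qe (scval s) (val X' Y') ?\<Phi>'))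
    \<longleftrightarrow> (\<exists>X. \<forall>Y. (bd \<longrightarrow> (\<forall>j<n. \<bar>Y j\<bar> \<le> 1)) \<longrightarrow> (bd \<longrightarrow> (\<forall>i<m. \<bar>X i\<bar> \<le> 1))
        \<and> (premise \<Psi> (join m X Y) \<longrightarrow> eval_qff eval_term \<Phi> (join m X Y)))" for bd
    by (rule old_iff_new[OF n1]) (use n2 n3 in blast)
  note eq = eq[unfolded guard_def premise_def]
  \<comment> \<open>The semantics of bounded quantifiers is a disjunction, while the equivalence was
    obtained with an implication.\<close>
  have imp: "(\<not> P \<or> (Q \<and> R)) = (P \<longrightarrow> Q \<and> R)" for P Q R by blast
  show ?thesis
  proof (cases s)
    case (S2 m1 n1 \<Phi>1)
    then have p: "m1 = m" "n1 = n" "\<Phi>1 = \<Phi>" "\<Psi> = None" "C = Sigma2" using s C by (auto dest: in_class_class_of)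
    have t: "transf tr m' n' s = S2 m' n' (map_qff tr ?\<Phi>')" using S2 p by (simp add: Let_def)
    have "holds eval_term s \<longleftrightarrow> holds eval_term (S2 m n \<Phi>)" using S2 p by simp
    then have "holds ev (transf tr m' n' s) \<longleftrightarrow> holds eval_term s"
      using eq[of False] unfolding t p(4) holds.simps e[OF g1] by simp
    then show ?thesis unfolding t p(5) using v[OF g1] d[OF g1] by simp
  next
    case (BS2 m1 n1 \<Phi>1)
    then have p: "m1 = m" "n1 = n" "\<Phi>1 = \<Phi>" "\<Psi> = None" "C = BSigma2" using s C by (auto dest: in_class_class_of)
    have t: "transf tr m' n' s = BS2 m' n' (map_qff tr ?\<Phi>')" using BS2 p by (simp add: Let_def)
    have "holds eval_term s \<longleftrightarrow> holds eval_term (BS2 m n \<Phi>)" using BS2 p by simp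
    then have "holds ev (transf tr m' n' s) \<longleftrightarrow> holds eval_term s"
      using eq[of True] unfolding t p(4) holds.simps e[OF g1] imp by simp
    then show ?thesis unfolding t p(5) using v[OF g1] d[OF g1] by simp
  next
    case (BS2pp m1 n1 \<Psi>1 \<Phi>1)
    then have p: "m1 = m" "n1 = n" "\<Phi>1 = \<Phi>" "\<Psi> = Some \<Psi>1" "C = BSigma2pp"
      using s C by (auto dest: in_class_class_of)
    have t: "transf tr m' n' s = BS2pp m' n' (map_qff tr (Psi' ?ns (start s) \<Psi>1)) (map_qff tr ?\<Phi>')"
      using BS2pp p by (simp add: Let_def)
    have "holds eval_term s \<longleftrightarrow> holds eval_term (BS2pp m n \<Psi>1 \<Phi>)" using BS2pp p by simp
    then have "holds ev (transf tr m' n' s) \<longleftrightarrow> holds eval_term s"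
      using eq[of True] unfolding t p(4) holds.simps e[OF g1] e[OF g2[OF p(4)]] imp by simp
    then show ?thesis unfolding t p(5) using v[OF g1] d[OF g1] v2[OF p(4)] d[OF g2[OF p(4)]]
      by (simp add: ball_Un)
  qed
qed

section \<open>Programs\<close>

definition For :: "nat \<Rightarrow> cmd \<Rightarrow> cmd" where "For i c = Seq (Zero i) (Loop i c)"

text \<open>Loop execution up to the value of the counter. Since every iteration sets the counter,
  executions over consecutive ranges compose without recording where it was left.\<close>

definition fl :: "(regs \<Rightarrow> regs \<times> bool list) \<Rightarrow> nat \<Rightarrow> nat list \<Rightarrow> regs \<Rightarrow> regs \<Rightarrow> bool list \<Rightarrow> bool" where
  "fl F i js \<sigma> \<sigma>' out \<longleftrightarrow> (fst (floop F i js \<sigma>))(i := 0) = \<sigma>'(i := 0) \<and> snd (floop F i js \<sigma>) = out"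

lemma floop_insens:
  assumes "\<sigma>(i := 0) = \<tau>(i := 0)"
  shows "(fst (floop F i js \<sigma>))(i := 0) = (fst (floop F i js \<tau>))(i := 0)
       \<and> snd (floop F i js \<sigma>) = snd (floop F i js \<tau>)"
proof (cases js)
  case (Cons j js')
  have "\<sigma>(i := j) = \<tau>(i := j)" using assms by (metis fun_upd_upd)
  then show ?thesis using Cons by simp
qed (use assms in simp)

lemma floop_append: "floop F i (js @ ks) \<sigma> =
    (let (\<sigma>1, o1) = floop F i js \<sigma>; (\<sigma>2, o2) = floop F i ks \<sigma>1 in (\<sigma>2, o1 @ o2))"
  by (induction js arbitrary: \<sigma>) (auto simp: case_prod_unfold Let_def)

lemma fl_Nil: "fl F i [] \<sigma> \<sigma> []"
  by (simp add: fl_def)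

lemma fl_Cons: "F (\<sigma>(i := j)) = (\<sigma>1, o1) \<Longrightarrow> fl F i js \<sigma>1 \<sigma>2 o2 \<Longrightarrow> fl F i (j # js) \<sigma> \<sigma>2 (o1 @ o2)"
  by (simp add: fl_def case_prod_unfold)

lemma fl_single: "F (\<sigma>(i := j)) = (\<sigma>1, o1) \<Longrightarrow> fl F i [j] \<sigma> \<sigma>1 o1"
  by (simp add: fl_def case_prod_unfold)

lemma fl_append:
  assumes "fl F i js \<sigma> \<sigma>1 o1" "fl F i ks \<sigma>1 \<sigma>2 o2"
  shows "fl F i (js @ ks) \<sigma> \<sigma>2 (o1 @ o2)"
  using assms floop_insens[of "fst (floop F i js \<sigma>)" i \<sigma>1 F ks]
  by (auto simp: fl_def floop_append case_prod_unfold)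

lemma fl_cong: "fl F i js \<sigma> \<sigma>' out \<Longrightarrow> \<sigma>'(i := 0) = \<tau>'(i := 0) \<Longrightarrow> out = out' \<Longrightarrow> fl F i js \<sigma> \<tau>' out'"
  by (simp add: fl_def)

lemma fl_start: "fl F i js \<sigma> \<sigma>' out \<Longrightarrow> \<sigma>(i := 0) = \<tau>(i := 0) \<Longrightarrow> fl F i js \<tau> \<sigma>' out"
  using floop_insens[of \<sigma> i \<tau> F js] by (simp add: fl_def)

lemma fl_nop:
  assumes "\<And>j. j \<in> set js \<Longrightarrow> F (\<sigma>(i := j)) = (\<sigma>(i := j), g j)"
  shows "fl F i js \<sigma> \<sigma> (concat (map g js))"
  using assms
proof (induction js)
  case (Cons j js)
  have "fl F i js \<sigma> \<sigma> (concat (map g js))" using Cons by auto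
  then have "fl F i js (\<sigma>(i := j)) \<sigma> (concat (map g js))" by (rule fl_start) simp
  moreover have "F (\<sigma>(i := j)) = (\<sigma>(i := j), g j)" by (rule Cons.prems) simp
  ultimately show ?case using fl_Cons by fastforce
qed (simp add: fl_Nil)

lemma fl_silent:
  assumes "\<And>j. j \<in> set js \<Longrightarrow> F (\<sigma>(i := j)) = (\<sigma>(i := j), [])"
  shows "fl F i js \<sigma> \<sigma> []"
proof -
  have "fl F i js \<sigma> \<sigma> (concat (map (\<lambda>_. []) js))" by (rule fl_nop) (use assms in simp)
  moreover have "concat (map (\<lambda>_. []) js) = ([] :: bool list)" by simp
  ultimately show ?thesis by simp
qed

lemma run_For:
  assumes "fl (run W c) i [0..<length W] \<sigma> \<sigma>' out"
  shows "run W (For i c) \<sigma> = (\<sigma>'(i := 0), out)"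
  using fl_start[OF assms, of "\<sigma>(i := 0)"] by (simp add: For_def fl_def case_prod_unfold)

lemma run_For_out:
  assumes "\<sigma> i = 0" "\<And>k. k < length W \<Longrightarrow> run W c (\<sigma>(i := k)) = (\<sigma>(i := k), to_bits (g k))"
  shows "run W (For i c) \<sigma> = (\<sigma>, to_bits (concat (map g [0..<length W])))"
proof -
  have tb: "concat (map (\<lambda>k. to_bits (g k)) ks) = to_bits (concat (map g ks))" for ks
    by (induction ks) (auto simp: to_bits_def)
  have "fl (run W c) i [0..<length W] \<sigma> \<sigma> (concat (map (\<lambda>k. to_bits (g k)) [0..<length W]))"
    by (rule fl_nop) (use assms in auto)
  from run_For[OF this] show ?thesis using assms(1) by (simp add: tb fun_upd_idem)
qed

lemma mods_For [simp]: "mods (For i c) = insert i (mods c)"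
  and wfc_For [simp]: "wfc (For i c) \<longleftrightarrow> i \<notin> mods c \<and> wfc c"
  by (auto simp: For_def)

lemma to_bits_append [simp]: "to_bits (xs @ ys) = to_bits xs @ to_bits ys"
  by (simp add: to_bits_def)

lemma to_bits_Nil [simp]: "to_bits [] = []"
  by (simp add: to_bits_def)

section \<open>Tokens on the padded tape\<close>

definition pad :: "nat list \<Rightarrow> nat list" where "pad ts = concat (map (\<lambda>t. [16, 16, 16, t]) ts)"

lemma length_pad [simp]: "length (pad ts) = 4 * length ts"
  by (induction ts) (auto simp: pad_def)

lemma pre_to_bits: "\<forall>t\<in>set ts. t < 16 \<Longrightarrow> pre [] (to_bits ts) = pad ts"
proof (induction ts)
  case (Cons t ts)
  have "t < 16" using Cons.prems by simp
  then have "t = 0 \<or> t = 1 \<or> t = 2 \<or> t = 3 \<or> t = 4 \<or> t = 5 \<or> t = 6 \<or> t = 7 \<or> t = 8 \<or> t = 9 \<or> t = 10 \<or> t = 11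
     \<or> t = 12 \<or> t = 13 \<or> t = 14 \<or> t = 15" by presburger
  then have "tokval (bits4 t) = t" by (elim disjE) (simp_all add: tokval_def bits4_def)
  then show ?case using Cons by (simp add: to_bits_def bits4_def pad_def)
qed (simp add: pad_def)

lemma nth_pad: "j < 4 * length ts \<Longrightarrow> pad ts ! j = (if j mod 4 = 3 then ts ! (j div 4) else 16)"
proof (induction ts arbitrary: j)
  case (Cons t ts)
  show ?case
  proof (cases "j < 4")
    case True
    then have "j = 0 \<or> j = 1 \<or> j = 2 \<or> j = 3" by auto
    then show ?thesis by (auto simp: pad_def)
  next
    case False
    then obtain i where i: "j = i + 4" by (metis add.commute le_Suc_ex not_less)
    have "pad (t # ts) ! j = pad ts ! i" by (simp add: pad_def i)
    then show ?thesis using Cons i by simp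
  qed
qed simp

definition ps :: "nat \<Rightarrow> nat" where "ps k = 4 * k + 3"

lemma ps_mod [simp]: "ps k mod 4 = 3" "ps k div 4 = k"
  by (simp_all add: ps_def)

lemma ps_eq [simp]: "ps k = ps l \<longleftrightarrow> k = l" by (simp add: ps_def)
lemma ps_less [simp]: "ps k < ps l \<longleftrightarrow> k < l" by (auto simp: ps_def)

lemma nth_pad_ps [simp]: "k < length ts \<Longrightarrow> pad ts ! ps k = ts ! k"
  using nth_pad[of "ps k" ts] by (simp add: ps_def)

lemma ps_bound [simp]: "k < length ts \<Longrightarrow> ps k < 4 * length ts" by (simp add: ps_def)

lemma upt_blocks: "[4 * a..<4 * b] = concat (map (\<lambda>k. [4 * k, 4 * k + 1, 4 * k + 2, ps k]) [a..<b])"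
proof (induction b)
  case (Suc b)
  show ?case
  proof (cases "a \<le> b")
    case True
    have "[4 * a..<4 * Suc b] = [4 * a..<4 * b] @ [4 * b, 4 * b + 1, 4 * b + 2, ps b]"
      using True by (simp add: upt_add_eq_append[of "4 * a" "4 * b" 4] add.commute ps_def numeral_eq_Suc)
    then show ?thesis using Suc True by simp
  qed (use Suc in simp)
qed simp

text \<open>Loops may skip the padding cells if their bodies ignore them.\<close>

lemma fl_pads:
  assumes pad: "\<And>\<sigma> j. Inv \<sigma> \<Longrightarrow> a \<le> j div 4 \<Longrightarrow> j div 4 < b \<Longrightarrow> j mod 4 \<noteq> 3 \<Longrightarrow> F (\<sigma>(i := j)) = (\<sigma>(i := j), [])"
    and inv: "\<And>\<sigma> k. Inv \<sigma> \<Longrightarrow> a \<le> k \<Longrightarrow> k < b \<Longrightarrow> Inv (fst (F (\<sigma>(i := ps k))))"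
    and I: "Inv \<sigma>" and ab: "fl F i (map ps [a..<b]) \<sigma> \<sigma>' out"
    and insens: "\<And>\<sigma> v. Inv \<sigma> \<Longrightarrow> Inv (\<sigma>(i := v))"
  shows "fl F i [4 * a..<4 * b] \<sigma> \<sigma>' out"
proof -
  have "floop F i (concat (map (\<lambda>k. [4 * k, 4 * k + 1, 4 * k + 2, ps k]) ks)) \<sigma> = floop F i (map ps ks) \<sigma>"
    if "set ks \<subseteq> {a..<b}" "Inv \<sigma>" for ks \<sigma>
    using that
  proof (induction ks arbitrary: \<sigma>)
    case (Cons k ks)
    have d: "(4 * k) div 4 = k" "(4 * k + 1) div 4 = k" "(4 * k + 2) div 4 = k"
      "(4 * k) mod 4 \<noteq> 3" "(4 * k + 1) mod 4 \<noteq> 3" "(4 * k + 2) mod 4 \<noteq> 3" by presburger+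
    have k: "a \<le> k" "k < b" using Cons.prems by auto
    have p: "F (\<tau>(i := 4 * k)) = (\<tau>(i := 4 * k), [])" "F (\<tau>(i := 4 * k + 1)) = (\<tau>(i := 4 * k + 1), [])"
      "F (\<tau>(i := 4 * k + 2)) = (\<tau>(i := 4 * k + 2), [])" if "Inv \<tau>" for \<tau>
      using pad[OF that, of "4 * k"] pad[OF that, of "4 * k + 1"] pad[OF that, of "4 * k + 2"] d k by simp_all
    let ?G = "\<lambda>ks. concat (map (\<lambda>k. [4 * k, 4 * k + 1, 4 * k + 2, ps k]) ks)"
    have 1: "floop F i ([4 * k, 4 * k + 1, 4 * k + 2] @ xs) \<sigma> = floop F i xs (\<sigma>(i := 4 * k + 2))" for xs
      using p[OF Cons.prems(2)] p[OF insens[OF Cons.prems(2)]] by (simp add: case_prod_unfold)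
    have 2: "floop F i (ps k # xs) (\<sigma>(i := 4 * k + 2)) = floop F i (ps k # xs) \<sigma>" for xs
      by simp
    have 3: "?G (k # ks) = [4 * k, 4 * k + 1, 4 * k + 2] @ (ps k # ?G ks)" by simp
    have "floop F i (?G (k # ks)) \<sigma> = floop F i (ps k # ?G ks) \<sigma>"
      unfolding 3 1 2 ..
    also have "\<dots> = floop F i (map ps (k # ks)) \<sigma>"
      using Cons.IH[of "fst (F (\<sigma>(i := ps k)))"] Cons.prems inv[OF Cons.prems(2) k]
      by (simp add: case_prod_unfold Let_def)
    finally show ?case .
  qed simp
  from this[of "[a..<b]" \<sigma>] show ?thesis using I ab unfolding fl_def upt_blocks by simp
qed

definition OutT :: "nat \<Rightarrow> cmd" where
  "OutT t = Seq (Out (odd t)) (Seq (Out (odd (t div 2))) (Seq (Out (odd (t div 4))) (Out (odd (t div 8)))))"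

lemma run_OutT [simp]: "run W (OutT t) \<sigma> = (\<sigma>, to_bits [t])"
  by (simp add: OutT_def to_bits_def bits4_def)

lemma OutT_simps [simp]: "mods (OutT t) = {}" "wfc (OutT t)"
  by (simp_all add: OutT_def)

lemma run_Seq [simp]: "run W (Seq c d) \<sigma> = (fst (run W d (fst (run W c \<sigma>))), snd (run W c \<sigma>) @ snd (run W d (fst (run W c \<sigma>))))"
  by (simp add: case_prod_unfold Let_def)

declare run.simps(6) [simp del]

text \<open>\<open>rT\<close> and \<open>rU\<close> point to nodes, \<open>rA\<close> and
  \<open>rB\<close> to the children of a node, \<open>rM\<close> to the token before the digits of
  m, and \<open>rH\<close> to the first token of \<Phi> in the third class. \<open>rN\<close>,
  \<open>rC\<close> and \<open>rD\<close> belong to the halving of a number.\<close>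

abbreviation (input) "rT \<equiv> 2 :: nat"
abbreviation (input) "rU \<equiv> 3 :: nat"
abbreviation (input) "rA \<equiv> 4 :: nat"
abbreviation (input) "rB \<equiv> 5 :: nat"
abbreviation (input) "rI \<equiv> 6 :: nat"
abbreviation (input) "rJ \<equiv> 7 :: nat"
abbreviation (input) "rP \<equiv> 8 :: nat"
abbreviation (input) "rQ \<equiv> 9 :: nat"
abbreviation (input) "rF \<equiv> 10 :: nat"
abbreviation (input) "rZ \<equiv> 11 :: nat"
abbreviation (input) "rM \<equiv> 12 :: nat"
abbreviation (input) "rH \<equiv> 13 :: nat"
abbreviation (input) "rN \<equiv> 14 :: nat"
abbreviation (input) "rC \<equiv> 15 :: nat"
abbreviation (input) "rD \<equiv> 16 :: nat"

text \<open>Registers that subroutines find at 0 and return to 0. \<open>rZ\<close> is never written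
  and serves as the constant 0, so \<open>Neq rF rZ\<close> asks whether the flag \<open>rF\<close>
  is raised.\<close>

definition scratch :: "nat set" where "scratch = {rI, rJ, rP, rQ, rF, rZ}"

definition clean :: "regs \<Rightarrow> bool" where "clean \<sigma> \<longleftrightarrow> (\<forall>r\<in>scratch. \<sigma> r = 0)"

lemma cleanD: "clean \<sigma> \<Longrightarrow> \<sigma> rI = 0 \<and> \<sigma> rJ = 0 \<and> \<sigma> rP = 0 \<and> \<sigma> rQ = 0 \<and> \<sigma> rF = 0 \<and> \<sigma> rZ = 0"
  by (simp add: clean_def scratch_def)

lemma clean_upd [simp]: "r \<notin> scratch \<Longrightarrow> clean (\<sigma>(r := v)) \<longleftrightarrow> clean \<sigma>"
  by (auto simp: clean_def)

text \<open>The flag goes up at position \<open>r\<close> and down at the next end marker; tokens in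
  between are echoed. A full loop thus replaces jumping to a position.\<close>

definition copy_body :: "nat \<Rightarrow> cmd" where
  "copy_body r = If (Neq rF rZ)
     (If (Tok rJ {4}) (Seq (OutT 4) (Zero rF))
       (If (Tok rJ {0}) (OutT 0) (If (Tok rJ {1}) (OutT 1) (If (Tok rJ {2}) (OutT 2) (If (Tok rJ {3}) (OutT 3) Skip)))))
     (If (Neq rJ r) Skip (Inc rF))"

definition CopyD :: "nat \<Rightarrow> cmd" where "CopyD r = For rJ (copy_body r)"

definition digits_at :: "nat list \<Rightarrow> nat \<Rightarrow> nat list \<Rightarrow> bool" where
  "digits_at ts k xs \<longleftrightarrow> (\<exists>ds rest. k < length ts \<and> drop (Suc k) ts = ds @ 4 # rest \<and> set ds \<subseteq> {0..3} \<and> xs = ds @ [4])"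

lemma run_CopyD:
  assumes c: "clean \<sigma>" and r: "r \<notin> scratch" "\<sigma> r = ps k" and d: "digits_at ts k xs"
  shows "run (pad ts) (CopyD r) \<sigma> = (\<sigma>, to_bits xs)"
proof -
  obtain ds rest where k: "k < length ts" and ds: "drop (Suc k) ts = ds @ 4 # rest" "set ds \<subseteq> {0..3}"
    and xs: "xs = ds @ [4]" using d by (auto simp: digits_at_def)
  let ?F = "run (pad ts) (copy_body r)" and ?l = "length ts"
  have r': "r \<noteq> rJ" "r \<noteq> rF" "r \<noteq> rZ" using r by (auto simp: scratch_def)
  note cl = cleanD[OF c]
  have nth: "ts ! (Suc k + i) = (ds @ 4 # rest) ! i" for i
    using ds(1) k by (metis Suc_leI nth_drop)
  have l: "?l = Suc k + (length ds + Suc (length rest))"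
    using arg_cong[OF ds(1), of length] k by simp
  \<comment> \<open>The flag is constant on each stretch: down before \<open>k\<close>, raised at
    \<open>k\<close>, up over the digits, lowered at the end marker, down behind it.\<close>
  have sp: "[0..<?l] = [0..<k] @ [k] @ [Suc k..<Suc k + length ds] @ [Suc k + length ds] @ [Suc (Suc k + length ds)..<?l]"
  proof -
    have "[0..<?l] = [0..<k] @ [k..<?l]" using k by (metis less_imp_le_nat upt_add_eq_append le_add_diff_inverse zero_le)
    moreover have "[k..<?l] = k # [Suc k..<?l]" using k by (rule upt_conv_Cons)
    moreover have "[Suc k..<?l] = [Suc k..<Suc k + length ds] @ [Suc k + length ds..<?l]"
      using upt_add_eq_append[of "Suc k" "Suc k + length ds" "Suc (length rest)"] l by (simp add: add.assoc)
    moreover have "[Suc k + length ds..<?l] = (Suc k + length ds) # [Suc (Suc k + length ds)..<?l]"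
      using l by (intro upt_conv_Cons) simp
    ultimately show ?thesis by simp
  qed
  let ?\<tau> = "\<sigma>(rF := Suc 0)"
  have 1: "fl ?F rJ (map ps [0..<k]) \<sigma> \<sigma> []"
    by (rule fl_silent) (use cl r r' in \<open>auto simp: copy_body_def\<close>)
  have 2: "fl ?F rJ (map ps [k]) \<sigma> ?\<tau> []"
    unfolding list.map
    by (rule fl_cong[OF fl_single[of _ _ _ _ "(\<sigma>(rJ := ps k))(rF := Suc 0)"]])
      (use cl r r' in \<open>auto simp: copy_body_def fun_upd_twist\<close>)
  have 3: "fl ?F rJ (map ps [Suc k..<Suc k + length ds]) ?\<tau> ?\<tau> (to_bits ds)"
  proof -
    have "fl ?F rJ (map ps [Suc k..<Suc k + length ds]) ?\<tau> ?\<tau> (concat (map (\<lambda>j. to_bits [ts ! (j div 4)]) (map ps [Suc k..<Suc k + length ds])))"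
    proof (rule fl_nop)
      fix j assume "j \<in> set (map ps [Suc k..<Suc k + length ds])"
      then obtain i where i: "j = ps (Suc k + i)" "i < length ds" by (auto simp: le_iff_add)
      then have b: "Suc k + i < ?l" using l by simp
      have t: "ts ! (Suc k + i) = ds ! i" using nth[of i] i by (simp add: nth_append)
      have "ds ! i \<in> {0..3}" using ds(2) i(2) nth_mem by blast
      then have "ds ! i = 0 \<or> ds ! i = 1 \<or> ds ! i = 2 \<or> ds ! i = 3" by auto
      then show "?F (?\<tau>(rJ := j)) = (?\<tau>(rJ := j), to_bits [ts ! (j div 4)])"
        using cl r' b t i by (auto simp: copy_body_def)
    qed
    moreover have "concat (map (\<lambda>j. to_bits [ts ! (j div 4)]) (map ps [Suc k..<Suc k + length ds])) = to_bits ds"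
    proof -
      have "map (\<lambda>j. ts ! (j div 4)) (map ps [Suc k..<Suc k + length ds]) = ds"
        by (rule nth_equalityI) (use nth in \<open>auto simp: nth_append simp del: upt_Suc\<close>)
      moreover have "concat (map (\<lambda>j. to_bits [h j]) js) = to_bits (map h js)" for h :: "nat \<Rightarrow> nat" and js
        by (induction js) (auto simp: to_bits_def)
      ultimately show ?thesis by metis
    qed
    ultimately show ?thesis by simp
  qed
  have 4: "fl ?F rJ (map ps [Suc k + length ds]) ?\<tau> \<sigma> (to_bits [4])"
    unfolding list.map
  proof (rule fl_cong[OF fl_single])
    have "ts ! (Suc k + length ds) = 4" "Suc k + length ds < ?l" using nth[of "length ds"] l by simp_all
    then show "?F (?\<tau>(rJ := ps (Suc k + length ds))) = ((?\<tau>(rJ := ps (Suc k + length ds)))(rF := 0), to_bits [4])"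
      using cl r' by (simp add: copy_body_def)
  qed (use cl in auto)
  have 5: "fl ?F rJ (map ps [Suc (Suc k + length ds)..<?l]) \<sigma> \<sigma> []"
    by (rule fl_silent) (use cl r r' in \<open>auto simp: copy_body_def\<close>)
  have "fl ?F rJ (map ps [0..<?l]) \<sigma> \<sigma> (to_bits xs)"
    unfolding sp map_append
    by (rule fl_cong[OF fl_append[OF 1 fl_append[OF 2 fl_append[OF 3 fl_append[OF 4 5]]]]]) (simp_all add: xs)
  then have "fl ?F rJ [4 * 0..<4 * ?l] \<sigma> \<sigma> (to_bits xs)"
  proof (rule fl_pads[rotated 3, where Inv = "\<lambda>\<sigma>. \<sigma> r = ps k"])
    fix \<sigma> j assume "\<sigma> r = ps k" "0 \<le> j div 4" "j div 4 < ?l" "j mod 4 \<noteq> 3"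
    moreover have "j < 4 * ?l" using \<open>j div 4 < ?l\<close> by linarith
    moreover have "j \<noteq> ps k" using \<open>j mod 4 \<noteq> 3\<close> by auto
    ultimately show "?F (\<sigma>(rJ := j)) = (\<sigma>(rJ := j), [])"
      using r' by (auto simp: copy_body_def nth_pad)
  next
    fix \<sigma> j assume "\<sigma> r = ps k"
    moreover have "r \<notin> mods (copy_body r)" using r' by (auto simp: copy_body_def)
    ultimately show "fst (?F (\<sigma>(rJ := ps j))) r = ps k" using run_unmod r' by simp
  qed (use r r' in auto)
  from run_For[of "pad ts" "copy_body r" rJ \<sigma> \<sigma> "to_bits xs"] this show ?thesis
    using cl by (simp add: CopyD_def fun_upd_idem)
qed

section \<open>Finding the end of a subtree in prefix notation\<close>

inductive tree :: "nat list \<Rightarrow> bool" where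
  leaf: "x \<in> {5, 6} \<Longrightarrow> set ds \<subseteq> {0..4} \<Longrightarrow> tree (x # ds)"
| node: "x \<in> {7..11} \<Longrightarrow> tree xs \<Longrightarrow> tree ys \<Longrightarrow> tree (x # xs @ ys)"

definition occ :: "nat list \<Rightarrow> nat \<Rightarrow> nat list \<Rightarrow> bool" where
  "occ ts a xs \<longleftrightarrow> a + length xs \<le> length ts \<and> (\<forall>j < length xs. ts ! (a + j) = xs ! j)"

lemma occ_append: "occ ts a (xs @ ys) \<longleftrightarrow> occ ts a xs \<and> occ ts (a + length xs) ys"
proof
  assume o: "occ ts a (xs @ ys)"
  have "ts ! (a + length xs + j) = ys ! j" if "j < length ys" for j
  proof -
    have "length xs + j < length (xs @ ys)" using that by simp
    then have "ts ! (a + (length xs + j)) = (xs @ ys) ! (length xs + j)" using o unfolding occ_def by blast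
    then show ?thesis by (simp add: add.assoc)
  qed
  moreover have "ts ! (a + j) = xs ! j" if "j < length xs" for j
  proof -
    have "ts ! (a + j) = (xs @ ys) ! j" using o that by (simp add: occ_def)
    then show ?thesis using that by (simp add: nth_append)
  qed
  ultimately show "occ ts a xs \<and> occ ts (a + length xs) ys" using o by (simp add: occ_def)
next
  assume o: "occ ts a xs \<and> occ ts (a + length xs) ys"
  have "ts ! (a + j) = (xs @ ys) ! j" if "j < length xs + length ys" for j
  proof (cases "j < length xs")
    case True
    then show ?thesis using o by (simp add: occ_def nth_append)
  next
    case False
    then have "j - length xs < length ys" using that by simp
    then have "ts ! (a + length xs + (j - length xs)) = ys ! (j - length xs)" using o unfolding occ_def by blast
    moreover have "a + length xs + (j - length xs) = a + j" using False by simp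
    ultimately show ?thesis using False by (simp add: nth_append)
  qed
  then show "occ ts a (xs @ ys)" using o by (simp add: occ_def)
qed

lemma occ_Cons: "occ ts a (x # xs) \<longleftrightarrow> a < length ts \<and> ts ! a = x \<and> occ ts (Suc a) xs"
  using occ_append[of ts a "[x]" xs] by (auto simp: occ_def)

text \<open>A subtree in prefix notation ends when its leaves outnumber its binary nodes by one. \<open>rP\<close> counts
  the binary nodes plus one, \<open>rQ\<close> the leaves.\<close>

definition find_body :: "nat \<Rightarrow> cmd" where
  "find_body r = If (Neq rF rZ)
     (If (Tok rJ {5..11})
        (If (Neq rP rQ) (If (Tok rJ {7..11}) (Inc rP) (Inc rQ)) (Seq (Copy rB rJ) (Zero rF)))
        Skip)
     (If (Neq rJ r) Skip (Seq (Inc rF) (Inc rP)))"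

definition FindB :: "nat \<Rightarrow> cmd" where
  "FindB r = Seq (For rJ (find_body r)) (Seq (Zero rP) (Zero rQ))"

text \<open>A subtree with \<open>d\<close> binary nodes has \<open>d + 1\<close> leaves, so
  scanning it closes the gap between the counters by one. Before each of its head tokens a leaf is
  still missing, hence the end cannot be reported too early. Arbitrary initial counts make the
  induction go through.\<close>

lemma scan_tree:
  assumes "tree xs" "occ ts a xs" "\<sigma> rF = 1" "\<sigma> rZ = 0" "\<sigma> rQ < \<sigma> rP"
  shows "\<exists>d. fl (run (pad ts) (find_body r)) rJ (map ps [a..<a + length xs]) \<sigma> (\<sigma>(rP := \<sigma> rP + d, rQ := \<sigma> rQ + d + 1)) []"
  using assms
proof (induction xs arbitrary: a \<sigma> rule: tree.induct)
  case (leaf x ds)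
  let ?F = "run (pad ts) (find_body r)"
  have x: "a < length ts" "ts ! a = x" "occ ts (Suc a) ds" using leaf.prems(1) by (auto simp: occ_Cons)
  have 1: "fl ?F rJ (map ps [a]) \<sigma> (\<sigma>(rQ := \<sigma> rQ + 1)) []"
    unfolding list.map
    by (rule fl_cong[OF fl_single[of _ _ _ _ "(\<sigma>(rJ := ps a))(rQ := \<sigma> rQ + 1)"]])
      (use leaf.prems leaf.hyps x in \<open>auto simp: find_body_def fun_upd_twist\<close>)
  have 2: "fl ?F rJ (map ps [Suc a..<Suc a + length ds]) (\<sigma>(rQ := \<sigma> rQ + 1)) (\<sigma>(rQ := \<sigma> rQ + 1)) []"
  proof (rule fl_silent)
    fix j assume "j \<in> set (map ps [Suc a..<Suc a + length ds])"
    then obtain i where i: "j = ps (Suc a + i)" "i < length ds" by (auto simp: le_iff_add)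
    then have "Suc a + i < length ts" "ts ! (Suc a + i) = ds ! i" using x(3) by (auto simp: occ_def)
    moreover have "ds ! i \<in> {0..4}" using leaf.hyps i nth_mem by blast
    ultimately show "?F ((\<sigma>(rQ := \<sigma> rQ + 1))(rJ := j)) = ((\<sigma>(rQ := \<sigma> rQ + 1))(rJ := j), [])"
      using leaf.prems i by (auto simp: find_body_def)
  qed
  have e: "map ps [a..<a + length (x # ds)] = map ps [a] @ map ps [Suc a..<Suc a + length ds]"
    by (simp add: upt_conv_Cons del: upt_Suc)
  have "fl ?F rJ (map ps [a..<a + length (x # ds)]) \<sigma> (\<sigma>(rQ := \<sigma> rQ + 1)) []"
    using fl_append[OF 1 2] unfolding e append_Nil .
  moreover have "\<sigma>(rQ := \<sigma> rQ + 1) = \<sigma>(rP := \<sigma> rP + 0, rQ := \<sigma> rQ + 0 + 1)" by (rule ext) simp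
  ultimately show ?case by metis
next
  case (node x xs ys)
  let ?F = "run (pad ts) (find_body r)"
  have x: "a < length ts" "ts ! a = x" "occ ts (Suc a) xs" "occ ts (Suc a + length xs) ys"
    using node.prems(1) by (auto simp: occ_Cons occ_append)
  let ?s1 = "\<sigma>(rP := \<sigma> rP + 1)"
  have 1: "fl ?F rJ (map ps [a]) \<sigma> ?s1 []"
    unfolding list.map
    by (rule fl_cong[OF fl_single[of _ _ _ _ "(\<sigma>(rJ := ps a))(rP := \<sigma> rP + 1)"]])
      (use node.prems node.hyps x in \<open>auto simp: find_body_def fun_upd_twist\<close>)
  obtain d where 2: "fl ?F rJ (map ps [Suc a..<Suc a + length xs]) ?s1 (?s1(rP := ?s1 rP + d, rQ := ?s1 rQ + d + 1)) []"
  proof -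
    have "?s1 rF = 1" "?s1 rZ = 0" "?s1 rQ < ?s1 rP" using node.prems by simp_all
    from node.IH(1)[OF x(3) this] that show ?thesis by blast
  qed
  let ?s2 = "?s1(rP := ?s1 rP + d, rQ := ?s1 rQ + d + 1)"
  obtain e where 3: "fl ?F rJ (map ps [Suc a + length xs..<Suc a + length xs + length ys]) ?s2 (?s2(rP := ?s2 rP + e, rQ := ?s2 rQ + e + 1)) []"
  proof -
    have "?s2 rF = 1" "?s2 rZ = 0" "?s2 rQ < ?s2 rP" using node.prems by simp_all
    from node.IH(2)[OF x(4) this] that show ?thesis by blast
  qed
  have e: "map ps [a..<a + length (x # xs @ ys)] = map ps [a] @ map ps [Suc a..<Suc a + length xs] @ map ps [Suc a + length xs..<Suc a + length xs + length ys]"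
    using upt_add_eq_append[of "Suc a" "Suc a + length xs" "length ys"] by (simp add: upt_conv_Cons add.assoc del: upt_Suc)
  have "fl ?F rJ (map ps [a..<a + length (x # xs @ ys)]) \<sigma> (?s2(rP := ?s2 rP + e, rQ := ?s2 rQ + e + 1)) []"
    using fl_append[OF 1 fl_append[OF 2 3]] unfolding e append_Nil .
  moreover have "?s2(rP := ?s2 rP + e, rQ := ?s2 rQ + e + 1) = \<sigma>(rP := \<sigma> rP + (1 + d + e), rQ := \<sigma> rQ + (1 + d + e) + 1)"
    by (rule ext) simp
  ultimately show ?case by metis
qed

text \<open>The counters become equal at the last leaf, but the position is taken at the next head
  token, so that the digits of that leaf are passed; therefore some head token must follow the
  subtree. The tokens between \<open>k\<close> and \<open>a\<close> are digits of a header, which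
  the scan passes over.\<close>

lemma run_FindB:
  assumes c: "clean \<sigma>" and r: "r \<notin> scratch" "r \<noteq> rB" "\<sigma> r = ps k" and k: "k < length ts"
    and xs: "tree xs" "occ ts a xs" "k < a" "\<And>j. k < j \<Longrightarrow> j < a \<Longrightarrow> ts ! j < 5"
    and nxt: "a + length xs < length ts" "ts ! (a + length xs) \<in> {5..11}"
  shows "run (pad ts) (FindB r) \<sigma> = (\<sigma>(rB := ps (a + length xs)), [])"
proof -
  let ?F = "run (pad ts) (find_body r)" and ?l = "length ts" and ?e = "a + length xs"
  have r': "r \<noteq> rJ" "r \<noteq> rF" "r \<noteq> rZ" "r \<noteq> rP" "r \<noteq> rQ" using r by (auto simp: scratch_def)
  note cl = cleanD[OF c]
  have sp: "[0..<?l] = [0..<k] @ [k] @ [Suc k..<a] @ [a..<?e] @ [?e] @ [Suc ?e..<?l]"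
  proof -
    have "[0..<?l] = [0..<k] @ [k..<?l]" using k by (metis less_imp_le_nat upt_add_eq_append le_add_diff_inverse zero_le)
    moreover have "[k..<?l] = k # [Suc k..<?l]" using k by (rule upt_conv_Cons)
    moreover have "[Suc k..<?l] = [Suc k..<a] @ [a..<?l]"
      using xs(3) nxt(1) by (metis Suc_leI add_leD1 le_add_diff_inverse less_imp_le_nat upt_add_eq_append)
    moreover have "[a..<?l] = [a..<?e] @ [?e..<?l]"
      using nxt(1) by (metis le_add1 le_add_diff_inverse less_imp_le_nat upt_add_eq_append)
    moreover have "[?e..<?l] = ?e # [Suc ?e..<?l]" using nxt(1) by (intro upt_conv_Cons)
    ultimately show ?thesis by simp
  qed
  let ?s1 = "\<sigma>(rF := Suc 0, rP := Suc 0)"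
  have 1: "fl ?F rJ (map ps [0..<k]) \<sigma> \<sigma> []"
    by (rule fl_silent) (use cl r r' in \<open>auto simp: find_body_def\<close>)
  have 2: "fl ?F rJ (map ps [k]) \<sigma> ?s1 []"
    unfolding list.map
    by (rule fl_cong[OF fl_single[of _ _ _ _ "(\<sigma>(rJ := ps k))(rF := Suc 0, rP := Suc 0)"]])
      (use cl r r' in \<open>auto simp: find_body_def fun_upd_twist\<close>)
  have 3: "fl ?F rJ (map ps [Suc k..<a]) ?s1 ?s1 []"
  proof (rule fl_silent)
    fix j assume "j \<in> set (map ps [Suc k..<a])"
    then obtain i where i: "j = ps i" "k < i" "i < a" by auto
    moreover have "i < ?l" using i nxt(1) by simp
    ultimately show "?F (?s1(rJ := j)) = (?s1(rJ := j), [])"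
      using xs(4)[of i] cl r' by (auto simp: find_body_def)
  qed
  obtain d where 4: "fl ?F rJ (map ps [a..<?e]) ?s1 (?s1(rP := ?s1 rP + d, rQ := ?s1 rQ + d + 1)) []"
    using scan_tree[OF xs(1,2), of ?s1 r] cl by auto
  let ?s2 = "?s1(rP := Suc d, rQ := Suc d)"
  have s2: "?s1(rP := ?s1 rP + d, rQ := ?s1 rQ + d + 1) = ?s2" using cl by (intro ext) simp
  let ?s3 = "\<sigma>(rP := Suc d, rQ := Suc d, rB := ps ?e)"
  have 5: "fl ?F rJ (map ps [?e]) ?s2 ?s3 []"
    unfolding list.map
  proof (rule fl_cong[OF fl_single])
    show "?F (?s2(rJ := ps ?e)) = ((?s2(rJ := ps ?e))(rB := ps ?e, rF := 0), [])"
      using cl r' nxt by (simp add: find_body_def)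
    show "(?s2(rJ := ps ?e, rB := ps ?e, rF := 0))(rJ := 0) = ?s3(rJ := 0)"
      using cl by (intro ext) simp
  qed simp
  have 6: "fl ?F rJ (map ps [Suc ?e..<?l]) ?s3 ?s3 []"
    by (rule fl_silent) (use cl r r' xs(3) in \<open>auto simp: find_body_def\<close>)
  have "fl ?F rJ (map ps [0..<?l]) \<sigma> ?s3 []"
    unfolding sp map_append
    by (rule fl_cong[OF fl_append[OF 1 fl_append[OF 2 fl_append[OF 3 fl_append[OF 4[unfolded s2] fl_append[OF 5 6]]]]]]) simp_all
  then have "fl ?F rJ [4 * 0..<4 * ?l] \<sigma> ?s3 []"
  proof (rule fl_pads[rotated 3, where Inv = "\<lambda>\<sigma>. \<sigma> r = ps k"])
    fix \<sigma> j assume "\<sigma> r = ps k" "0 \<le> j div 4" "j div 4 < ?l" "j mod 4 \<noteq> 3"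
    moreover have "j < 4 * ?l" using \<open>j div 4 < ?l\<close> by linarith
    moreover have "j \<noteq> ps k" using \<open>j mod 4 \<noteq> 3\<close> by auto
    ultimately show "?F (\<sigma>(rJ := j)) = (\<sigma>(rJ := j), [])"
      using r' by (auto simp: find_body_def nth_pad)
  next
    fix \<sigma> j assume "\<sigma> r = ps k"
    moreover have "r \<notin> mods (find_body r)" using r' r by (auto simp: find_body_def)
    ultimately show "fst (?F (\<sigma>(rJ := ps j))) r = ps k" using run_unmod r' by simp
  qed (use r r' in auto)
  from run_For[of "pad ts" "find_body r" rJ \<sigma> ?s3 "[]"] this
  have "run (pad ts) (For rJ (find_body r)) \<sigma> = (?s3(rJ := 0), [])" by simp
  moreover have "(?s3(rJ := 0))(rP := 0, rQ := 0) = \<sigma>(rB := ps ?e)" using cl by (intro ext) simp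
  ultimately show ?thesis by (simp add: FindB_def)
qed

section \<open>Printing coefficients, monomials and polynomials\<close>

primrec PCoef :: "coef \<Rightarrow> cmd" where
  "PCoef One = Seq (OutT 3) (Seq (OutT 1) (OutT 4))"
| "PCoef (Dig r) = CopyD r"
| "PCoef (DigV r) = Seq (OutT 3) (CopyD r)"

definition zeros :: "nat \<Rightarrow> cmd" where "zeros b = foldr (\<lambda>_. Seq (For rI (OutT 0))) [0..<b] Skip"

text \<open>Binary digits are listed from the lowest on, so an index 2 ^ n is n zeros followed by a
  one. The zeros for the block and for the position are printed by separate loops, and no sum is
  ever computed.\<close>

definition PVarT :: "nat \<Rightarrow> nat \<Rightarrow> cmd" where
  "PVarT b r = Seq (OutT 5) (Seq (zeros b) (Seq (For rI (If (Less rI r) (OutT 0) Skip)) (Seq (OutT 1) (OutT 4))))"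

definition PMonoT :: "mono \<Rightarrow> cmd" where
  "PMonoT m = foldr (\<lambda>(b, r) c. Seq (OutT 8) (Seq (PVarT b r) c)) (snd m) (Seq (OutT 6) (PCoef (fst m)))"

definition PPolyT :: "apoly \<Rightarrow> cmd" where
  "PPolyT P = foldr (\<lambda>m c. Seq (OutT 7) (Seq (PMonoT m) c)) P (Seq (OutT 6) (Seq (OutT 3) (OutT 4)))"

text \<open>Prints the exponent of the variable of block \<open>b\<close> at position
  \<open>rI\<close> by comparing it with every factor of the monomial. Blocks are known when the
  program is built, positions only when it runs.\<close>

definition marks :: "(nat \<times> nat) list \<Rightarrow> nat \<Rightarrow> cmd" where
  "marks fs b = foldr (\<lambda>(b', r) c. if b' = b then Seq (If (Neq rI r) Skip (OutT 13)) c else c) fs (OutT 12)"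

definition PMonoS :: "mono \<Rightarrow> cmd" where
  "PMonoS m = Seq (OutT 14) (Seq (foldr (\<lambda>b. Seq (For rI (marks (snd m) b))) [0..<7] Skip)
     (Seq (OutT 15) (PCoef (fst m))))"

definition PPolyS :: "apoly \<Rightarrow> cmd" where
  "PPolyS P = Seq (OutT 14) (foldr (\<lambda>m. Seq (PMonoS m)) P (OutT 15))"

primrec PQ :: "(apoly \<Rightarrow> cmd) \<Rightarrow> apoly qff \<Rightarrow> cmd" where
  "PQ PP (Le p q) = Seq (OutT 9) (Seq (PP p) (PP q))"
| "PQ PP (And a b) = Seq (OutT 10) (Seq (PQ PP a) (PQ PP b))"
| "PQ PP (Or a b) = Seq (OutT 11) (Seq (PQ PP a) (PQ PP b))"

text \<open>The formulas double as templates: in a program their positions are register numbers, and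
  instantiation replaces these by the contents of the registers.\<close>

fun inst_coef :: "regs \<Rightarrow> coef \<Rightarrow> coef" where
  "inst_coef \<sigma> One = One"
| "inst_coef \<sigma> (Dig r) = Dig (\<sigma> r)"
| "inst_coef \<sigma> (DigV r) = DigV (\<sigma> r)"

definition inst :: "regs \<Rightarrow> apoly \<Rightarrow> apoly" where
  "inst \<sigma> P = map (\<lambda>(c, fs). (inst_coef \<sigma> c, map (\<lambda>(b, r). (b, \<sigma> r)) fs)) P"

fun ok_coef :: "nat list \<Rightarrow> (coef \<Rightarrow> int) \<Rightarrow> regs \<Rightarrow> coef \<Rightarrow> bool" where
  "ok_coef ts cv \<sigma> One = (cv One = 1)"
| "ok_coef ts cv \<sigma> (Dig r) = (r \<notin> scratch \<and> (\<exists>k. \<sigma> r = ps k \<and> digits_at ts k (enc_int (cv (Dig (\<sigma> r))))))"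
| "ok_coef ts cv \<sigma> (DigV r) = (r \<notin> scratch \<and> (\<exists>k v. \<sigma> r = ps k \<and> digits_at ts k (enc_nat v) \<and> cv (DigV (\<sigma> r)) = int v))"

definition ok_mono :: "nat list \<Rightarrow> (coef \<Rightarrow> int) \<Rightarrow> regs \<Rightarrow> mono \<Rightarrow> bool" where
  "ok_mono ts cv \<sigma> m \<longleftrightarrow> ok_coef ts cv \<sigma> (fst m) \<and>
     (\<forall>(b, r) \<in> set (snd m). b < 7 \<and> r \<notin> scratch \<and> \<sigma> r < 4 * length ts)"

definition ok_qff :: "nat list \<Rightarrow> (coef \<Rightarrow> int) \<Rightarrow> regs \<Rightarrow> apoly qff \<Rightarrow> bool" where
  "ok_qff ts cv \<sigma> \<phi> \<longleftrightarrow> (\<forall>P \<in> polys_qff \<phi>. \<forall>m \<in> set P. ok_mono ts cv \<sigma> m)"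

text \<open>The contract that both formats fulfil: a template is printed as the encoding of its
  instance, and all registers are restored.\<close>

definition printer :: "nat list \<Rightarrow> (coef \<Rightarrow> int) \<Rightarrow> (apoly \<Rightarrow> cmd) \<Rightarrow> ('p \<Rightarrow> nat list) \<Rightarrow> (apoly \<Rightarrow> 'p) \<Rightarrow> bool" where
  "printer ts cv PP e tr \<longleftrightarrow> (\<forall>\<sigma> P. clean \<sigma> \<longrightarrow> (\<forall>m \<in> set P. ok_mono ts cv \<sigma> m) \<longrightarrow>
     run (pad ts) (PP P) \<sigma> = (\<sigma>, to_bits (e (tr (inst \<sigma> P)))))"

lemma to_bits_node: "to_bits (t # xs @ ys) = to_bits [t] @ to_bits xs @ to_bits ys"
  by (simp add: to_bits_def)

lemma to_bits_15: "to_bits (15 # enc_int z @ xs) = to_bits [15] @ to_bits (enc_int z) @ to_bits xs"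
  "to_bits (15 # enc_int z) = to_bits [15] @ to_bits (enc_int z)"
  by (simp_all add: to_bits_def)

lemma run_PQ:
  assumes "printer ts cv PP e tr" "clean \<sigma>"
  shows "ok_qff ts cv \<sigma> \<phi> \<Longrightarrow> run (pad ts) (PQ PP \<phi>) \<sigma> = (\<sigma>, to_bits (enc_qff e (map_qff (\<lambda>P. tr (inst \<sigma> P)) \<phi>)))"
proof (induction \<phi>)
  case (Le p q)
  have "run (pad ts) (PP p) \<sigma> = (\<sigma>, to_bits (e (tr (inst \<sigma> p))))" "run (pad ts) (PP q) \<sigma> = (\<sigma>, to_bits (e (tr (inst \<sigma> q))))"
    using assms Le by (auto simp: printer_def ok_qff_def)
  then show ?case by (simp add: to_bits_node)
next
  case (And a b)
  then show ?case by (simp add: ok_qff_def to_bits_node ball_Un)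
next
  case (Or a b)
  then show ?case by (simp add: ok_qff_def to_bits_node ball_Un)
qed

lemma binnat_simps [simp]: "binnat 0 = []" "n > 0 \<Longrightarrow> binnat n = (n mod 2) # binnat (n div 2)"
  by (simp_all)

declare binnat.simps [simp del]

lemma run_PCoef:
  assumes "clean \<sigma>" "ok_coef ts cv \<sigma> c"
  shows "run (pad ts) (PCoef c) \<sigma> = (\<sigma>, to_bits (enc_int (cv (inst_coef \<sigma> c))))"
proof (cases c)
  case One
  have "enc_int 1 = [3, 1, 4]" by (simp add: enc_int_def)
  then show ?thesis using One assms to_bits_append[of "[3]" "[1, 4]"] to_bits_append[of "[1]" "[4]"] by simp
next
  case (Dig r)
  then show ?thesis using assms run_CopyD[OF assms(1), of r] by auto
next
  case (DigV r)
  then obtain k v where v: "r \<notin> scratch" "\<sigma> r = ps k" "digits_at ts k (enc_nat v)" "cv (DigV (\<sigma> r)) = int v"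
    using assms(2) by auto
  have "enc_int (int v) = [3] @ enc_nat v" by (simp add: enc_int_def enc_nat_def)
  then show ?thesis using DigV run_CopyD[OF assms(1) v(1-3)] v(2,4) to_bits_append[of "[3]" "enc_nat v"] by simp
qed

lemma run_zeros: "\<sigma> rI = 0 \<Longrightarrow> run (pad ts) (zeros b) \<sigma> = (\<sigma>, to_bits (replicate (b * (4 * length ts)) 0))"
proof -
  assume I: "\<sigma> rI = 0"
  have "concat (map (\<lambda>k. [0]) [0..<n]) = replicate n (0 :: nat)" for n
    by (induction n) (auto simp: replicate_append_same)
  then have l: "run (pad ts) (For rI (OutT 0)) \<sigma> = (\<sigma>, to_bits (replicate (4 * length ts) 0))"
    using run_For_out[of \<sigma> rI "pad ts" "OutT 0" "\<lambda>_. [0]"] I by simp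
  have "run (pad ts) (foldr (\<lambda>_. Seq (For rI (OutT 0))) js Skip) \<sigma> = (\<sigma>, to_bits (replicate (length js * (4 * length ts)) 0))" for js :: "nat list"
  proof (induction js)
    case (Cons j js)
    then show ?case by (simp add: l replicate_add)
  qed simp
  from this[of "[0..<b]"] show ?thesis by (simp add: zeros_def)
qed

lemma binnat_pow2: "binnat (2 ^ n) = replicate n 0 @ [1]"
  by (induction n) auto

lemma run_PVarT:
  assumes "clean \<sigma>" "r \<notin> scratch" "\<sigma> r < 4 * length ts"
  shows "run (pad ts) (PVarT b r) \<sigma> = (\<sigma>, to_bits (5 # enc_nat (2 ^ (b * (4 * length ts) + \<sigma> r))))"
proof -
  note I = cleanD[OF assms(1)]
  have r: "r \<noteq> rI" using assms(2) by (auto simp: scratch_def)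
  have "concat (map (\<lambda>k. if k < m then [0] else []) [0..<n]) = replicate (min m n) (0 :: nat)" for m n
  proof (induction n)
    case (Suc n)
    consider "m \<le> n" | "m = Suc n" | "Suc n < m" by linarith
    then show ?case using Suc by cases (auto simp: min_def replicate_append_same)
  qed simp
  then have "run (pad ts) (For rI (If (Less rI r) (OutT 0) Skip)) \<sigma> = (\<sigma>, to_bits (replicate (\<sigma> r) 0))"
    using run_For_out[of \<sigma> rI "pad ts" "If (Less rI r) (OutT 0) Skip" "\<lambda>k. if k < \<sigma> r then [0] else []"] I r assms(3) by simp
  moreover have "to_bits (5 # enc_nat (2 ^ (b * (4 * length ts) + \<sigma> r)))
     = to_bits [5] @ to_bits (replicate (b * (4 * length ts)) 0) @ to_bits (replicate (\<sigma> r) 0) @ to_bits [1] @ to_bits [4]"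
    unfolding to_bits_append[symmetric] enc_nat_def binnat_pow2 by (simp add: replicate_add)
  ultimately show ?thesis using run_zeros[of \<sigma> ts b] I by (simp add: PVarT_def)
qed

text \<open>In terms, variable indices are in binary, and powers of two are printed without arithmetic. In the
  standard encoding they are in unary and must stay polynomial.\<close>

definition iT :: "nat list \<Rightarrow> nat \<Rightarrow> nat \<Rightarrow> nat" where "iT ts b k = 2 ^ (b * (4 * length ts) + k)"
definition iS :: "nat list \<Rightarrow> nat \<Rightarrow> nat \<Rightarrow> nat" where "iS ts b k = b * (4 * length ts) + k"

lemma printer_T: "printer ts cv PPolyT enc_term (tr_term (iT ts) cv)"
  unfolding printer_def
proof (intro allI impI)
  fix \<sigma> P assume c: "clean \<sigma>" and ok: "\<forall>m \<in> set P. ok_mono ts cv \<sigma> m"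
  have mono: "run (pad ts) (PMonoT m) \<sigma> = (\<sigma>, to_bits (enc_term (tr_mono (iT ts) cv (inst_coef \<sigma> (fst m), map (\<lambda>(b, r). (b, \<sigma> r)) (snd m)))))"
    if m: "ok_mono ts cv \<sigma> m" for m
  proof -
    have "run (pad ts) (foldr (\<lambda>(b, r) c. Seq (OutT 8) (Seq (PVarT b r) c)) fs (Seq (OutT 6) (PCoef (fst m)))) \<sigma> =
      (\<sigma>, to_bits (enc_term (foldr (\<lambda>(b, k). Mul (Var (iT ts b k))) (map (\<lambda>(b, r). (b, \<sigma> r)) fs) (Const (cv (inst_coef \<sigma> (fst m)))))))"
      if "\<forall>(b, r) \<in> set fs. b < 7 \<and> r \<notin> scratch \<and> \<sigma> r < 4 * length ts" for fs
      using that
    proof (induction fs)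
      case Nil
      then show ?case using m run_PCoef[OF c, of ts cv "fst m"] to_bits_append[of "[6]" "enc_int (cv (inst_coef \<sigma> (fst m)))"]
        by (simp add: ok_mono_def)
    next
      case (Cons f fs)
      obtain b r where f: "f = (b, r)" by fastforce
      have "run (pad ts) (PVarT b r) \<sigma> = (\<sigma>, to_bits (5 # enc_nat (iT ts b (\<sigma> r))))"
        using run_PVarT[OF c] Cons.prems f by (simp add: iT_def)
      moreover have "to_bits (8 # 5 # xs @ ys) = to_bits [8] @ to_bits (5 # xs) @ to_bits ys" for xs ys
        unfolding to_bits_append[symmetric] by simp
      ultimately show ?case using Cons f by (simp del: to_bits_append)
    qed
    from this[of "snd m"] show ?thesis using m by (simp add: PMonoT_def tr_mono_def ok_mono_def)
  qed
  show "run (pad ts) (PPolyT P) \<sigma> = (\<sigma>, to_bits (enc_term (tr_term (iT ts) cv (inst \<sigma> P))))"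
    using ok
  proof (induction P)
    case Nil
    have "enc_int 0 = [3, 4]" by (simp add: enc_int_def)
    then show ?case using to_bits_append[of "[6]" "[3, 4]"] to_bits_append[of "[3]" "[4]"]
      by (simp add: PPolyT_def tr_term_def inst_def)
  next
    case (Cons m P)
    have "to_bits (7 # xs @ ys) = to_bits [7] @ to_bits xs @ to_bits ys" for xs ys
      unfolding to_bits_append[symmetric] by simp
    then show ?case using Cons mono[of m]
      by (simp add: PPolyT_def tr_term_def inst_def case_prod_unfold del: to_bits_append)
  qed
qed

lemma printer_S: "printer ts cv PPolyS enc_std (tr_std (iS ts) (7 * (4 * length ts)) cv)"
  unfolding printer_def
proof (intro allI impI)
  fix \<sigma> P assume c: "clean \<sigma>" and ok: "\<forall>m \<in> set P. ok_mono ts cv \<sigma> m"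
  note I = cleanD[OF c]
  let ?N = "4 * length ts" and ?f = "\<lambda>fs. map (\<lambda>(b, r). (b, \<sigma> r)) fs"
  let ?em = "\<lambda>\<alpha> c. [14] @ concat (map (\<lambda>k. replicate k 13 @ [12]) \<alpha>) @ [15] @ enc_int c"
  have mono: "run (pad ts) (PMonoS m) \<sigma> = (\<sigma>, to_bits (?em (expo (iS ts) (7 * ?N) (?f (snd m))) (cv (inst_coef \<sigma> (fst m)))))"
    if m: "ok_mono ts cv \<sigma> m" for m
  proof -
    define fs where "fs = snd m"
    have ok: "\<forall>(b, r) \<in> set fs. b < 7 \<and> r \<notin> scratch \<and> \<sigma> r < ?N" using m by (simp add: ok_mono_def fs_def)
    let ?cnt = "\<lambda>fs i. length (filter (\<lambda>(b, k). iS ts b k = i) (?f fs))"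
    have 1: "run (pad ts) (marks fs b) (\<sigma>(rI := k)) = (\<sigma>(rI := k), to_bits (replicate (?cnt fs (b * ?N + k)) 13 @ [12]))"
      if "k < ?N" "\<forall>(b, r) \<in> set fs. b < 7 \<and> r \<notin> scratch \<and> \<sigma> r < ?N" for b k fs
      using that(2)
    proof (induction fs)
      case (Cons f fs)
      obtain b' r where f: "f = (b', r)" by fastforce
      have r: "r \<noteq> rI" "\<sigma> r < ?N" using Cons.prems f by (auto simp: scratch_def)
      have "iS ts b' (\<sigma> r) = b * ?N + k \<longleftrightarrow> b' = b \<and> \<sigma> r = k"
      proof
        assume e: "iS ts b' (\<sigma> r) = b * ?N + k"
        have dv: "(c * n + x) div n = c" if "x < n" for c n x :: nat
          using that div_mult_self1[of n x c] by (simp add: add.commute)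
        have "b' = (b' * ?N + \<sigma> r) div ?N" "b = (b * ?N + k) div ?N" using dv r(2) that(1) by presburger+
        then have "b' = b" using e unfolding iS_def by metis
        then show "b' = b \<and> \<sigma> r = k" using e by (simp add: iS_def)
      qed (simp add: iS_def)
      moreover have "to_bits (13 # replicate n 13) = to_bits [13] @ to_bits (replicate n 13)" for n
        by (simp add: to_bits_def)
      ultimately show ?case using Cons f r by (auto simp: marks_def to_bits_node)
    qed (simp add: marks_def)
    have 2: "run (pad ts) (For rI (marks fs b)) \<sigma> = (\<sigma>, to_bits (concat (map (\<lambda>k. replicate (?cnt fs (b * ?N + k)) 13 @ [12]) [0..<?N])))" for b
      using run_For_out[of \<sigma> rI "pad ts" "marks fs b"] 1[OF _ ok] I by simp
    have up: "map (\<lambda>k. h (b * n + k)) [0..<n] = map h [b * n..<Suc b * n]" for h :: "nat \<Rightarrow> nat list" and b n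
      by (rule nth_equalityI) auto
    \<comment> \<open>Stated for any stretch of blocks, since the fold over the blocks is unrolled
      from the front.\<close>
    have 3: "run (pad ts) (foldr (\<lambda>b. Seq (For rI (marks fs b))) [l..<l + d] Skip) \<sigma> =
       (\<sigma>, to_bits (concat (map (\<lambda>i. replicate (?cnt fs i) 13 @ [12]) [l * ?N..<(l + d) * ?N])))" for l d
    proof (induction d arbitrary: l)
      case (Suc d)
      have u: "[l..<l + Suc d] = l # [Suc l..<Suc l + d]" by (simp add: upt_conv_Cons del: upt_Suc)
      have v: "[l * ?N..<(l + Suc d) * ?N] = [l * ?N..<Suc l * ?N] @ [Suc l * ?N..<(Suc l + d) * ?N]"
        using upt_add_eq_append[of "l * ?N" "Suc l * ?N" "d * ?N"] by (simp add: algebra_simps)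
      show ?case
        unfolding u v map_append concat_append to_bits_append
        using 2[of l] Suc.IH[of "Suc l"] up[of "\<lambda>i. replicate (?cnt fs i) 13 @ [12]" l ?N] by simp
    qed simp
    have "run (pad ts) (foldr (\<lambda>b. Seq (For rI (marks fs b))) [0..<7] Skip) \<sigma> =
       (\<sigma>, to_bits (concat (map (\<lambda>k. replicate k 13 @ [12]) (expo (iS ts) (7 * ?N) (?f fs)))))"
      using 3[of 0 7] by (simp add: expo_def comp_def)
    then show ?thesis using m run_PCoef[OF c, of ts cv "fst m"]
      by (simp add: PMonoS_def ok_mono_def fs_def[symmetric] to_bits_node to_bits_15)
  qed
  have "run (pad ts) (foldr (\<lambda>m. Seq (PMonoS m)) P (OutT 15)) \<sigma> =
      (\<sigma>, to_bits (concat (map (\<lambda>(\<alpha>, c). ?em \<alpha> c) (tr_std (iS ts) (7 * ?N) cv (inst \<sigma> P))) @ [15]))"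
    using ok
  proof (induction P)
    case (Cons m P)
    then show ?case using mono[of m] by (simp add: tr_std_def inst_def case_prod_unfold to_bits_node to_bits_15)
  qed (simp add: tr_std_def inst_def)
  then show "run (pad ts) (PPolyS P) \<sigma> = (\<sigma>, to_bits (enc_std (tr_std (iS ts) (7 * ?N) cv (inst \<sigma> P))))"
    by (simp add: PPolyS_def enc_std_def to_bits_node)
qed

text \<open>Printing touches only these three registers, so it may be nested in loops over
  \<open>rT\<close> and \<open>rU\<close>.\<close>

definition wfout :: "cmd \<Rightarrow> bool" where "wfout c \<longleftrightarrow> wfc c \<and> mods c \<subseteq> {rI, rJ, rF}"

lemma wfout_Seq: "wfout c \<Longrightarrow> wfout d \<Longrightarrow> wfout (Seq c d)"
  and wfout_OutT: "wfout (OutT t)"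
  and wfout_Skip: "wfout Skip"
  by (auto simp: wfout_def)

lemma wfout_PCoef: "wfout (PCoef c)"
  by (cases c) (auto simp: wfout_def CopyD_def copy_body_def)

lemma wfout_PPolyT: "wfout (PPolyT P)"
proof -
  have z: "wfout (zeros b)" for b
  proof -
    have "wfout (foldr (\<lambda>_. Seq (For rI (OutT 0))) js Skip)" for js :: "nat list"
      by (induction js) (auto simp: wfout_def)
    then show ?thesis by (simp add: zeros_def)
  qed
  have v: "wfout (PVarT b r)" for b r
    unfolding PVarT_def by (intro wfout_Seq wfout_OutT z) (simp add: wfout_def)
  have "wfout (PMonoT m)" for m
  proof -
    have "wfout (foldr (\<lambda>(b, r) c. Seq (OutT 8) (Seq (PVarT b r) c)) fs (Seq (OutT 6) (PCoef (fst m))))" for fs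
      by (induction fs) (auto intro!: wfout_Seq wfout_OutT v wfout_PCoef)
    then show ?thesis by (simp add: PMonoT_def)
  qed
  then show ?thesis
    unfolding PPolyT_def by (induction P) (auto intro!: wfout_Seq wfout_OutT)
qed

lemma wfout_PPolyS: "wfout (PPolyS P)"
proof -
  have "wfc (marks fs b) \<and> mods (marks fs b) = {}" for fs b
    unfolding marks_def by (induction fs) (auto simp: case_prod_unfold)
  then have m: "wfout (For rI (marks fs b))" for fs b by (simp add: wfout_def)
  have "wfout (PMonoS m)" for m
  proof -
    have "wfout (foldr (\<lambda>b. Seq (For rI (marks fs b))) js Skip)" for fs js
      by (induction js) (auto intro!: wfout_Seq wfout_Skip m)
    then show ?thesis unfolding PMonoS_def by (intro wfout_Seq wfout_OutT wfout_PCoef)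
  qed
  then have "wfout (foldr (\<lambda>m. Seq (PMonoS m)) P (OutT 15))"
    by (induction P) (auto intro!: wfout_Seq wfout_OutT)
  then show ?thesis unfolding PPolyS_def by (intro wfout_Seq wfout_OutT)
qed

lemma wfout_PQ: "(\<And>P. wfout (PP P)) \<Longrightarrow> wfout (PQ PP \<phi>)"
  by (induction \<phi>) (auto intro!: wfout_Seq wfout_OutT)

section \<open>The reduction\<close>

text \<open>Halving by counting up to \<open>rN\<close>: \<open>rD\<close> keeps the parity and
  \<open>rC\<close> the number of completed pairs.\<close>

definition half_step :: cmd where
  "half_step = If (Less rI rN) (If (Neq rD rZ) (Seq (Inc rC) (Zero rD)) (Inc rD)) Skip"

definition bin_step :: cmd where
  "bin_step = If (Neq rN rZ)
     (Seq (For rI half_step) (Seq (If (Neq rD rZ) (OutT 1) (OutT 0)) (Seq (Copy rN rC) (Seq (Zero rC) (Zero rD))))) Skip"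

text \<open>The only arithmetic in the program: the number of cells of the input, printed in binary
  by repeated halving with the lowest digit first.\<close>

definition PBin :: cmd where
  "PBin = Seq (For rI (Inc rN)) (Seq (For rJ bin_step) (Zero rN))"

definition base :: "regs \<Rightarrow> bool" where
  "base \<sigma> \<longleftrightarrow> clean \<sigma> \<and> \<sigma> rT = 0 \<and> \<sigma> rU = 0 \<and> \<sigma> rA = 0 \<and> \<sigma> rB = 0 \<and> \<sigma> rN = 0 \<and> \<sigma> rC = 0 \<and> \<sigma> rD = 0 \<and> \<sigma> rM = 3"

lemma run_half:
  assumes "\<sigma> rZ = 0" "\<sigma> rI = 0" "\<sigma> rC = 0" "\<sigma> rD = 0" "\<sigma> rN \<le> length W"
  shows "run W (For rI half_step) \<sigma> = (\<sigma>(rC := \<sigma> rN div 2, rD := \<sigma> rN mod 2), [])"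
proof -
  let ?v = "\<sigma> rN"
  let ?s = "\<lambda>c. \<sigma>(rC := c div 2, rD := c mod 2)"
  have "fl (run W half_step) rI [0..<i] \<sigma> (?s (min i ?v)) []" for i
  proof (induction i)
    case 0
    show ?case unfolding upt.simps(1) by (rule fl_cong[OF fl_Nil]) (use assms in \<open>auto simp: fun_eq_iff\<close>)
  next
    case (Suc i)
    have "fl (run W half_step) rI [i] (?s (min i ?v)) (?s (min (Suc i) ?v)) []"
    proof (cases "i < ?v")
      case True
      have 1: "(Suc i) div 2 = i div 2 + i mod 2" "Suc i mod 2 = 1 - i mod 2" by presburger+
      have "run W half_step ((?s i)(rI := i)) = ((?s (Suc i))(rI := i), [])"
      proof (cases "i mod 2 = 0")
        case True
        then have "run W half_step ((?s i)(rI := i)) = (((?s i)(rI := i))(rD := 1), [])"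
          using assms \<open>i < ?v\<close> by (simp add: half_step_def)
        moreover have "((?s i)(rI := i))(rD := 1) = (?s (Suc i))(rI := i)" using 1 True by (intro ext) simp
        ultimately show ?thesis by simp
      next
        case False
        then have "run W half_step ((?s i)(rI := i)) = (((?s i)(rI := i))(rC := Suc (i div 2), rD := 0), [])"
          using assms \<open>i < ?v\<close> by (simp add: half_step_def)
        moreover have "((?s i)(rI := i))(rC := Suc (i div 2), rD := 0) = (?s (Suc i))(rI := i)"
          using 1 False by (intro ext) simp
        ultimately show ?thesis by simp
      qed
      then have "fl (run W half_step) rI [i] (?s i) ((?s (Suc i))(rI := i)) []" by (rule fl_single)
      then have "fl (run W half_step) rI [i] (?s i) (?s (Suc i)) []" by (rule fl_cong) simp_all
      then show ?thesis using True by (simp add: min_def)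
    next
      case False
      have "run W half_step ((?s ?v)(rI := i)) = ((?s ?v)(rI := i), [])"
        using False by (simp add: half_step_def)
      then have "fl (run W half_step) rI [i] (?s ?v) ((?s ?v)(rI := i)) []" by (rule fl_single)
      then have "fl (run W half_step) rI [i] (?s ?v) (?s ?v) []" by (rule fl_cong) simp_all
      moreover have "min i ?v = ?v" "min (Suc i) ?v = ?v" using False by simp_all
      ultimately show ?thesis by (simp only:)
    qed
    from fl_append[OF Suc this] show ?case unfolding upt_Suc_append[OF le0] append_Nil .
  qed
  moreover have "min (length W) ?v = ?v" using assms by simp
  ultimately have "fl (run W half_step) rI [0..<length W] \<sigma> (?s ?v) []" by metis
  from run_For[OF this] show ?thesis using assms by (simp add: fun_upd_idem)
qed

lemma run_PBin:
  assumes b: "base \<sigma>"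
  shows "run W PBin \<sigma> = (\<sigma>, to_bits (binnat (length W)))"
proof -
  have z: "\<sigma> rZ = 0" "\<sigma> rI = 0" "\<sigma> rJ = 0" "\<sigma> rN = 0" "\<sigma> rC = 0" "\<sigma> rD = 0"
    using b cleanD unfolding base_def by auto
  have "fl (run W (Inc rN)) rI [0..<i] \<sigma> (\<sigma>(rN := i)) []" for i
  proof (induction i)
    case 0
    show ?case unfolding upt.simps(1) by (rule fl_cong[OF fl_Nil]) (use z in \<open>auto simp: fun_eq_iff\<close>)
  next
    case (Suc i)
    have "fl (run W (Inc rN)) rI [i] (\<sigma>(rN := i)) ((\<sigma>(rN := i))(rI := i, rN := Suc i)) []"
      by (rule fl_single) simp
    then have "fl (run W (Inc rN)) rI [i] (\<sigma>(rN := i)) (\<sigma>(rN := Suc i)) []" by (rule fl_cong) auto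
    from fl_append[OF Suc this] show ?case unfolding upt_Suc_append[OF le0] append_Nil .
  qed
  from run_For[OF this[of "length W"]]
  have 1: "run W (For rI (Inc rN)) \<sigma> = (\<sigma>(rN := length W), [])" using z by (simp add: fun_upd_idem)
  have st: "run W bin_step (\<sigma>(rN := v, rJ := k)) = (\<sigma>(rN := v div 2, rJ := k), to_bits (if v = 0 then [] else [v mod 2]))"
    if "v \<le> length W" for v k
  proof (cases "v = 0")
    case False
    let ?\<tau> = "\<sigma>(rN := v, rJ := k)"
    have h: "run W (For rI half_step) ?\<tau> = (?\<tau>(rC := v div 2, rD := v mod 2), [])"
      using run_half[of ?\<tau> W] z that by simp
    have e: "(?\<tau>(rC := v div 2, rD := v mod 2))(rN := v div 2, rC := 0, rD := 0) = \<sigma>(rN := v div 2, rJ := k)"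
      using z by (intro ext) simp
    have "run W bin_step ?\<tau> = ((?\<tau>(rC := v div 2, rD := v mod 2))(rN := v div 2, rC := 0, rD := 0), to_bits [v mod 2])"
      using False z by (auto simp: bin_step_def h mod_2_eq_odd)
    then show ?thesis using False unfolding e by simp
  next
    case True
    then show ?thesis using z by (simp add: bin_step_def)
  qed
  \<comment> \<open>The outer loop merely repeats; iterations after \<open>v\<close> has reached 0
    are idle. As many iterations as there are cells suffice, because a number is less than two to
    its own power.\<close>
  have "fl (run W bin_step) rJ js (\<sigma>(rN := v)) (\<sigma>(rN := 0)) (to_bits (binnat v))"
    if "v < 2 ^ length js" "v \<le> length W" for js v
    using that
  proof (induction js arbitrary: v)
    case Nil
    then show ?case using fl_Nil by simp
  next
    case (Cons j js)
    have "fl (run W bin_step) rJ js (\<sigma>(rN := v div 2)) (\<sigma>(rN := 0)) (to_bits (binnat (v div 2)))"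
      by (rule Cons.IH) (use Cons.prems in auto)
    then have "fl (run W bin_step) rJ js (\<sigma>(rN := v div 2, rJ := j)) (\<sigma>(rN := 0)) (to_bits (binnat (v div 2)))"
      by (rule fl_start) simp
    note c = fl_Cons[of "run W bin_step", OF st[OF Cons.prems(2)] this]
    have e: "to_bits (if v = 0 then [] else [v mod 2]) @ to_bits (binnat (v div 2)) = to_bits (binnat v)"
      by (cases "v = 0") (simp_all add: to_bits_append[symmetric] del: to_bits_append)
    show ?case using c unfolding e .
  qed
  from this[of "length W" "[0..<length W]"]
  have "fl (run W bin_step) rJ [0..<length W] (\<sigma>(rN := length W)) (\<sigma>(rN := 0)) (to_bits (binnat (length W)))" by simp
  from run_For[OF this] show ?thesis using z 1 by (simp add: PBin_def fun_upd_idem fun_upd_twist)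
qed

text \<open>The numbers of variables are powers of two as well and are printed by zeros and a final
  one.\<close>

definition HeadT :: cmd where
  "HeadT = Seq (zeros 1) (Seq (OutT 1) (Seq (OutT 4) (Seq (zeros 7) (Seq (OutT 1) (OutT 4)))))"

text \<open>Three leading zero digits multiply by 8, and 8 times the number of cells leaves room for
  the six universal blocks.\<close>

definition HeadS :: cmd where
  "HeadS = Seq PBin (Seq (OutT 4) (Seq (OutT 0) (Seq (OutT 0) (Seq (OutT 0) (Seq PBin (OutT 4))))))"

lemma run_HeadT:
  assumes "base \<sigma>"
  shows "run (pad ts) HeadT \<sigma> = (\<sigma>, to_bits (enc_nat (2 ^ (4 * length ts)) @ enc_nat (2 ^ (7 * (4 * length ts)))))"
proof -
  have "\<sigma> rI = 0" using assms cleanD unfolding base_def by auto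
  moreover have "to_bits (enc_nat (2 ^ n)) = to_bits (replicate n 0) @ to_bits [1] @ to_bits [4]" for n
    unfolding enc_nat_def binnat_pow2 to_bits_append append_assoc ..
  ultimately show ?thesis using run_zeros[of \<sigma> ts] by (simp add: HeadT_def)
qed

lemma run_HeadS:
  assumes "base \<sigma>" "ts \<noteq> []"
  shows "run (pad ts) HeadS \<sigma> = (\<sigma>, to_bits (enc_nat (4 * length ts) @ enc_nat (8 * (4 * length ts))))"
proof -
  have "binnat (8 * n) = [0, 0, 0] @ binnat n" if "n > 0" for n using that by simp
  then have e: "to_bits (enc_nat (8 * (4 * length ts))) = to_bits [0] @ to_bits [0] @ to_bits [0] @ to_bits (binnat (4 * length ts)) @ to_bits [4]"
    using assms(2) unfolding to_bits_append[symmetric] enc_nat_def by (simp del: to_bits_append)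
  show ?thesis unfolding to_bits_append e using run_PBin[OF assms(1), of "pad ts"] by (simp add: HeadS_def enc_nat_def)
qed

section \<open>Assembling the program\<close>

definition emit :: "(apoly \<Rightarrow> cmd) \<Rightarrow> nat \<Rightarrow> apoly qff \<Rightarrow> cmd" where
  "emit PP op \<phi> = Seq (OutT op) (PQ PP \<phi>)"

definition Leaves :: "cmd \<Rightarrow> cmd" where "Leaves c = For rU (If (Tok rU {5}) c Skip)"

text \<open>The first child starts one token, that is four cells, behind the node; the second starts
  where the subtree of the first ends.\<close>

definition Children :: "cmd \<Rightarrow> cmd" where
  "Children c = Seq (Copy rA rT) (Seq (Inc rA) (Seq (Inc rA) (Seq (Inc rA) (Seq (Inc rA)
     (Seq (FindB rT) (Seq c (Seq (Zero rA) (Zero rB))))))))"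

definition Links :: "(apoly \<Rightarrow> cmd) \<Rightarrow> nat \<Rightarrow> cmd" where
  "Links PP b = For rT (If (Tok rT {5}) (Leaves (emit PP 10 (f_link b rT rU))) Skip)"

definition FNodes :: "(apoly \<Rightarrow> cmd) \<Rightarrow> cmd" where
  "FNodes PP = For rT
     (If (Tok rT {5}) (Seq (emit PP 11 (f_pos rT)) (Leaves (emit PP 11 (f_var rM rT rU))))
     (If (Tok rT {6}) (Seq (emit PP 11 (f_pos rT)) (emit PP 11 (f_const rT)))
     (If (Tok rT {7}) (Children (Seq (emit PP 11 (f_pos rT)) (emit PP 11 (f_add rT rA rB))))
     (If (Tok rT {8}) (Children (Seq (emit PP 11 (f_pos rT)) (emit PP 11 (f_mul rT rA rB)))) Skip))))"

definition ENodes :: "(apoly \<Rightarrow> cmd) \<Rightarrow> cmd" where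
  "ENodes PP = For rT
     (If (Tok rT {5}) (Seq (emit PP 10 (e_unit rT)) (emit PP 10 (e_var rT)))
     (If (Tok rT {6}) (Seq (emit PP 10 (e_unit rT)) (emit PP 10 (e_const rT)))
     (If (Tok rT {7}) (Children (Seq (emit PP 10 (e_unit rT)) (emit PP 10 (e_add rT rA rB))))
     (If (Tok rT {8}) (Children (Seq (emit PP 10 (e_unit rT)) (emit PP 10 (e_mul rT rA rB)))) Skip))))"

text \<open>The skeleton of the output has its connectives in the same prefix order as the input, so
  one pass over the tokens prints it without recursion.\<close>

definition skel_body :: "(apoly \<Rightarrow> cmd) \<Rightarrow> (nat \<Rightarrow> nat \<Rightarrow> apoly qff) \<Rightarrow> cmd" where
  "skel_body PP mk = If (Tok rT {10}) (OutT 10) (If (Tok rT {11}) (OutT 11)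
     (If (Tok rT {9}) (Children (PQ PP (mk rA rB))) Skip))"

definition setM :: cmd where "setM = Seq (Inc rM) (Seq (Inc rM) (Inc rM))"

text \<open>In the third class the end of \<Psi> is located once and kept in \<open>rH\<close>;
  comparison with it selects the half of the input whose skeleton is printed.\<close>

fun Prog :: "sclass \<Rightarrow> cmd \<Rightarrow> (apoly \<Rightarrow> cmd) \<Rightarrow> cmd" where
  "Prog Sigma2 hdr PP = Seq setM (Seq (OutT 0) (Seq hdr (Seq (Links PP 0) (Seq (FNodes PP) (For rT (skel_body PP f_atom))))))"
| "Prog BSigma2 hdr PP = Seq setM (Seq (OutT 1) (Seq hdr (Seq (Links PP 0) (Seq (FNodes PP) (For rT (skel_body PP f_atom))))))"
| "Prog BSigma2pp hdr PP = Seq setM (Seq (FindB rM) (Seq (Copy rH rB) (Seq (Zero rB) (Seq (OutT 2) (Seq hdr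
     (Seq (Links PP 1) (Seq (ENodes PP) (Seq (For rT (If (Less rT rH) (skel_body PP e_atom) Skip))
     (Seq (Links PP 0) (Seq (FNodes PP) (For rT (If (Less rT rH) Skip (skel_body PP f_atom)))))))))))))"

lemma wfc_Prog:
  assumes PP: "\<And>P. wfout (PP P)" and hdr: "wfc hdr"
  shows "wfc (Prog C hdr PP)"
proof -
  have p: "wfc (PQ PP \<phi>)" "mods (PQ PP \<phi>) \<subseteq> {rI, rJ, rF}" for \<phi>
    using wfout_PQ[of PP \<phi>] PP by (auto simp: wfout_def)
  have nm: "r \<notin> mods (PQ PP \<phi>)" if "r \<in> {rT, rU}" for r \<phi> using p(2)[of \<phi>] that by auto
  have fb: "wfc (FindB r)" "mods (FindB r) = {rJ, rB, rF, rP, rQ}" for r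
    by (auto simp: FindB_def find_body_def)
  have ch: "wfc (Children c)" "rT \<notin> mods (Children c)" if "wfc c" "rT \<notin> mods c" for c
    using that by (auto simp: Children_def fb)
  have l: "wfc (Links PP b)" for b by (simp add: Links_def Leaves_def emit_def p nm)
  have f: "wfc (FNodes PP)" by (simp add: FNodes_def Leaves_def emit_def p nm ch)
  have e: "wfc (ENodes PP)" by (simp add: ENodes_def Leaves_def emit_def p nm ch)
  have s: "wfc (skel_body PP mk)" "rT \<notin> mods (skel_body PP mk)" for mk
    by (auto simp: skel_body_def p nm ch)
  show ?thesis by (cases C) (auto simp: setM_def hdr l f e s fb)
qed

lemma wfc_HeadT: "wfc HeadT"
proof -
  have "wfc (foldr (\<lambda>_. Seq (For rI (OutT 0))) js Skip)" for js :: "nat list"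
    by (induction js) auto
  then show ?thesis by (simp add: HeadT_def zeros_def del: upt.simps foldr.simps)
qed

lemma wfc_HeadS: "wfc HeadS"
  by (auto simp: HeadS_def PBin_def bin_step_def half_step_def)

section \<open>Encoded terms and formulas as trees\<close>

lemma set_binnat: "set (binnat n) \<subseteq> {0, 1}"
proof (induction n rule: less_induct)
  case (less n)
  then show ?case using less.IH[of "n div 2"] by (cases "n = 0") auto
qed

lemma set_enc_int: "set (enc_int c) \<subseteq> {0..4}"
  using set_binnat[of "nat \<bar>c\<bar>"] by (auto simp: enc_int_def)

lemma set_enc_nat: "set (enc_nat c) \<subseteq> {0..4}"
  using set_binnat[of c] by (auto simp: enc_nat_def)

lemma tree_term: "tree (enc_term t)"
proof (induction t)
  case (Var i) then show ?case unfolding enc_term.simps by (intro tree.leaf set_enc_nat) simp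
next
  case (Const c) then show ?case unfolding enc_term.simps by (intro tree.leaf set_enc_int) simp
next
  case (Add a b) then show ?case unfolding enc_term.simps by (intro tree.node) auto
next
  case (Mul a b) then show ?case unfolding enc_term.simps by (intro tree.node) auto
qed

lemma tree_qff: "tree (enc_qff enc_term \<phi>)"
proof (induction \<phi>)
  case (Le a b) then show ?case unfolding enc_qff.simps by (intro tree.node tree_term) auto
next
  case (And a b) then show ?case unfolding enc_qff.simps by (intro tree.node) auto
next
  case (Or a b) then show ?case unfolding enc_qff.simps by (intro tree.node) auto
qed

lemma occ_head:
  "occ ts k (enc_term t) \<Longrightarrow> k < length ts \<and> ts ! k \<in> {5..8}"
  "occ ts k (enc_qff enc_term \<phi>) \<Longrightarrow> k < length ts \<and> ts ! k \<in> {9..11}"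
  by (cases t; auto simp: occ_Cons) (cases \<phi>; auto simp: occ_Cons)

lemma occ_nth: "occ ts a xs \<Longrightarrow> a \<le> k \<Longrightarrow> k < a + length xs \<Longrightarrow> k < length ts \<and> ts ! k = xs ! (k - a)"
  unfolding occ_def by (metis add_diff_inverse_nat nat_add_left_cancel_less not_less order_less_le_trans)

lemma digits_enc:
  "occ ts k (x # enc_nat v) \<Longrightarrow> digits_at ts k (enc_nat v)"
  "occ ts k (x # enc_int c) \<Longrightarrow> digits_at ts k (enc_int c)"
proof -
  have d: "digits_at ts k (ds @ [4])" if o: "occ ts k (x # ds @ [4])" and ds: "set ds \<subseteq> {0..3}" for ds
  proof -
    have o': "k < length ts" "occ ts (Suc k) (ds @ [4])" using o by (auto simp: occ_Cons)
    have "take (length (ds @ [4])) (drop (Suc k) ts) = ds @ [4]"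
      by (rule nth_equalityI) (use o'(2) in \<open>auto simp: occ_def\<close>)
    then have "drop (Suc k) ts = (ds @ [4]) @ drop (length (ds @ [4])) (drop (Suc k) ts)"
      by (metis append_take_drop_id)
    then show ?thesis using o'(1) ds unfolding digits_at_def by auto
  qed
  have b: "set (binnat n) \<subseteq> {0..3}" for n
    by (rule subset_trans[OF set_binnat]) simp
  show "occ ts k (x # enc_nat v) \<Longrightarrow> digits_at ts k (enc_nat v)"
    unfolding enc_nat_def by (rule d[OF _ b])
  have e: "enc_int c = ((if c < 0 then [2] else [3]) @ binnat (nat \<bar>c\<bar>)) @ [4]" by (simp add: enc_int_def)
  show "occ ts k (x # enc_int c) \<Longrightarrow> digits_at ts k (enc_int c)"
    unfolding e by (rule d) (use b in simp_all)
qed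

lemma ps_Suc: "ps k + 4 = ps (Suc k)" by (simp add: ps_def)

lemma second_ps: "second (ps k) t = ps (Suc k + length (enc_term t))"
  "second_qff (ps k) a = ps (Suc k + length (enc_qff enc_term a))"
  by (simp_all add: second_def second_qff_def ps_def)

lemma upt_split3: "a \<le> b \<Longrightarrow> b \<le> c \<Longrightarrow> [a..<c] = [a..<b] @ [b..<c]"
  by (metis le_add_diff_inverse upt_add_eq_append)

lemma upt_split_node:
  "map ps [a..<a + length (x # xs @ ys)] =
    map ps [a] @ map ps [Suc a..<Suc a + length xs] @ map ps [Suc a + length xs..<Suc a + length xs + length ys]"
  using upt_split3[of "Suc a" "Suc a + length xs" "Suc a + length xs + length ys"]
  by (simp add: upt_conv_Cons add.assoc del: upt_Suc)

lemma fl_tok: "F (\<sigma>(i := ps k)) = (\<sigma>(i := ps k), out) \<Longrightarrow> fl F i (map ps [k]) \<sigma> \<sigma> out"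
  using fl_single[of F \<sigma> i "ps k"] by (auto elim!: fl_cong)

text \<open>\<open>nodes\<close> lists subterms in the order of their head tokens, so a loop over
  the tokens meets them in this order and passes silently over the digits.\<close>

lemma nodes_fl:
  assumes out: "\<And>k u. occ ts k (enc_term u) \<Longrightarrow> (ps k, u) \<in> ns \<Longrightarrow> F (\<sigma>(i := ps k)) = (\<sigma>(i := ps k), out (ps k, u))"
    and nop: "\<And>k. k < length ts \<Longrightarrow> ts ! k \<notin> {5..8} \<Longrightarrow> F (\<sigma>(i := ps k)) = (\<sigma>(i := ps k), [])"
  shows "occ ts a (enc_term t) \<Longrightarrow> set (nodes (ps a) t) \<subseteq> ns \<Longrightarrow>
    fl F i (map ps [a..<a + length (enc_term t)]) \<sigma> \<sigma> (concat (map out (nodes (ps a) t)))"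
proof (induction t arbitrary: a)
  case (Var j)
  have 1: "fl F i (map ps [a]) \<sigma> \<sigma> (out (ps a, Var j))"
    by (rule fl_tok, rule out) (use Var in auto)
  have 2: "fl F i (map ps [Suc a..<Suc a + length (enc_nat j)]) \<sigma> \<sigma> []"
  proof (rule fl_silent)
    fix p assume "p \<in> set (map ps [Suc a..<Suc a + length (enc_nat j)])"
    then obtain k where k: "p = ps k" "Suc a \<le> k" "k < Suc a + length (enc_nat j)" by auto
    have o: "occ ts (Suc a) (enc_nat j)" using Var.prems(1) by (simp add: occ_Cons)
    have "k < length ts" "ts ! k \<in> set (enc_nat j)" using occ_nth[OF o k(2,3)] k by auto
    then show "F (\<sigma>(i := p)) = (\<sigma>(i := p), [])" using nop[of k] k(1) set_enc_nat[of j] by auto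
  qed
  have "map ps [a..<a + length (enc_term (Var j))] = map ps [a] @ map ps [Suc a..<Suc a + length (enc_nat j)]"
    by (simp add: upt_conv_Cons del: upt_Suc)
  then show ?case using fl_append[OF 1 2] by (simp del: upt_Suc)
next
  case (Const c)
  have 1: "fl F i (map ps [a]) \<sigma> \<sigma> (out (ps a, Const c))"
    by (rule fl_tok, rule out) (use Const in auto)
  have 2: "fl F i (map ps [Suc a..<Suc a + length (enc_int c)]) \<sigma> \<sigma> []"
  proof (rule fl_silent)
    fix p assume "p \<in> set (map ps [Suc a..<Suc a + length (enc_int c)])"
    then obtain k where k: "p = ps k" "Suc a \<le> k" "k < Suc a + length (enc_int c)" by auto
    have o: "occ ts (Suc a) (enc_int c)" using Const.prems(1) by (simp add: occ_Cons)
    have "k < length ts" "ts ! k \<in> set (enc_int c)" using occ_nth[OF o k(2,3)] k by auto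
    then show "F (\<sigma>(i := p)) = (\<sigma>(i := p), [])" using nop[of k] k(1) set_enc_int[of c] by auto
  qed
  have "map ps [a..<a + length (enc_term (Const c))] = map ps [a] @ map ps [Suc a..<Suc a + length (enc_int c)]"
    by (simp add: upt_conv_Cons del: upt_Suc)
  then show ?case using fl_append[OF 1 2] by (simp del: upt_Suc)
next
  case (Add u v)
  have 1: "fl F i (map ps [a]) \<sigma> \<sigma> (out (ps a, Add u v))"
    by (rule fl_tok, rule out[OF Add.prems(1)]) (use Add.prems in auto)
  have 2: "fl F i (map ps [Suc a..<Suc a + length (enc_term u)]) \<sigma> \<sigma> (concat (map out (nodes (ps (Suc a)) u)))"
    using Add.prems by (intro Add.IH(1)) (auto simp: occ_Cons occ_append ps_Suc)
  have 3: "fl F i (map ps [Suc a + length (enc_term u)..<Suc a + length (enc_term u) + length (enc_term v)]) \<sigma> \<sigma>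
     (concat (map out (nodes (ps (Suc a + length (enc_term u))) v)))"
    using Add.prems by (intro Add.IH(2)) (auto simp: occ_Cons occ_append second_ps)
  show ?case unfolding enc_term.simps upt_split_node
    using fl_append[OF 1 fl_append[OF 2 3]] by (simp add: ps_Suc second_ps del: upt_Suc)
next
  case (Mul u v)
  have 1: "fl F i (map ps [a]) \<sigma> \<sigma> (out (ps a, Mul u v))"
    by (rule fl_tok, rule out[OF Mul.prems(1)]) (use Mul.prems in auto)
  have 2: "fl F i (map ps [Suc a..<Suc a + length (enc_term u)]) \<sigma> \<sigma> (concat (map out (nodes (ps (Suc a)) u)))"
    using Mul.prems by (intro Mul.IH(1)) (auto simp: occ_Cons occ_append ps_Suc)
  have 3: "fl F i (map ps [Suc a + length (enc_term u)..<Suc a + length (enc_term u) + length (enc_term v)]) \<sigma> \<sigma>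
     (concat (map out (nodes (ps (Suc a + length (enc_term u))) v)))"
    using Mul.prems by (intro Mul.IH(2)) (auto simp: occ_Cons occ_append second_ps)
  show ?case unfolding enc_term.simps upt_split_node
    using fl_append[OF 1 fl_append[OF 2 3]] by (simp add: ps_Suc second_ps del: upt_Suc)
qed

lemma qnodes_fl:
  assumes out: "\<And>k u. occ ts k (enc_term u) \<Longrightarrow> (ps k, u) \<in> ns \<Longrightarrow> F (\<sigma>(i := ps k)) = (\<sigma>(i := ps k), out (ps k, u))"
    and nop: "\<And>k. k < length ts \<Longrightarrow> ts ! k \<notin> {5..8} \<Longrightarrow> F (\<sigma>(i := ps k)) = (\<sigma>(i := ps k), [])"
  shows "occ ts a (enc_qff enc_term \<phi>) \<Longrightarrow> set (qnodes (ps a) \<phi>) \<subseteq> ns \<Longrightarrow>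
    fl F i (map ps [a..<a + length (enc_qff enc_term \<phi>)]) \<sigma> \<sigma> (concat (map out (qnodes (ps a) \<phi>)))"
proof (induction \<phi> arbitrary: a)
  case (Le u v)
  have 1: "fl F i (map ps [a]) \<sigma> \<sigma> []"
    by (rule fl_silent) (use Le.prems nop in \<open>auto simp: occ_Cons\<close>)
  have 2: "fl F i (map ps [Suc a..<Suc a + length (enc_term u)]) \<sigma> \<sigma> (concat (map out (nodes (ps (Suc a)) u)))"
    using Le.prems by (intro nodes_fl[where ns = ns, OF out nop]) (auto simp: occ_Cons occ_append ps_Suc)
  have 3: "fl F i (map ps [Suc a + length (enc_term u)..<Suc a + length (enc_term u) + length (enc_term v)]) \<sigma> \<sigma>
     (concat (map out (nodes (ps (Suc a + length (enc_term u))) v)))"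
    using Le.prems by (intro nodes_fl[where ns = ns, OF out nop]) (auto simp: occ_Cons occ_append second_ps)
  show ?case unfolding enc_qff.simps upt_split_node
    using fl_append[OF 1 fl_append[OF 2 3]] by (simp add: ps_Suc second_ps del: upt_Suc)
next
  case (And u v)
  have 1: "fl F i (map ps [a]) \<sigma> \<sigma> []"
    by (rule fl_silent) (use And.prems nop in \<open>auto simp: occ_Cons\<close>)
  have 2: "fl F i (map ps [Suc a..<Suc a + length (enc_qff enc_term u)]) \<sigma> \<sigma> (concat (map out (qnodes (ps (Suc a)) u)))"
    using And.prems by (intro And.IH(1)) (auto simp: occ_Cons occ_append ps_Suc)
  have 3: "fl F i (map ps [Suc a + length (enc_qff enc_term u)..<Suc a + length (enc_qff enc_term u) + length (enc_qff enc_term v)]) \<sigma> \<sigma>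
     (concat (map out (qnodes (ps (Suc a + length (enc_qff enc_term u))) v)))"
    using And.prems by (intro And.IH(2)) (auto simp: occ_Cons occ_append second_ps)
  show ?case unfolding enc_qff.simps upt_split_node
    using fl_append[OF 1 fl_append[OF 2 3]] by (simp add: ps_Suc second_ps del: upt_Suc)
next
  case (Or u v)
  have 1: "fl F i (map ps [a]) \<sigma> \<sigma> []"
    by (rule fl_silent) (use Or.prems nop in \<open>auto simp: occ_Cons\<close>)
  have 2: "fl F i (map ps [Suc a..<Suc a + length (enc_qff enc_term u)]) \<sigma> \<sigma> (concat (map out (qnodes (ps (Suc a)) u)))"
    using Or.prems by (intro Or.IH(1)) (auto simp: occ_Cons occ_append ps_Suc)
  have 3: "fl F i (map ps [Suc a + length (enc_qff enc_term u)..<Suc a + length (enc_qff enc_term u) + length (enc_qff enc_term v)]) \<sigma> \<sigma>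
     (concat (map out (qnodes (ps (Suc a + length (enc_qff enc_term u))) v)))"
    using Or.prems by (intro Or.IH(2)) (auto simp: occ_Cons occ_append second_ps)
  show ?case unfolding enc_qff.simps upt_split_node
    using fl_append[OF 1 fl_append[OF 2 3]] by (simp add: ps_Suc second_ps del: upt_Suc)
qed

text \<open>\<open>lo\<close> and \<open>hi\<close> confine the assumptions on the body to one part
  of the input, because in the third class the body behaves differently on \<Psi> and on
  \<Phi>.\<close>

lemma skel_fl:
  assumes out: "\<And>k u v. lo \<le> k \<Longrightarrow> k < hi \<Longrightarrow> occ ts k (enc_qff enc_term (Le u v)) \<Longrightarrow> {(ps (Suc k), u), (second (ps k) u, v)} \<subseteq> ns \<Longrightarrow>
      F (\<sigma>(i := ps k)) = (\<sigma>(i := ps k), to_bits (enc_qff e (map_qff tr (mk (ps (Suc k)) (second (ps k) u)))))"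
    and op: "\<And>k. lo \<le> k \<Longrightarrow> k < hi \<Longrightarrow> k < length ts \<Longrightarrow> ts ! k \<in> {10, 11} \<Longrightarrow> F (\<sigma>(i := ps k)) = (\<sigma>(i := ps k), to_bits [ts ! k])"
    and nop: "\<And>k. k < length ts \<Longrightarrow> ts ! k < 9 \<Longrightarrow> F (\<sigma>(i := ps k)) = (\<sigma>(i := ps k), [])"
  shows "occ ts a (enc_qff enc_term \<phi>) \<Longrightarrow> set (qnodes (ps a) \<phi>) \<subseteq> ns \<Longrightarrow> lo \<le> a \<Longrightarrow> a + length (enc_qff enc_term \<phi>) \<le> hi \<Longrightarrow>
    fl F i (map ps [a..<a + length (enc_qff enc_term \<phi>)]) \<sigma> \<sigma> (to_bits (enc_qff e (map_qff tr (skel mk (ps a) \<phi>))))"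
proof (induction \<phi> arbitrary: a)
  case (Le u v)
  have s: "{(ps (Suc a), u), (second (ps a) u, v)} \<subseteq> ns"
    using Le.prems(2) nodes_self[of "ps (Suc a)" u] nodes_self[of "second (ps a) u" v] by (auto simp: ps_Suc simp del: nodes.simps)
  have 1: "fl F i (map ps [a]) \<sigma> \<sigma> (to_bits (enc_qff e (map_qff tr (mk (ps (Suc a)) (second (ps a) u)))))"
    by (rule fl_tok, rule out[OF _ _ Le.prems(1) s]) (use Le.prems in auto)
  have lt: "set (enc_term t) \<subseteq> {0..8}" for t
    using set_enc_int set_enc_nat by (induction t) fastforce+
  have sil: "fl F i (map ps [c..<c + length (enc_term t)]) \<sigma> \<sigma> []" if o: "occ ts c (enc_term t)" for c t
  proof (rule fl_silent)
    fix p assume "p \<in> set (map ps [c..<c + length (enc_term t)])"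
    then obtain k where k: "p = ps k" "c \<le> k" "k < c + length (enc_term t)" by auto
    have "k < length ts" "ts ! k \<in> set (enc_term t)" using occ_nth[OF o k(2,3)] k by auto
    then show "F (\<sigma>(i := p)) = (\<sigma>(i := p), [])" using nop[of k] k(1) lt[of t] by fastforce
  qed
  have 2: "fl F i (map ps [Suc a..<Suc a + length (enc_term u)]) \<sigma> \<sigma> []"
    using Le.prems by (intro sil) (auto simp: occ_Cons occ_append)
  have 3: "fl F i (map ps [Suc a + length (enc_term u)..<Suc a + length (enc_term u) + length (enc_term v)]) \<sigma> \<sigma> []"
    using Le.prems by (intro sil) (auto simp: occ_Cons occ_append)
  show ?case unfolding enc_qff.simps upt_split_node
    using fl_append[OF 1 fl_append[OF 2 3]] by (simp add: ps_Suc del: upt_Suc)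
next
  case (And u v)
  have 1: "fl F i (map ps [a]) \<sigma> \<sigma> (to_bits [10])"
    by (rule fl_tok) (use op[of a] And.prems in \<open>simp add: occ_Cons\<close>)
  have 2: "fl F i (map ps [Suc a..<Suc a + length (enc_qff enc_term u)]) \<sigma> \<sigma> (to_bits (enc_qff e (map_qff tr (skel mk (ps (Suc a)) u))))"
    using And.prems by (intro And.IH(1)) (auto simp: occ_Cons occ_append ps_Suc)
  have 3: "fl F i (map ps [Suc a + length (enc_qff enc_term u)..<Suc a + length (enc_qff enc_term u) + length (enc_qff enc_term v)]) \<sigma> \<sigma>
     (to_bits (enc_qff e (map_qff tr (skel mk (ps (Suc a + length (enc_qff enc_term u))) v))))"
    using And.prems by (intro And.IH(2)) (auto simp: occ_Cons occ_append second_ps)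
  show ?case unfolding enc_qff.simps upt_split_node
    using fl_append[OF 1 fl_append[OF 2 3]] by (simp add: ps_Suc second_ps to_bits_node del: upt_Suc)
next
  case (Or u v)
  have 1: "fl F i (map ps [a]) \<sigma> \<sigma> (to_bits [11])"
    by (rule fl_tok) (use op[of a] Or.prems in \<open>simp add: occ_Cons\<close>)
  have 2: "fl F i (map ps [Suc a..<Suc a + length (enc_qff enc_term u)]) \<sigma> \<sigma> (to_bits (enc_qff e (map_qff tr (skel mk (ps (Suc a)) u))))"
    using Or.prems by (intro Or.IH(1)) (auto simp: occ_Cons occ_append ps_Suc)
  have 3: "fl F i (map ps [Suc a + length (enc_qff enc_term u)..<Suc a + length (enc_qff enc_term u) + length (enc_qff enc_term v)]) \<sigma> \<sigma>
     (to_bits (enc_qff e (map_qff tr (skel mk (ps (Suc a + length (enc_qff enc_term u))) v))))"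
    using Or.prems by (intro Or.IH(2)) (auto simp: occ_Cons occ_append second_ps)
  show ?case unfolding enc_qff.simps upt_split_node
    using fl_append[OF 1 fl_append[OF 2 3]] by (simp add: ps_Suc second_ps to_bits_node del: upt_Suc)
qed

lemma leaves_concat:
  "concat (map (\<lambda>(p, u). case u of Var i \<Rightarrow> to_bits (g p) | _ \<Rightarrow> []) ns) = to_bits (concat (map g (leaves ns)))"
  by (induction ns) (auto simp: leaves_def split: tm_term.splits)

lemma occ_self: "ts = xs @ ys @ zs \<Longrightarrow> occ ts (length xs) ys"
  by (auto simp: occ_def nth_append)

lemma map_qff_inst:
  "map_qff (\<lambda>P. tr (inst \<sigma> P)) \<phi> = map_qff tr (map_qff (inst \<sigma>) \<phi>)"
  by (simp add: qff.map_comp comp_def)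

lemma inst_f [simp]:
  "map_qff (inst \<sigma>) (f_link b p q) = f_link b (\<sigma> p) (\<sigma> q)"
  "map_qff (inst \<sigma>) (f_pos p) = f_pos (\<sigma> p)"
  "map_qff (inst \<sigma>) (f_var r p q) = f_var (\<sigma> r) (\<sigma> p) (\<sigma> q)"
  "map_qff (inst \<sigma>) (f_const p) = f_const (\<sigma> p)"
  "map_qff (inst \<sigma>) (f_add p a b) = f_add (\<sigma> p) (\<sigma> a) (\<sigma> b)"
  "map_qff (inst \<sigma>) (f_mul p a b) = f_mul (\<sigma> p) (\<sigma> a) (\<sigma> b)"
  "map_qff (inst \<sigma>) (f_atom a b) = f_atom (\<sigma> a) (\<sigma> b)"
  "map_qff (inst \<sigma>) (e_unit p) = e_unit (\<sigma> p)"
  "map_qff (inst \<sigma>) (e_var p) = e_var (\<sigma> p)"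
  "map_qff (inst \<sigma>) (e_const p) = e_const (\<sigma> p)"
  "map_qff (inst \<sigma>) (e_add p a b) = e_add (\<sigma> p) (\<sigma> a) (\<sigma> b)"
  "map_qff (inst \<sigma>) (e_mul p a b) = e_mul (\<sigma> p) (\<sigma> a) (\<sigma> b)"
  "map_qff (inst \<sigma>) (e_atom a b) = e_atom (\<sigma> a) (\<sigma> b)"
  by (simp_all add: f_defs inst_def)

lemma enc_qff_foldr:
  "enc_qff e (map_qff tr (foldr And fs \<phi>)) = concat (map (\<lambda>f. 10 # enc_qff e (map_qff tr f)) fs) @ enc_qff e (map_qff tr \<phi>)"
  "enc_qff e (map_qff tr (foldr Or fs \<phi>)) = concat (map (\<lambda>f. 11 # enc_qff e (map_qff tr f)) fs) @ enc_qff e (map_qff tr \<phi>)"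
  by (induction fs) auto

definition enc_premise :: "tm_term qff option \<Rightarrow> nat list" where
  "enc_premise \<Psi> = (case \<Psi> of None \<Rightarrow> [] | Some \<psi> \<Rightarrow> enc_qff enc_term \<psi>)"

lemma concat_map_concat: "concat (map f (concat (map g xs))) = concat (map (\<lambda>x. concat (map f (g x))) xs)"
  by (induction xs) auto

section \<open>Output of the program on an encoded sentence\<close>

locale compile =
  fixes s :: "tm_term sentence" and ts :: "nat list" and m n :: nat and \<Psi> :: "tm_term qff option" and \<Phi> :: "tm_term qff"
    and ns :: "(nat \<times> tm_term) list" and cv :: "coef \<Rightarrow> int"
    and PP :: "apoly \<Rightarrow> cmd" and e :: "'p \<Rightarrow> nat list" and tr :: "apoly \<Rightarrow> 'p"
  assumes ts: "ts = enc_sentence enc_term s" and split: "split_sentence s = (m, n, \<Psi>, \<Phi>)"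
    and ns: "ns = snodes s" and par: "parsed ns cv 3 m"
    and pos: "(p, t) \<in> set ns \<Longrightarrow> p < 4 * length ts" and pr: "printer ts cv PP e tr"
begin

text \<open>The number of header tokens, hence the index of the first token of the first formula;
  \<open>a2\<close> below is that of \<Phi>.\<close>

definition h where "h = 1 + length (enc_nat m) + length (enc_nat n)"
abbreviation "encpsi \<equiv> enc_premise \<Psi>"
abbreviation "a2 \<equiv> h + length encpsi"

lemma start_ps: "start s = ps h"
  by (simp add: start_def split h_def ps_def)

lemma middle_ps: "middle s = ps a2"
  by (simp add: middle_def start_ps split ps_def enc_premise_def split: option.splits)

lemma ts_eq: "\<exists>c \<le> 2. ts = c # enc_nat m @ enc_nat n @ encpsi @ enc_qff enc_term \<Phi>"
  using split by (cases s) (auto simp: ts enc_premise_def)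

lemma occ_Phi: "occ ts a2 (enc_qff enc_term \<Phi>)" "length ts = a2 + length (enc_qff enc_term \<Phi>)"
proof -
  obtain c where c: "ts = c # enc_nat m @ enc_nat n @ encpsi @ enc_qff enc_term \<Phi>" using ts_eq by blast
  show "occ ts a2 (enc_qff enc_term \<Phi>)"
    using occ_self[of ts "c # enc_nat m @ enc_nat n @ encpsi" "enc_qff enc_term \<Phi>" "[]"] c by (simp add: h_def add.assoc)
  show "length ts = a2 + length (enc_qff enc_term \<Phi>)" by (simp add: c h_def)
qed

lemma occ_Psi: "occ ts h encpsi"
proof -
  obtain c where c: "ts = c # enc_nat m @ enc_nat n @ encpsi @ enc_qff enc_term \<Phi>" using ts_eq by blast
  show ?thesis
    using occ_self[of ts "c # enc_nat m @ enc_nat n" encpsi "enc_qff enc_term \<Phi>"] c by (simp add: h_def)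
qed

lemma header: "k < h \<Longrightarrow> k < length ts \<and> ts ! k < 5"
proof -
  obtain c where c: "c \<le> 2" "ts = c # enc_nat m @ enc_nat n @ encpsi @ enc_qff enc_term \<Phi>" using ts_eq by blast
  assume k: "k < h"
  then have "ts ! k = (c # enc_nat m @ enc_nat n) ! k" "k < length (c # enc_nat m @ enc_nat n)"
    using c(2) by (auto simp: h_def nth_append nth_Cons split: nat.splits)
  then have "ts ! k \<in> set (c # enc_nat m @ enc_nat n)" by (metis nth_mem)
  then have "ts ! k \<in> {0..4}" using c(1) subsetD[OF set_enc_nat] by fastforce
  then show ?thesis using k occ_Phi(2) by (simp add:)
qed

lemma digits_m: "digits_at ts 0 (enc_nat m)"
proof -
  obtain c where c: "ts = c # enc_nat m @ enc_nat n @ encpsi @ enc_qff enc_term \<Phi>" using ts_eq by blast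
  have "occ ts 0 (c # enc_nat m)" using occ_self[of ts "[]" "c # enc_nat m" "enc_nat n @ encpsi @ enc_qff enc_term \<Phi>"] c by simp
  then show ?thesis by (rule digits_enc)
qed

lemma ns_eq: "ns = (case \<Psi> of None \<Rightarrow> [] | Some \<psi> \<Rightarrow> qnodes (ps h) \<psi>) @ qnodes (ps a2) \<Phi>"
  by (simp add: ns snodes_def split start_ps middle_ps enc_premise_def split: option.splits)

lemma sentence_fl:
  assumes out: "\<And>k u. occ ts k (enc_term u) \<Longrightarrow> (ps k, u) \<in> set ns \<Longrightarrow> F (\<sigma>(i := ps k)) = (\<sigma>(i := ps k), out (ps k, u))"
    and nop: "\<And>k. k < length ts \<Longrightarrow> ts ! k \<notin> {5..8} \<Longrightarrow> F (\<sigma>(i := ps k)) = (\<sigma>(i := ps k), [])"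
  shows "fl F i (map ps [0..<length ts]) \<sigma> \<sigma> (concat (map out ns))"
proof -
  have 1: "fl F i (map ps [0..<h]) \<sigma> \<sigma> []"
    by (rule fl_silent) (use header nop in fastforce)
  have 2: "fl F i (map ps [h..<a2]) \<sigma> \<sigma> (concat (map out (case \<Psi> of None \<Rightarrow> [] | Some \<psi> \<Rightarrow> qnodes (ps h) \<psi>)))"
  proof (cases \<Psi>)
    case None
    then show ?thesis by (simp add: enc_premise_def fl_Nil)
  next
    case (Some \<psi>)
    have "fl F i (map ps [h..<h + length (enc_qff enc_term \<psi>)]) \<sigma> \<sigma> (concat (map out (qnodes (ps h) \<psi>)))"
      by (rule qnodes_fl[where ns = "set ns", OF out nop]) (use occ_Psi Some in \<open>auto simp: enc_premise_def ns_eq\<close>)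
    then show ?thesis using Some by (simp add: enc_premise_def)
  qed
  have 3: "fl F i (map ps [a2..<length ts]) \<sigma> \<sigma> (concat (map out (qnodes (ps a2) \<Phi>)))"
    unfolding occ_Phi(2)
    by (rule qnodes_fl[where ns = "set ns", OF out nop]) (use occ_Phi in \<open>auto simp: ns_eq\<close>)
  have "[0..<length ts] = [0..<h] @ [h..<a2] @ [a2..<length ts]"
    using upt_split3[of 0 h "length ts"] upt_split3[of h a2 "length ts"] occ_Phi(2) by (simp add:)
  then show ?thesis using fl_append[OF 1 fl_append[OF 2 3]] by (simp add: ns_eq)
qed

lemma run_For_pads:
  assumes pads: "\<And>\<sigma> j. j < 4 * length ts \<Longrightarrow> j mod 4 \<noteq> 3 \<Longrightarrow> run (pad ts) c (\<sigma>(i := j)) = (\<sigma>(i := j), [])"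
    and fl: "fl (run (pad ts) c) i (map ps [0..<length ts]) \<sigma> \<sigma> out" and i: "\<sigma> i = 0"
  shows "run (pad ts) (For i c) \<sigma> = (\<sigma>, out)"
proof -
  have "fl (run (pad ts) c) i [4 * 0..<4 * length ts] \<sigma> \<sigma> out"
  proof (rule fl_pads[rotated 3, OF fl, where Inv = "\<lambda>_. True"])
    fix \<sigma> j assume "0 \<le> j div 4" "j div 4 < length ts" "j mod 4 \<noteq> 3"
    moreover from this have "j < 4 * length ts" by linarith
    ultimately show "run (pad ts) c (\<sigma>(i := j)) = (\<sigma>(i := j), [])" using pads by blast
  qed auto
  then have "fl (run (pad ts) c) i [0..<length (pad ts)] \<sigma> \<sigma> out" by simp
  from run_For[OF this] show ?thesis using i by (simp add: fun_upd_idem)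
qed

definition prt :: "nat \<Rightarrow> apoly qff \<Rightarrow> nat list" where "prt op \<phi> = op # enc_qff e (map_qff tr \<phi>)"

lemma run_emit:
  assumes "clean \<sigma>" "ok_qff ts cv \<sigma> \<phi>"
  shows "run (pad ts) (emit PP op \<phi>) \<sigma> = (\<sigma>, to_bits (prt op (map_qff (inst \<sigma>) \<phi>)))"
proof -
  have "to_bits (prt op \<phi>') = to_bits [op] @ to_bits (enc_qff e (map_qff tr \<phi>'))" for \<phi>'
    by (simp add: prt_def to_bits_def)
  then show ?thesis using run_PQ[OF pr assms] by (simp add: emit_def map_qff_inst)
qed

lemma run_Leaves:
  assumes "\<sigma> rU = 0"
    and "\<And>k i. (ps k, Var i) \<in> set ns \<Longrightarrow> occ ts k (enc_term (Var i)) \<Longrightarrow>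
       run (pad ts) c (\<sigma>(rU := ps k)) = (\<sigma>(rU := ps k), to_bits (g (ps k)))"
  shows "run (pad ts) (Leaves c) \<sigma> = (\<sigma>, to_bits (concat (map g (leaves ns))))"
  unfolding Leaves_def leaves_concat[symmetric]
proof (rule run_For_pads[OF _ sentence_fl])
  fix \<sigma> :: regs and j assume "j < 4 * length ts" "j mod 4 \<noteq> 3"
  then show "run (pad ts) (If (Tok rU {5}) c Skip) (\<sigma>(rU := j)) = (\<sigma>(rU := j), [])"
    by (simp add: nth_pad)
next
  fix k u assume o: "occ ts k (enc_term u)" and u: "(ps k, u) \<in> set ns"
  show "run (pad ts) (If (Tok rU {5}) c Skip) (\<sigma>(rU := ps k)) =
      (\<sigma>(rU := ps k), case (ps k, u) of (p, u) \<Rightarrow> (case u of Var i \<Rightarrow> to_bits (g p) | _ \<Rightarrow> []))"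
  proof (cases u)
    case (Var i)
    then have "k < length ts" "ts ! k = 5" using o by (auto simp: occ_Cons)
    then show ?thesis using Var assms(2) o u by simp
  qed (use o in \<open>auto simp: occ_Cons\<close>)
next
  fix k assume "k < length ts" "ts ! k \<notin> {5..8}"
  then show "run (pad ts) (If (Tok rU {5}) c Skip) (\<sigma>(rU := ps k)) = (\<sigma>(rU := ps k), [])" by auto
qed (rule assms(1))

lemma run_Children:
  assumes c: "clean \<sigma>" "\<sigma> rA = 0" "\<sigma> rB = 0" "\<sigma> rT = ps k"
    and o: "occ ts k (x # xs @ ys)" "tree xs" "\<And>j. occ ts j ys \<Longrightarrow> j < length ts \<and> ts ! j \<in> {5..11}"
    and r: "run (pad ts) d (\<sigma>(rA := ps (Suc k), rB := ps (Suc k + length xs))) =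
      (\<sigma>(rA := ps (Suc k), rB := ps (Suc k + length xs)), out)"
  shows "run (pad ts) (Children d) \<sigma> = (\<sigma>, out)"
proof -
  have o': "k < length ts" "occ ts (Suc k) xs" "occ ts (Suc k + length xs) ys" using o(1) by (auto simp: occ_Cons occ_append)
  let ?\<tau> = "\<sigma>(rA := ps (Suc k))"
  have "run (pad ts) (FindB rT) ?\<tau> = (?\<tau>(rB := ps (Suc k + length xs)), [])"
  proof (rule run_FindB[where k = k and a = "Suc k", OF _ _ _ _ o'(1) o(2) o'(2)])
    show "clean ?\<tau>" using c(1) by (simp add: scratch_def)
    show "rT \<notin> scratch" by (simp add: scratch_def)
    show "?\<tau> rT = ps k" using c by simp
    show "Suc k + length xs < length ts" "ts ! (Suc k + length xs) \<in> {5..11}" using o(3)[OF o'(3)] by auto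
  qed auto
  moreover have "\<sigma>(rA := Suc (Suc (Suc (Suc (ps k))))) = ?\<tau>" by (simp add: ps_def)
  moreover have "(\<sigma>(rA := ps (Suc k), rB := ps (Suc k + length xs)))(rA := 0, rB := 0) = \<sigma>" using c by (intro ext) simp
  ultimately show ?thesis using c r by (simp add: Children_def)
qed

lemma one: "cv One = 1" using par by (rule parsed.cv)

lemma ok_leaf:
  assumes "(ps k, Var i) \<in> set ns" "occ ts k (enc_term (Var i))" "r \<notin> scratch" "\<sigma> r = ps k"
  shows "ok_coef ts cv \<sigma> (DigV r)"
proof -
  have "digits_at ts k (enc_nat i)" using assms(2) digits_enc(1) by simp
  moreover have "cv (DigV (ps k)) = int i" using parsed.cv(2)[OF par assms(1)] .
  ultimately show ?thesis using assms(3,4) by auto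
qed

lemma ok_const:
  assumes "(ps k, Const c) \<in> set ns" "occ ts k (enc_term (Const c))" "r \<notin> scratch" "\<sigma> r = ps k"
  shows "ok_coef ts cv \<sigma> (Dig r)"
proof -
  have "digits_at ts k (enc_int c)" using assms(2) digits_enc(2) by simp
  moreover have "cv (Dig (ps k)) = c" using parsed.cv(3)[OF par assms(1)] .
  ultimately show ?thesis using assms(3,4) by auto
qed

lemma ok_M: "\<sigma> rM = 3 \<Longrightarrow> ok_coef ts cv \<sigma> (DigV rM)"
  using digits_m parsed.cv(4)[OF par] by (auto simp: scratch_def ps_def intro!: exI[of _ 0])

lemma no_scratch: "rT \<notin> scratch" "rU \<notin> scratch" "rA \<notin> scratch" "rB \<notin> scratch" "rM \<notin> scratch"
  by (simp_all add: scratch_def)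

lemma ok_simple:
  assumes "\<sigma> rT < 4 * length ts"
  shows "ok_qff ts cv \<sigma> (f_pos rT)" "ok_qff ts cv \<sigma> (e_unit rT)" "ok_qff ts cv \<sigma> (e_var rT)"
  using assms no_scratch by (auto simp: ok_qff_def ok_mono_def f_defs one)

lemma ok_arith:
  assumes "\<sigma> rT < 4 * length ts" "\<sigma> rA < 4 * length ts" "\<sigma> rB < 4 * length ts"
  shows "ok_qff ts cv \<sigma> (f_add rT rA rB)" "ok_qff ts cv \<sigma> (f_mul rT rA rB)"
    "ok_qff ts cv \<sigma> (e_add rT rA rB)" "ok_qff ts cv \<sigma> (e_mul rT rA rB)"
  using assms no_scratch by (auto simp: ok_qff_def ok_mono_def f_defs one)

lemma ok_atom:
  assumes "\<sigma> rA < 4 * length ts" "\<sigma> rB < 4 * length ts"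
  shows "ok_qff ts cv \<sigma> (f_atom rA rB)" "ok_qff ts cv \<sigma> (e_atom rA rB)"
  using assms no_scratch by (auto simp: ok_qff_def ok_mono_def f_defs one)

lemma ok_consts:
  assumes "\<sigma> rT < 4 * length ts" "ok_coef ts cv \<sigma> (Dig rT)"
  shows "ok_qff ts cv \<sigma> (f_const rT)" "ok_qff ts cv \<sigma> (e_const rT)"
  using assms no_scratch by (auto simp: ok_qff_def ok_mono_def f_defs one simp del: ok_coef.simps(2))

lemma ok_pairs:
  assumes "\<sigma> rT < 4 * length ts" "\<sigma> rU < 4 * length ts" "ok_coef ts cv \<sigma> (DigV rT)" "ok_coef ts cv \<sigma> (DigV rU)" "b < 7"
  shows "ok_qff ts cv \<sigma> (f_link b rT rU)"
    "ok_coef ts cv \<sigma> (DigV rM) \<Longrightarrow> ok_qff ts cv \<sigma> (f_var rM rT rU)"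
  using assms no_scratch by (auto simp: ok_qff_def ok_mono_def f_defs one simp del: ok_coef.simps(3))

text \<open>The state between the phases of the program, which each phase restores. It leaves
  \<open>rH\<close> open, as this register is set only in the third class.\<close>

definition st :: "regs \<Rightarrow> bool" where
  "st \<sigma> \<longleftrightarrow> clean \<sigma> \<and> \<sigma> rT = 0 \<and> \<sigma> rU = 0 \<and> \<sigma> rA = 0 \<and> \<sigma> rB = 0 \<and> \<sigma> rM = 3"

lemma st_clean [simp]: "st \<sigma> \<Longrightarrow> clean \<sigma>" "st \<sigma> \<Longrightarrow> clean (\<sigma>(rT := p))" "st \<sigma> \<Longrightarrow> clean (\<sigma>(rT := p, rU := q))"
  by (simp_all add: st_def scratch_def)

lemma run_Links:
  assumes "st \<sigma>" "b < 7"
  shows "run (pad ts) (Links PP b) \<sigma> = (\<sigma>, to_bits (concat (map (prt 10) (links b (leaves ns)))))"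
proof -
  define g where "g = (\<lambda>p. concat (map (\<lambda>q. prt 10 (f_link b p q)) (leaves ns)))"
  have e: "concat (map (prt 10) (links b (leaves ns))) = concat (map g (leaves ns))"
    by (simp add: links_def concat_map_concat comp_def g_def)
  show ?thesis
    unfolding Links_def e leaves_concat[symmetric]
  proof (rule run_For_pads[OF _ sentence_fl])
    fix \<sigma> :: regs and j assume "j < 4 * length ts" "j mod 4 \<noteq> 3"
    then show "run (pad ts) (If (Tok rT {5}) (Leaves (emit PP 10 (f_link b rT rU))) Skip) (\<sigma>(rT := j)) = (\<sigma>(rT := j), [])"
      by (simp add: nth_pad)
  next
    fix k u assume o: "occ ts k (enc_term u)" and u: "(ps k, u) \<in> set ns"
    show "run (pad ts) (If (Tok rT {5}) (Leaves (emit PP 10 (f_link b rT rU))) Skip) (\<sigma>(rT := ps k)) =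
      (\<sigma>(rT := ps k), case (ps k, u) of (p, u) \<Rightarrow> (case u of Var i \<Rightarrow> to_bits (g p) | _ \<Rightarrow> []))"
    proof (cases u)
      case (Var i)
      then have k: "k < length ts" "ts ! k = 5" using o by (auto simp: occ_Cons)
      let ?\<tau> = "\<sigma>(rT := ps k)"
      have "run (pad ts) (Leaves (emit PP 10 (f_link b rT rU))) ?\<tau> = (?\<tau>, to_bits (g (ps k)))"
        unfolding g_def
      proof (rule run_Leaves)
        fix l j assume l: "(ps l, Var j) \<in> set ns" "occ ts l (enc_term (Var j))"
        have "ok_qff ts cv (?\<tau>(rU := ps l)) (f_link b rT rU)"
          by (rule ok_pairs) (use ok_leaf[OF l, of rU "?\<tau>(rU := ps l)"] ok_leaf[of k i rT "?\<tau>(rU := ps l)"] o u Var no_scratch pos l k assms in auto)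
        then show "run (pad ts) (emit PP 10 (f_link b rT rU)) (?\<tau>(rU := ps l)) = (?\<tau>(rU := ps l), to_bits (prt 10 (f_link b (ps k) (ps l))))"
          using run_emit[of "?\<tau>(rU := ps l)"] assms by simp
      qed (use assms in \<open>simp add: st_def\<close>)
      then show ?thesis using k Var by simp
    qed (use o in \<open>auto simp: occ_Cons\<close>)
  next
    fix k assume "k < length ts" "ts ! k \<notin> {5..8}"
    then show "run (pad ts) (If (Tok rT {5}) (Leaves (emit PP 10 (f_link b rT rU))) Skip) (\<sigma>(rT := ps k)) = (\<sigma>(rT := ps k), [])"
      by auto
  qed (use assms in \<open>simp add: st_def\<close>)
qed

lemma to_bits_concat: "concat (map (\<lambda>x. to_bits (g x)) xs) = to_bits (concat (map g xs))"
  by (induction xs) auto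

text \<open>The common frame of \<open>FNodes\<close> and \<open>ENodes\<close>, which differ only
  in what they print at a node.\<close>

lemma run_nodes:
  assumes \<sigma>: "st \<sigma>"
    and var: "\<And>k i. k < length ts \<Longrightarrow> occ ts k (enc_term (Var i)) \<Longrightarrow> (ps k, Var i) \<in> set ns \<Longrightarrow>
        run (pad ts) cvar (\<sigma>(rT := ps k)) = (\<sigma>(rT := ps k), to_bits (g (ps k, Var i)))"
    and const: "\<And>k c. k < length ts \<Longrightarrow> occ ts k (enc_term (Const c)) \<Longrightarrow> (ps k, Const c) \<in> set ns \<Longrightarrow>
        run (pad ts) cconst (\<sigma>(rT := ps k)) = (\<sigma>(rT := ps k), to_bits (g (ps k, Const c)))"
    and add: "\<And>k a b \<tau>. k < length ts \<Longrightarrow> \<tau> = \<sigma>(rT := ps k, rA := ps k + 4, rB := second (ps k) a) \<Longrightarrow> clean \<tau> \<Longrightarrow>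
        \<tau> rA < 4 * length ts \<Longrightarrow> \<tau> rB < 4 * length ts \<Longrightarrow> run (pad ts) cadd \<tau> = (\<tau>, to_bits (g (ps k, Add a b)))"
    and mul: "\<And>k a b \<tau>. k < length ts \<Longrightarrow> \<tau> = \<sigma>(rT := ps k, rA := ps k + 4, rB := second (ps k) a) \<Longrightarrow> clean \<tau> \<Longrightarrow>
        \<tau> rA < 4 * length ts \<Longrightarrow> \<tau> rB < 4 * length ts \<Longrightarrow> run (pad ts) cmul \<tau> = (\<tau>, to_bits (g (ps k, Mul a b)))"
  shows "run (pad ts) (For rT (If (Tok rT {5}) cvar (If (Tok rT {6}) cconst
      (If (Tok rT {7}) (Children cadd) (If (Tok rT {8}) (Children cmul) Skip))))) \<sigma>
    = (\<sigma>, to_bits (concat (map g ns)))"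
  unfolding to_bits_concat[symmetric]
proof (rule run_For_pads[OF _ sentence_fl])
  fix \<sigma> :: regs and j assume "j < 4 * length ts" "j mod 4 \<noteq> 3"
  then show "run (pad ts) (If (Tok rT {5}) cvar (If (Tok rT {6}) cconst
      (If (Tok rT {7}) (Children cadd) (If (Tok rT {8}) (Children cmul) Skip)))) (\<sigma>(rT := j)) = (\<sigma>(rT := j), [])"
    by (simp add: nth_pad)
next
  fix k u assume o: "occ ts k (enc_term u)" and u: "(ps k, u) \<in> set ns"
  let ?\<tau> = "\<sigma>(rT := ps k)"
  have k: "k < length ts" using occ_head(1)[OF o] by blast
  have ch: "run (pad ts) (Children d) ?\<tau> = (?\<tau>, out)"
    if x: "enc_term u = x # enc_term a @ enc_term b"
      and d: "\<And>\<tau>. \<tau> = \<sigma>(rT := ps k, rA := ps k + 4, rB := second (ps k) a) \<Longrightarrow> clean \<tau> \<Longrightarrow>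
        \<tau> rA < 4 * length ts \<Longrightarrow> \<tau> rB < 4 * length ts \<Longrightarrow> run (pad ts) d \<tau> = (\<tau>, out)" for x a b d out
  proof (rule run_Children)
    show "occ ts k (x # enc_term a @ enc_term b)" using o x by simp
    then have o2: "occ ts (Suc k) (enc_term a)" "occ ts (Suc k + length (enc_term a)) (enc_term b)"
      by (auto simp: occ_Cons occ_append)
    let ?\<tau>2 = "?\<tau>(rA := ps (Suc k), rB := ps (Suc k + length (enc_term a)))"
    have "?\<tau>2 = \<sigma>(rT := ps k, rA := ps k + 4, rB := second (ps k) a)" by (simp add: ps_Suc second_ps)
    moreover have "clean ?\<tau>2" using \<sigma> by (simp add: no_scratch)
    moreover have "?\<tau>2 rA < 4 * length ts" "?\<tau>2 rB < 4 * length ts"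
      using occ_head(1)[OF o2(1)] occ_head(1)[OF o2(2)] by simp_all
    ultimately show "run (pad ts) d ?\<tau>2 = (?\<tau>2, out)" by (rule d)
    show "\<And>j. occ ts j (enc_term b) \<Longrightarrow> j < length ts \<and> ts ! j \<in> {5..11}" using occ_head(1) by fastforce
  qed (use \<sigma> in \<open>simp_all add: st_def tree_term no_scratch\<close>)
  show "run (pad ts) (If (Tok rT {5}) cvar (If (Tok rT {6}) cconst
      (If (Tok rT {7}) (Children cadd) (If (Tok rT {8}) (Children cmul) Skip)))) ?\<tau> = (?\<tau>, to_bits (g (ps k, u)))"
  proof (cases u)
    case (Var i)
    then have "ts ! k = 5" using o by (simp add: occ_Cons)
    then show ?thesis using k var[OF k] o u Var by simp
  next
    case (Const c)
    then have "ts ! k = 6" using o by (simp add: occ_Cons)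
    then show ?thesis using k const[OF k] o u Const by simp
  next
    case (Add a b)
    then have "ts ! k = 7" using o by (simp add: occ_Cons)
    then show ?thesis using k ch[of 7 a b cadd "to_bits (g (ps k, u))"] add[OF k] Add by simp
  next
    case (Mul a b)
    then have "ts ! k = 8" using o by (simp add: occ_Cons)
    then show ?thesis using k ch[of 8 a b cmul "to_bits (g (ps k, u))"] mul[OF k] Mul by simp
  qed
next
  fix k assume "k < length ts" "ts ! k \<notin> {5..8}"
  then show "run (pad ts) (If (Tok rT {5}) cvar (If (Tok rT {6}) cconst
      (If (Tok rT {7}) (Children cadd) (If (Tok rT {8}) (Children cmul) Skip)))) (\<sigma>(rT := ps k)) = (\<sigma>(rT := ps k), [])"
    by auto
qed (use \<sigma> in \<open>simp add: st_def\<close>)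

lemma run_ENodes:
  assumes "st \<sigma>"
  shows "run (pad ts) (ENodes PP) \<sigma> = (\<sigma>, to_bits (concat (map (prt 10) (concat (map e_node ns)))))"
proof -
  have e: "concat (map (prt 10) (concat (map e_node ns))) = concat (map (\<lambda>z. concat (map (prt 10) (e_node z))) ns)"
    by (rule concat_map_concat)
  show ?thesis
    unfolding ENodes_def e
    by (rule run_nodes[OF assms])
      (use assms no_scratch in \<open>simp_all add: run_emit ok_simple ok_arith ok_consts ok_const del: ok_coef.simps\<close>)
qed

lemma run_FNodes:
  assumes "st \<sigma>"
  shows "run (pad ts) (FNodes PP) \<sigma> = (\<sigma>, to_bits (concat (map (prt 11) (concat (map (f_node 3 (leaves ns)) ns)))))"
proof -
  have e: "concat (map (prt 11) (concat (map (f_node 3 (leaves ns)) ns))) = concat (map (\<lambda>z. concat (map (prt 11) (f_node 3 (leaves ns) z))) ns)"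
    by (rule concat_map_concat)
  have M: "\<sigma> rM = 3" using assms by (simp add: st_def)
  show ?thesis
    unfolding FNodes_def e
  proof (rule run_nodes[OF assms])
    fix k i assume k: "k < length ts" "occ ts k (enc_term (Var i))" "(ps k, Var i) \<in> set ns"
    let ?\<tau> = "\<sigma>(rT := ps k)"
    have "run (pad ts) (Leaves (emit PP 11 (f_var rM rT rU))) ?\<tau> = (?\<tau>, to_bits (concat (map (\<lambda>q. prt 11 (f_var 3 (ps k) q)) (leaves ns))))"
    proof (rule run_Leaves)
      fix l j assume l: "(ps l, Var j) \<in> set ns" "occ ts l (enc_term (Var j))"
      let ?\<tau>2 = "?\<tau>(rU := ps l)"
      have "ok_qff ts cv ?\<tau>2 (f_var rM rT rU)"
      proof (rule ok_pairs(2)[where b = 0])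
        show "ok_coef ts cv ?\<tau>2 (DigV rT)" by (rule ok_leaf[OF k(3,2)]) (simp_all add: no_scratch)
        show "ok_coef ts cv ?\<tau>2 (DigV rU)" by (rule ok_leaf[OF l]) (simp_all add: no_scratch)
        show "ok_coef ts cv ?\<tau>2 (DigV rM)" by (rule ok_M) (simp add: M)
        show "?\<tau>2 rU < 4 * length ts" using pos[OF l(1)] by simp
      qed (use k in simp_all)
      then show "run (pad ts) (emit PP 11 (f_var rM rT rU)) ?\<tau>2 = (?\<tau>2, to_bits (prt 11 (f_var 3 (ps k) (ps l))))"
        using run_emit[of ?\<tau>2] assms M by simp
    qed (use assms in \<open>simp add: st_def\<close>)
    then show "run (pad ts) (Seq (emit PP 11 (f_pos rT)) (Leaves (emit PP 11 (f_var rM rT rU)))) ?\<tau> =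
        (?\<tau>, to_bits (concat (map (prt 11) (f_node 3 (leaves ns) (ps k, Var i)))))"
      using assms k by (simp add: run_emit ok_simple comp_def)
  qed (use assms no_scratch in \<open>simp_all add: run_emit ok_simple ok_arith ok_consts ok_const del: ok_coef.simps\<close>)
qed

lemma run_skel_node:
  assumes "st \<sigma>" "occ ts k (enc_qff enc_term (Le u v))" "{(ps (Suc k), u), (second (ps k) u, v)} \<subseteq> set ns"
    and ok: "\<And>\<tau>. \<tau> rA < 4 * length ts \<Longrightarrow> \<tau> rB < 4 * length ts \<Longrightarrow> ok_qff ts cv \<tau> (mk rA rB)"
    and inst: "\<And>\<tau>. map_qff (inst \<tau>) (mk rA rB) = mk (\<tau> rA) (\<tau> rB)"
  shows "run (pad ts) (skel_body PP mk) (\<sigma>(rT := ps k)) =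
     (\<sigma>(rT := ps k), to_bits (enc_qff e (map_qff tr (mk (ps (Suc k)) (second (ps k) u)))))"
proof -
  let ?\<tau> = "\<sigma>(rT := ps k)"
  have o: "occ ts k (9 # enc_term u @ enc_term v)" using assms(2) by simp
  then have k: "k < length ts" "ts ! k = 9" by (auto simp: occ_Cons)
  let ?\<tau>2 = "?\<tau>(rA := ps (Suc k), rB := ps (Suc k + length (enc_term u)))"
  have "run (pad ts) (Children (PQ PP (mk rA rB))) ?\<tau> = (?\<tau>, to_bits (enc_qff e (map_qff tr (mk (ps (Suc k)) (second (ps k) u)))))"
  proof (rule run_Children[OF _ _ _ _ o tree_term])
    have "ok_qff ts cv ?\<tau>2 (mk rA rB)" using pos assms(3) by (intro ok) (auto simp: second_ps)
    moreover have "clean ?\<tau>2" using assms(1) by (simp add: no_scratch)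
    ultimately show "run (pad ts) (PQ PP (mk rA rB)) ?\<tau>2 = (?\<tau>2, to_bits (enc_qff e (map_qff tr (mk (ps (Suc k)) (second (ps k) u)))))"
      using run_PQ[OF pr] by (simp add: map_qff_inst inst second_ps)
    show "\<And>j. occ ts j (enc_term v) \<Longrightarrow> j < length ts \<and> ts ! j \<in> {5..11}" using occ_head(1) by fastforce
  qed (use assms(1) in \<open>simp_all add: st_def no_scratch\<close>)
  then show ?thesis using k by (simp add: skel_body_def)
qed

lemma run_skel_op: "k < length ts \<Longrightarrow> ts ! k \<in> {10, 11} \<Longrightarrow>
    run (pad ts) (skel_body PP mk) (\<sigma>(rT := ps k)) = (\<sigma>(rT := ps k), to_bits [ts ! k])"
  by (auto simp: skel_body_def)

lemma run_skel_nop: "k < length ts \<Longrightarrow> ts ! k < 9 \<Longrightarrow>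
    run (pad ts) (skel_body PP mk) (\<sigma>(rT := ps k)) = (\<sigma>(rT := ps k), [])"
  by (auto simp: skel_body_def)

lemma run_skel_pad: "j < 4 * length ts \<Longrightarrow> j mod 4 \<noteq> 3 \<Longrightarrow>
    run (pad ts) (skel_body PP mk) (\<sigma>(rT := j)) = (\<sigma>(rT := j), [])"
  by (simp add: skel_body_def nth_pad)

lemma split_len: "[0..<length ts] = [0..<h] @ [h..<a2] @ [a2..<a2 + length (enc_qff enc_term \<Phi>)]"
  using upt_split3[of 0 h "length ts"] upt_split3[of h a2 "length ts"] occ_Phi(2) by (simp add:)

lemma run_skel_None:
  assumes "st \<sigma>" "\<Psi> = None"
  shows "run (pad ts) (For rT (skel_body PP f_atom)) \<sigma> = (\<sigma>, to_bits (enc_qff e (map_qff tr (skel f_atom (middle s) \<Phi>))))"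
proof (rule run_For_pads[OF run_skel_pad])
  let ?F = "run (pad ts) (skel_body PP f_atom)"
  have "fl ?F rT (map ps [a2..<a2 + length (enc_qff enc_term \<Phi>)]) \<sigma> \<sigma> (to_bits (enc_qff e (map_qff tr (skel f_atom (ps a2) \<Phi>))))"
    by (rule skel_fl[where ns = "set ns" and ts = ts and lo = 0 and hi = "length ts"])
      (use assms occ_Phi ok_atom in \<open>auto simp: run_skel_op run_skel_nop ns_eq intro!: run_skel_node\<close>)
  moreover have "fl ?F rT (map ps [0..<h]) \<sigma> \<sigma> []"
    by (rule fl_silent) (use header in \<open>fastforce intro!: run_skel_nop\<close>)
  moreover have "h = a2" using assms by (simp add: enc_premise_def)
  ultimately show "fl ?F rT (map ps [0..<length ts]) \<sigma> \<sigma> (to_bits (enc_qff e (map_qff tr (skel f_atom (middle s) \<Phi>))))"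
    using fl_append[of ?F rT "map ps [0..<h]" \<sigma> \<sigma> "[]"] unfolding split_len by (simp add: middle_ps)
qed (use assms in \<open>simp_all add: st_def\<close>)

lemma run_skel_Psi:
  assumes "st \<sigma>" "\<Psi> = Some \<psi>" "\<sigma> rH = ps a2"
  shows "run (pad ts) (For rT (If (Less rT rH) (skel_body PP e_atom) Skip)) \<sigma> = (\<sigma>, to_bits (enc_qff e (map_qff tr (skel e_atom (start s) \<psi>))))"
proof (rule run_For_pads)
  let ?F = "run (pad ts) (If (Less rT rH) (skel_body PP e_atom) Skip)"
  have F: "?F (\<sigma>(rT := ps k)) = (if k < a2 then run (pad ts) (skel_body PP e_atom) (\<sigma>(rT := ps k)) else (\<sigma>(rT := ps k), []))" for k
    using assms(3) by simp
  have a: "a2 = h + length (enc_qff enc_term \<psi>)" using assms by (simp add: enc_premise_def)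
  have 2: "fl ?F rT (map ps [h..<a2]) \<sigma> \<sigma> (to_bits (enc_qff e (map_qff tr (skel e_atom (ps h) \<psi>))))"
    unfolding a
    by (rule skel_fl[where ns = "set ns" and ts = ts and lo = 0 and hi = a2])
      (use assms occ_Psi ok_atom a in \<open>auto simp: F run_skel_op run_skel_nop ns_eq enc_premise_def simp del: run.simps intro!: run_skel_node\<close>)
  have 1: "fl ?F rT (map ps [0..<h]) \<sigma> \<sigma> []"
    by (rule fl_silent) (use header in \<open>fastforce simp: F run_skel_nop simp del: run.simps\<close>)
  have 3: "fl ?F rT (map ps [a2..<a2 + length (enc_qff enc_term \<Phi>)]) \<sigma> \<sigma> []"
    by (rule fl_silent) (auto simp: F simp del: run.simps)
  show "fl ?F rT (map ps [0..<length ts]) \<sigma> \<sigma> (to_bits (enc_qff e (map_qff tr (skel e_atom (start s) \<psi>))))"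
    using fl_append[OF 1 fl_append[OF 2 3]] unfolding split_len by (simp add: start_ps)
  show "run (pad ts) (If (Less rT rH) (skel_body PP e_atom) Skip) (\<sigma>(rT := j)) = (\<sigma>(rT := j), [])"
    if "j < 4 * length ts" "j mod 4 \<noteq> 3" for \<sigma> j using run_skel_pad[OF that] by simp
qed (use assms in \<open>simp add: st_def\<close>)

lemma run_skel_Phi:
  assumes "st \<sigma>" "\<sigma> rH = ps a2"
  shows "run (pad ts) (For rT (If (Less rT rH) Skip (skel_body PP f_atom))) \<sigma> = (\<sigma>, to_bits (enc_qff e (map_qff tr (skel f_atom (middle s) \<Phi>))))"
proof (rule run_For_pads)
  let ?F = "run (pad ts) (If (Less rT rH) Skip (skel_body PP f_atom))"
  have F: "?F (\<sigma>(rT := ps k)) = (if k < a2 then (\<sigma>(rT := ps k), []) else run (pad ts) (skel_body PP f_atom) (\<sigma>(rT := ps k)))" for k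
    using assms(2) by simp
  have 2: "fl ?F rT (map ps [a2..<a2 + length (enc_qff enc_term \<Phi>)]) \<sigma> \<sigma> (to_bits (enc_qff e (map_qff tr (skel f_atom (ps a2) \<Phi>))))"
    by (rule skel_fl[where ns = "set ns" and ts = ts and lo = a2 and hi = "length ts"])
      (use assms occ_Phi ok_atom in \<open>auto simp: F run_skel_op run_skel_nop ns_eq simp del: run.simps intro!: run_skel_node\<close>)
  have 1: "fl ?F rT (map ps [0..<a2]) \<sigma> \<sigma> []"
    by (rule fl_silent) (auto simp: F simp del: run.simps)
  have "[0..<length ts] = [0..<a2] @ [a2..<a2 + length (enc_qff enc_term \<Phi>)]"
    using upt_split3[of 0 a2 "length ts"] occ_Phi(2) by simp
  then show "fl ?F rT (map ps [0..<length ts]) \<sigma> \<sigma> (to_bits (enc_qff e (map_qff tr (skel f_atom (middle s) \<Phi>))))"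
    using fl_append[OF 1 2] by (simp add: middle_ps)
  show "run (pad ts) (If (Less rT rH) Skip (skel_body PP f_atom)) (\<sigma>(rT := j)) = (\<sigma>(rT := j), [])"
    if "j < 4 * length ts" "j mod 4 \<noteq> 3" for \<sigma> j using run_skel_pad[OF that] by simp
qed (use assms in \<open>simp add: st_def\<close>)

lemma enc_Phi': "enc_qff e (map_qff tr (Phi' 3 ns p \<Phi>)) = concat (map (prt 10) (links 0 (leaves ns)))
     @ concat (map (prt 11) (concat (map (f_node 3 (leaves ns)) ns))) @ enc_qff e (map_qff tr (skel f_atom p \<Phi>))"
  unfolding Phi'_def enc_qff_foldr prt_def ..

lemma enc_Psi': "enc_qff e (map_qff tr (Psi' ns p \<psi>)) = concat (map (prt 10) (links 1 (leaves ns)))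
     @ concat (map (prt 10) (concat (map e_node ns))) @ enc_qff e (map_qff tr (skel e_atom p \<psi>))"
  unfolding Psi'_def enc_qff_foldr prt_def ..

lemma run_setM: "run W setM (\<lambda>_. 0) = ((\<lambda>_. 0)(rM := 3), [])"
  by (auto simp: setM_def)

theorem run_Prog:
  assumes C: "class_of s = C"
    and hdr: "\<And>\<sigma>. base \<sigma> \<Longrightarrow> run (pad ts) hdr \<sigma> = (\<sigma>, to_bits (enc_nat m' @ enc_nat n'))"
  shows "snd (run (pad ts) (Prog C hdr PP) (\<lambda>_. 0)) = to_bits (enc_sentence e (transf tr m' n' s))"
proof -
  let ?\<sigma> = "(\<lambda>_. 0)(rM := 3) :: regs"
  have b: "base ?\<sigma>" "st ?\<sigma>" by (simp_all add: base_def st_def clean_def scratch_def)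
  show ?thesis
  proof (cases s)
    case (S2 m1 n1 \<Phi>1)
    then have e: "\<Psi> = None" "C = Sigma2" "\<Phi>1 = \<Phi>" using split C by auto
    have t: "enc_sentence e (transf tr m' n' s) = [0] @ (enc_nat m' @ enc_nat n') @ enc_qff e (map_qff tr (Phi' 3 ns (middle s) \<Phi>))"
      using S2 e by (simp add: Let_def ns)
    show ?thesis
      unfolding t e(2) enc_Phi' Prog.simps to_bits_append
      by (simp only: run_Seq run_OutT fst_conv snd_conv run_setM hdr[OF b(1)] run_Links[OF b(2)] run_FNodes[OF b(2)]
          run_skel_None[OF b(2) e(1)] to_bits_append append_assoc append_Nil)
  next
    case (BS2 m1 n1 \<Phi>1)
    then have e: "\<Psi> = None" "C = BSigma2" "\<Phi>1 = \<Phi>" using split C by auto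
    have t: "enc_sentence e (transf tr m' n' s) = [1] @ (enc_nat m' @ enc_nat n') @ enc_qff e (map_qff tr (Phi' 3 ns (middle s) \<Phi>))"
      using BS2 e by (simp add: Let_def ns)
    show ?thesis
      unfolding t e(2) enc_Phi' Prog.simps to_bits_append
      by (simp only: run_Seq run_OutT fst_conv snd_conv run_setM hdr[OF b(1)] run_Links[OF b(2)] run_FNodes[OF b(2)]
          run_skel_None[OF b(2) e(1)] to_bits_append append_assoc append_Nil)
  next
    case (BS2pp m1 n1 \<psi> \<Phi>1)
    then have e: "\<Psi> = Some \<psi>" "C = BSigma2pp" "\<Phi>1 = \<Phi>" using split C by auto
    have t: "enc_sentence e (transf tr m' n' s) = [2] @ (enc_nat m' @ enc_nat n') @
        enc_qff e (map_qff tr (Psi' ns (start s) \<psi>)) @ enc_qff e (map_qff tr (Phi' 3 ns (middle s) \<Phi>))"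
      using BS2pp e by (simp add: Let_def ns)
    \<comment> \<open>Started at the class token, the search skips the digits of m and n, whose
      tokens are below 5; the first subtree it meets is \<Psi>, and the next head token is that of
      \<Phi>.\<close>
    have "run (pad ts) (FindB rM) ?\<sigma> = (?\<sigma>(rB := ps (h + length (enc_qff enc_term \<psi>))), [])"
    proof (rule run_FindB[where k = 0])
      show "clean ?\<sigma>" using b by (simp add: st_def)
      show "?\<sigma> rM = ps 0" by (simp add: ps_def)
      show "0 < length ts" "0 < h" using header[of 0] by (auto simp: h_def)
      show "occ ts h (enc_qff enc_term \<psi>)" using occ_Psi e(1) by (simp add: enc_premise_def)
      show "ts ! j < 5" if "0 < j" "j < h" for j using header[OF that(2)] by blast
      show "h + length (enc_qff enc_term \<psi>) < length ts" "ts ! (h + length (enc_qff enc_term \<psi>)) \<in> {5..11}"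
        using occ_head(2)[OF occ_Phi(1)] e(1) by (auto simp: enc_premise_def)
    qed (simp_all add: no_scratch tree_qff)
    moreover have "h + length (enc_qff enc_term \<psi>) = a2" using e(1) by (simp add: enc_premise_def)
    ultimately have f: "run (pad ts) (FindB rM) ?\<sigma> = (?\<sigma>(rB := ps a2), [])" by simp
    let ?\<tau> = "?\<sigma>(rH := ps a2)"
    have b2: "base ?\<tau>" "st ?\<tau>" "?\<tau> rH = ps a2" by (simp_all add: base_def st_def clean_def scratch_def)
    have g: "run (pad ts) (Seq (Copy rH rB) (Seq (Zero rB) d)) (?\<sigma>(rB := ps a2)) = run (pad ts) d ?\<tau>" for d
    proof -
      have "(?\<sigma>(rB := ps a2))(rH := ps a2, rB := 0) = ?\<tau>" by (intro ext) simp
      then show ?thesis by simp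
    qed
    define Q where "Q = Seq (OutT 2) (Seq hdr (Seq (Links PP 1) (Seq (ENodes PP) (Seq (For rT (If (Less rT rH) (skel_body PP e_atom) Skip))
       (Seq (Links PP 0) (Seq (FNodes PP) (For rT (If (Less rT rH) Skip (skel_body PP f_atom)))))))))"
    have "snd (run (pad ts) Q ?\<tau>) = to_bits (enc_sentence e (transf tr m' n' s))"
      unfolding t Q_def enc_Phi' enc_Psi'
      by (simp only: run_Seq run_OutT fst_conv snd_conv hdr[OF b2(1)] run_Links[OF b2(2)] run_FNodes[OF b2(2)] run_ENodes[OF b2(2)]
          run_skel_Psi[OF b2(2) e(1) b2(3)] run_skel_Phi[OF b2(2,3)] to_bits_append append_assoc)
    then show ?thesis
      unfolding e(2) Prog.simps Q_def[symmetric] run_Seq[of _ setM] run_setM run_Seq[of _ "FindB rM"] fst_conv snd_conv f g by simp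
  qed
qed

end

lemma enc_sentence_small: "\<forall>t \<in> set (enc_sentence enc_term s). t < 16"
proof -
  have l: "A \<subseteq> {..<16}" if "A \<subseteq> {0..4}" for A :: "nat set"
    using that by (rule subset_trans) auto
  have n: "set (enc_nat k) \<subseteq> {..<16}" "set (enc_int c) \<subseteq> {..<16}" for k c
    by (rule l[OF set_enc_nat]) (rule l[OF set_enc_int])
  have t: "set (enc_term t) \<subseteq> {..<16}" for t by (induction t) (simp_all add: n)
  have q: "set (enc_qff enc_term \<phi>) \<subseteq> {..<16}" for \<phi> by (induction \<phi>) (simp_all add: t)
  have "set (enc_sentence enc_term s) \<subseteq> {..<16}" by (cases s) (simp_all add: n q)
  then show ?thesis by auto
qed

text \<open>Program and transformation for an arbitrary output format, given by its printer, header
  and numbering of variables. The program is fixed in advance, while translation and numbering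
  depend on the input word \<open>ts\<close>.\<close>

lemma reduction:
  assumes PP: "\<And>P. wfout (PP P)" and wh: "wfc hdr"
    and pr: "\<And>ts cv. printer ts cv PP e (tr ts cv)"
    and hdr: "\<And>ts \<sigma>. base \<sigma> \<Longrightarrow> ts \<noteq> [] \<Longrightarrow> run (pad ts) hdr \<sigma> = (\<sigma>, to_bits (enc_nat (m' ts) @ enc_nat (n' ts)))"
    and i0: "\<And>ts k. k < 4 * length ts \<Longrightarrow> \<iota> ts 0 k < m' ts"
    and i1: "\<And>ts b k. 1 \<le> b \<Longrightarrow> b < 7 \<Longrightarrow> k < 4 * length ts \<Longrightarrow> m' ts \<le> \<iota> ts b k \<and> \<iota> ts b k < m' ts + n' ts"
    and iinj: "\<And>ts b k c l. b < 7 \<Longrightarrow> k < 4 * length ts \<Longrightarrow> c < 7 \<Longrightarrow> l < 4 * length ts \<Longrightarrow> \<iota> ts b k = \<iota> ts c l \<Longrightarrow> b = c \<and> k = l"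
    and ev: "\<And>ts cv P x. \<forall>m \<in> set P. good_mono (4 * length ts) 4 m \<Longrightarrow> ev (tr ts cv P) x = aeval cv (\<lambda>b k. x (\<iota> ts b k)) P"
    and vs: "\<And>ts cv P. vs (tr ts cv P) \<subseteq> (\<Union>m \<in> set P. (\<lambda>(b, k). \<iota> ts b k) ` set (snd m))"
    and dg: "\<And>ts cv P. \<forall>m \<in> set P. good_mono (4 * length ts) 4 m \<Longrightarrow> D (tr ts cv P)"
  shows "\<exists>f. poly_time_computable f \<and>
      (\<forall>s. in_class vars_term C s \<longrightarrow>
        (\<exists>s'. f (to_bits (enc_sentence enc_term s)) = to_bits (enc_sentence e s') \<and>
              in_class vs C s' \<and> (\<forall>p \<in> sentence_polys s'. D p) \<and> (holds ev s' \<longleftrightarrow> holds eval_term s)))"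
proof (intro exI conjI allI impI)
  show "poly_time_computable (\<lambda>w. snd (run (pre [] w) (Prog C hdr PP) (\<lambda>_. 0)))"
    by (rule poly_time_run[OF wfc_Prog[OF PP wh]])
  fix s assume C: "in_class vars_term C s"
  obtain m n \<Psi> \<Phi> where s: "split_sentence s = (m, n, \<Psi>, \<Phi>)" by (metis prod_cases4)
  define ts where "ts = enc_sentence enc_term s"
  let ?s' = "transf (tr ts (scval s)) (m' ts) (n' ts) s"
  have ne: "ts \<noteq> []" by (cases s) (auto simp: ts_def)
  have num: "numbered (snodes s) (scval s) 3 (fst (split_sentence s)) (\<iota> ts) (m' ts) (n' ts) (4 * length ts) (fst (snd (split_sentence s)))"
  proof (rule numbered_sentence[OF C])
    show "\<And>b k c l. b < 7 \<Longrightarrow> k < 4 * length ts \<Longrightarrow> c < 7 \<Longrightarrow> l < 4 * length ts \<Longrightarrow> \<iota> ts b k = \<iota> ts c l \<Longrightarrow> b = c \<and> k = l"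
      by (rule iinj)
  qed (use i0 i1 in \<open>simp_all add: ts_def\<close>)
  interpret numbered "snodes s" "scval s" 3 m "\<iota> ts" "m' ts" "n' ts" "4 * length ts" n
    using num by (simp add: s)
  interpret compile s ts m n \<Psi> \<Phi> "snodes s" "scval s" PP e "tr ts (scval s)"
    by unfold_locales (simp_all add: ts_def s pos[unfolded ts_def] pr)
  have "snd (run (pad ts) (Prog C hdr PP) (\<lambda>_. 0)) = to_bits (enc_sentence e ?s')"
    by (rule run_Prog[OF in_class_class_of[OF C] hdr[OF _ ne]])
  then show "snd (run (pre [] (to_bits (enc_sentence enc_term s))) (Prog C hdr PP) (\<lambda>_. 0)) = to_bits (enc_sentence e ?s')"
    using pre_to_bits[OF enc_sentence_small] by (simp add: ts_def)
  have t: "in_class vs C ?s' \<and> (\<forall>p \<in> sentence_polys ?s'. D p) \<and> (holds ev ?s' \<longleftrightarrow> holds eval_term s)"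
  proof (rule transf_correct[OF C num])
    show "\<And>P x. \<forall>m \<in> set P. good_mono (4 * length ts) 4 m \<Longrightarrow> ev (tr ts (scval s) P) x = aeval (scval s) (\<lambda>b k. x (\<iota> ts b k)) P"
      by (rule ev)
    show "\<And>P. vs (tr ts (scval s) P) \<subseteq> (\<Union>m \<in> set P. (\<lambda>(b, k). \<iota> ts b k) ` set (snd m))" by (rule vs)
    show "\<And>P. \<forall>m \<in> set P. good_mono (4 * length ts) 4 m \<Longrightarrow> D (tr ts (scval s) P)" by (rule dg)
  qed
  show "in_class vs C ?s'" using t by (rule conjunct1)
  show "\<forall>p \<in> sentence_polys ?s'. D p" using t[THEN conjunct2] by (rule conjunct1)
  show "holds ev ?s' \<longleftrightarrow> holds eval_term s" using t[THEN conjunct2] by (rule conjunct2)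
qed

lemma block_bounds:
  assumes "k < (N :: nat)"
  shows "b * N + k < Suc b * N" "b < 7 \<Longrightarrow> b * N + k < 7 * N" "1 \<le> b \<Longrightarrow> N \<le> b * N + k"
proof -
  show 1: "b * N + k < Suc b * N" using assms by simp
  show "b * N + k < 7 * N" if "b < 7"
    using 1 mult_le_mono1[of "Suc b" 7 N] that by linarith
  show "N \<le> b * N + k" if "1 \<le> b" using mult_le_mono1[OF that, of N] by linarith
qed

text \<open>Uniqueness of quotient and remainder on division by \<open>N\<close>, which makes the
  numbering by block and position injective.\<close>

lemma block_inj:
  assumes "k < (N :: nat)" "l < N" "b * N + k = c * N + l"
  shows "b = c \<and> k = l"
proof -
  have dv: "(c * N + x) div N = c" if "x < N" for c x :: nat
    using that div_mult_self1[of N x c] by (simp add: add.commute)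
  have "b = c" using dv[OF assms(1), of b] dv[OF assms(2), of c] unfolding assms(3) by (rule trans[OF sym])
  then show ?thesis using assms(3) by simp
qed

lemma in_range:
  assumes "\<forall>m \<in> set P. good_mono N 4 m" "\<And>b k. b < 7 \<Longrightarrow> k < N \<Longrightarrow> \<iota> b k < l"
  shows "\<forall>m \<in> set P. \<forall>(b, k) \<in> set (snd m). \<iota> b k < (l :: nat)" "\<forall>m \<in> set P. length (snd m) \<le> 4"
  using assms by (fastforce simp: good_mono_def)+

theorem mainTheorem12:
  fixes C :: sclass
  shows
  "(\<exists>f. poly_time_computable f \<and>
      (\<forall>s. in_class vars_term C s \<longrightarrow>
        (\<exists>s'. f (to_bits (enc_sentence enc_term s)) = to_bits (enc_sentence enc_term s') \<and>
              in_class vars_term C s' \<and>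
              (\<forall>p \<in> sentence_polys s'. term_deg_le p 4) \<and>
              (holds eval_term s' \<longleftrightarrow> holds eval_term s))))
   \<and>
   (\<exists>g. poly_time_computable g \<and>
      (\<forall>s. in_class vars_term C s \<longrightarrow>
        (\<exists>s'. g (to_bits (enc_sentence enc_term s)) = to_bits (enc_sentence enc_std s') \<and>
              in_class vars_std C s' \<and>
              (\<forall>P \<in> sentence_polys s'. std_deg_le P 4) \<and>
              (holds eval_std s' \<longleftrightarrow> holds eval_term s))))"
proof
  show "\<exists>f. poly_time_computable f \<and>
      (\<forall>s. in_class vars_term C s \<longrightarrow>
        (\<exists>s'. f (to_bits (enc_sentence enc_term s)) = to_bits (enc_sentence enc_term s') \<and>
              in_class vars_term C s' \<and>
              (\<forall>p \<in> sentence_polys s'. term_deg_le p 4) \<and>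
              (holds eval_term s' \<longleftrightarrow> holds eval_term s)))"
  \<comment> \<open>Indices and numbers of variables are exponential in the length of the input, but
    in binary they have linearly many digits. Only polynomially many of the quantified variables
    occur.\<close>
  proof (rule reduction[where PP = PPolyT and hdr = HeadT and tr = "\<lambda>ts. tr_term (iT ts)" and \<iota> = iT
        and m' = "\<lambda>ts. 2 ^ (4 * length ts)" and n' = "\<lambda>ts. 2 ^ (7 * (4 * length ts))"])
    fix ts :: "nat list" and b k c l :: nat
    have "(2 :: nat) ^ x \<le> 2 ^ y" if "x \<le> y" for x y :: nat using that by (rule power_increasing) simp
    note pw = this
    have pl: "(2 :: nat) ^ x < 2 ^ y" if "x < y" for x y :: nat using that by (rule power_strict_increasing) simp
    show "iT ts 0 k < 2 ^ (4 * length ts)" if "k < 4 * length ts" using pl[OF that] by (simp add: iT_def)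
    show "2 ^ (4 * length ts) \<le> iT ts b k \<and> iT ts b k < 2 ^ (4 * length ts) + 2 ^ (7 * (4 * length ts))"
      if "1 \<le> b" "b < 7" "k < 4 * length ts"
      unfolding iT_def using pw[OF block_bounds(3)[OF that(3,1)]] pl[OF block_bounds(2)[OF that(3,2)]] by linarith
    show "b = c \<and> k = l" if "b < 7" "k < 4 * length ts" "c < 7" "l < 4 * length ts" "iT ts b k = iT ts c l"
    proof (rule block_inj[OF that(2,4)])
      show "b * (4 * length ts) + k = c * (4 * length ts) + l" using that(5) unfolding iT_def by (simp only: power_inject_exp)
    qed
    show "term_deg_le (tr_term (iT ts) cv P) 4" if "\<forall>m \<in> set P. good_mono (4 * length ts) 4 m" for cv P
    proof -
      have "iT ts b k < 2 ^ (7 * (4 * length ts))" if "b < 7" "k < 4 * length ts" for b k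
        unfolding iT_def using pl[OF block_bounds(2)[OF that(2,1)]] .
      from in_range[OF that this] show ?thesis by (intro term_deg_tr_term)
    qed
  qed (rule wfout_PPolyT wfc_HeadT printer_T run_HeadT eval_tr_term vars_tr_term | assumption)+
next
  show "\<exists>g. poly_time_computable g \<and>
      (\<forall>s. in_class vars_term C s \<longrightarrow>
        (\<exists>s'. g (to_bits (enc_sentence enc_term s)) = to_bits (enc_sentence enc_std s') \<and>
              in_class vars_std C s' \<and>
              (\<forall>P \<in> sentence_polys s'. std_deg_le P 4) \<and>
              (holds eval_std s' \<longleftrightarrow> holds eval_term s)))"
  \<comment> \<open>A multi-index lists an exponent for every variable of the seven blocks, so the
    indices have to stay linear in the length of the input; only the header then contains computed
    numbers in binary.\<close>
  proof (rule reduction[where PP = PPolyS and hdr = HeadS and tr = "\<lambda>ts. tr_std (iS ts) (7 * (4 * length ts))" and \<iota> = iS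
        and m' = "\<lambda>ts. 4 * length ts" and n' = "\<lambda>ts. 8 * (4 * length ts)"])
    fix ts :: "nat list" and b k c l :: nat
    show "iS ts 0 k < 4 * length ts" if "k < 4 * length ts" using that by (simp add: iS_def)
    show "4 * length ts \<le> iS ts b k \<and> iS ts b k < 4 * length ts + 8 * (4 * length ts)"
      if "1 \<le> b" "b < 7" "k < 4 * length ts"
      unfolding iS_def using block_bounds(3)[OF that(3,1)] block_bounds(2)[OF that(3,2)] by linarith
    show "b = c \<and> k = l" if "b < 7" "k < 4 * length ts" "c < 7" "l < 4 * length ts" "iS ts b k = iS ts c l"
      using block_inj[OF that(2,4)] that(5) unfolding iS_def by blast
    show "eval_std (tr_std (iS ts) (7 * (4 * length ts)) cv P) x = aeval cv (\<lambda>b k. x (iS ts b k)) P"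
      if "\<forall>m \<in> set P. good_mono (4 * length ts) 4 m" for cv P x
      by (rule eval_tr_std, rule in_range[OF that]) (simp only: iS_def block_bounds)
    show "std_deg_le (tr_std (iS ts) (7 * (4 * length ts)) cv P) 4" if "\<forall>m \<in> set P. good_mono (4 * length ts) 4 m" for cv P
      by (rule std_deg_tr_std) (use that in \<open>auto simp: good_mono_def\<close>)
  qed (rule wfout_PPolyS wfc_HeadS printer_S run_HeadS vars_tr_std | assumption)+
qed

end
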